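(* For every $n\ge 1$ and every weight vector $\lambda\in\Lambda$, the difference of quadratic risks $$\Delta_Q(S):=\mathcal R_Q(S^*_\lambda,S)-\mathcal R_Q(\widehat S_\lambda,S)$$ satisfies $$\sup_{Q\in\mathcal Q_n}\ \sup_{\|S\|\le r_n}\Delta_Q(S)\le -c_n^2,\qquad c_n=c_n(\lambda).$$
   Context: Model. Let $\Pi$ be a fixed positive (Lévy) measure on $\mathbb R_0=\mathbb R\setminus\{0\}$ with $\int x^2\,\Pi(dx)=1$ and $\int x^6\,\Pi(dx)<\infty$ ($\Pi(\mathbb R_0)=+\infty$ is allowed). Let $(w_t)$ be a standard Brownian motion and $\mu(ds\,dx)$ a jump (Poisson random) measure independent of $w$ with deterministic compensator $\widetilde\mu(ds\,dx)=ds\,\Pi(dx)$. Put $z_t=\int_0^t\int_{\mathbb R_0}x\,(\mu-\widetilde\mu)(ds\,dx)$ and $\xi_t=\sigma_1w_t+\sigma_2z_t$ with constants $\sigma_1,\sigma_2$. One observes $(y_t)_{0\le t\le n}$ with $dy_t=S(t)\,dt+d\xi_t$, where $S:\mathbb R\to\mathbb R$ is an unknown 1-periodic function, square integrable on $[0,1]$. $Q$ denotes the law of $(\xi_t)_{0\le t\le n}$ on the Skorokhod space $D[0,n]$, and $\mathcal Q_n$ is the family of all such laws with $0<\underline\sigma_n\le\sigma_1^2$ and $\sigma:=\sigma_1^2+\sigma_2^2\le\overline\sigma_n$, where $0<\underline\sigma_n\le\overline\sigma_n$ are given and satisfy, for every $\epsilon>0$, $\liminf_{n\to\infty} n^{\epsilon}\underline\sigma_n>0$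 and $\lim_{n\to\infty} n^{-\epsilon}\overline\sigma_n=0$. $\mathbf E_{Q,S}$ is the expectation under the law of $y$ for noise law $Q$ and signal $S$; $\|S\|^2=\int_0^1S^2(t)\,dt$; for an estimator $\widehat S$, $\mathcal R_Q(\widehat S,S)=\mathbf E_{Q,S}\|\widehat S-S\|^2$. Estimators. $(\phi_j)_{j\ge1}$ is an orthonormal basis of $L_2[0,1]$, extended 1-periodically to $\mathbb R$, with $\sup_{1\le j\le n}\sup_{0\le t\le1}|\phi_j(t)|\le\overline\phi_n<\infty$. $\widehat\theta_j=\frac1n\int_0^n\phi_j(t)\,dy_t$. $\Lambda\subset[0,1]^n$ is a finite set of weight vectors $\lambda=(\lambda(j))_{1\le j\le n}$ such that for every $\lambda\in\Lambda$ there is an integer $d=d(\lambda)$, $1\le d\le n$, with $\lambda(j)=1$ for $1\le j\le d$. The weighted least squares estimator is $\widehat S_\lambda=\sum_{j=1}^n\lambda(j)\widehat\theta_j\phi_j$. The shrinkage estimator is $S^*_\lambda=\sum_{j=1}^n\lambda(j)\theta^*_{\lambda,j}\phi_j$ with $\theta^*_{\lambda,j}=(1-g_\lambda(j))\widehat\theta_j$, $g_\lambda(j)=\frac{c_n}{|\widetilde\theta_n|_d}\mathbf 1_{\{1\le j\le d\}}$, $\widetilde\theta_n=(\widehat\theta_j)_{1\le j\le d}$, $|x|_d^2=\sum_{j=1}^dx_j^2$, and $$c_n=c_n(\lambda)=\frac{(d-1)\,\underline\sigma_n}{\left(r_n+\sqrt{d\,\overline\sigma_n/n}\right)n}.$$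 Here $r_n>0$ satisfies $r_n\to\infty$ and $r_n/n^{\epsilon}\to0$ as $n\to\infty$ for every $\epsilon>0$. *)

theory Defs
  imports "HOL-Probability.Probability"
begin

section \<open>Square integrable functions\<close>

definition square_integrable_on :: "(real \<Rightarrow> real) \<Rightarrow> real set \<Rightarrow> bool" where
  "square_integrable_on f A \<longleftrightarrow>
     f \<in> borel_measurable (lebesgue_on A) \<and> integrable (lebesgue_on A) (\<lambda>t. (f t)\<^sup>2)"

definition L2_inner :: "(real \<Rightarrow> real) \<Rightarrow> (real \<Rightarrow> real) \<Rightarrow> real" where
  "L2_inner f g = (\<integral>t. f t * g t \<partial>lebesgue_on {0..1})"

definition L2_norm :: "(real \<Rightarrow> real) \<Rightarrow> real" where
  "L2_norm f = sqrt (\<integral>t. (f t)\<^sup>2 \<partial>lebesgue_on {0..1})"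

definition L2_tendsto :: "'a measure \<Rightarrow> (nat \<Rightarrow> 'a \<Rightarrow> real) \<Rightarrow> ('a \<Rightarrow> real) \<Rightarrow> bool" where
  "L2_tendsto M X Y \<longleftrightarrow>
     (\<forall>k. X k \<in> borel_measurable M) \<and> Y \<in> borel_measurable M \<and>
     (\<lambda>k. \<integral>\<^sup>+\<omega>. ennreal ((X k \<omega> - Y \<omega>)\<^sup>2) \<partial>M) \<longlonglongrightarrow> 0"

definition one_periodic :: "(real \<Rightarrow> real) \<Rightarrow> bool" where
  "one_periodic f \<longleftrightarrow> (\<forall>t. f (t + 1) = f t)"

definition periodic_orthonormal_basis :: "(nat \<Rightarrow> real \<Rightarrow> real) \<Rightarrow> bool" where
  "periodic_orthonormal_basis \<phi> \<longleftrightarrow>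
     (\<forall>j\<ge>1. one_periodic (\<phi> j) \<and> square_integrable_on (\<phi> j) {0..1}) \<and>
     (\<forall>i\<ge>1. \<forall>j\<ge>1. L2_inner (\<phi> i) (\<phi> j) = (if i = j then 1 else 0)) \<and>
     (\<forall>f. square_integrable_on f {0..1} \<longrightarrow>
        (\<lambda>N. L2_norm (\<lambda>t. f t - (\<Sum>j=1..N. L2_inner f (\<phi> j) * \<phi> j t))) \<longlonglongrightarrow> 0)"

section \<open>The noise process\<close>

definition standard_brownian_motion :: "'a measure \<Rightarrow> (real \<Rightarrow> 'a \<Rightarrow> real) \<Rightarrow> bool" where
  "standard_brownian_motion M w \<longleftrightarrow>
     (\<forall>t\<ge>0. w t \<in> borel_measurable M) \<and>
     (\<forall>\<omega>\<in>space M. w 0 \<omega> = 0) \<and>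
     (\<forall>\<omega>\<in>space M. continuous_on {0..} (\<lambda>t. w t \<omega>)) \<and>
     (\<forall>s t. 0 \<le> s \<and> s < t \<longrightarrow>
        distributed M lborel (\<lambda>\<omega>. w t \<omega> - w s \<omega>) (normal_density 0 (sqrt (t - s)))) \<and>
     (\<forall>\<tau> m. 0 \<le> \<tau> 0 \<and> incseq \<tau> \<longrightarrow>
        prob_space.indep_vars M (\<lambda>_. borel)
          (\<lambda>i \<omega>. w (\<tau> (Suc i)) \<omega> - w (\<tau> i) \<omega>) {..<m::nat})"

definition levy_measure_space :: "real measure \<Rightarrow> bool" where
  "levy_measure_space levy \<longleftrightarrow>
     sets levy = sets (restrict_space borel (UNIV - {0})) \<and>
     (\<integral>\<^sup>+x. ennreal (x ^ 2) \<partial>levy) = 1 \<and> (\<integral>\<^sup>+x. ennreal (x ^ 6) \<partial>levy) < \<infinity>"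

definition jump_compensator :: "real measure \<Rightarrow> (real \<times> real) measure" where
  "jump_compensator levy = restrict_space lborel {0..} \<Otimes>\<^sub>M levy"

definition poisson_random_measure ::
  "'a measure \<Rightarrow> ('a \<Rightarrow> 'b measure) \<Rightarrow> 'b measure \<Rightarrow> bool" where
  "poisson_random_measure M \<mu> \<nu> \<longleftrightarrow>
     (\<forall>\<omega>\<in>space M. sets (\<mu> \<omega>) = sets \<nu>) \<and>
     (\<forall>A\<in>sets \<nu>. (\<lambda>\<omega>. emeasure (\<mu> \<omega>) A) \<in> borel_measurable M) \<and>
     (\<forall>A\<in>sets \<nu>. emeasure \<nu> A < \<infinity> \<longrightarrow>
        (\<forall>k::nat. measure M {\<omega>\<in>space M. emeasure (\<mu> \<omega>) A = of_nat k}
            = exp (- measure \<nu> A) * measure \<nu> A ^ k / fact k)) \<and>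
     (\<forall>A\<in>sets \<nu>. emeasure \<nu> A = \<infinity> \<longrightarrow> (AE \<omega> in M. emeasure (\<mu> \<omega>) A = \<infinity>)) \<and>
     (\<forall>A m. (\<forall>i<m. A i \<in> sets \<nu>) \<and> disjoint_family_on A {..<m} \<longrightarrow>
        prob_space.indep_vars M (\<lambda>_. borel) (\<lambda>i \<omega>. emeasure (\<mu> \<omega>) (A i)) {..<m::nat})"

definition brownian_jump_independent ::
  "'a measure \<Rightarrow> (real \<Rightarrow> 'a \<Rightarrow> real) \<Rightarrow> ('a \<Rightarrow> 'b measure) \<Rightarrow> 'b measure \<Rightarrow> bool" where
  "brownian_jump_independent M w \<mu> \<nu> \<longleftrightarrow>
     prob_space.indep_set M
       (sigma_sets (space M) {w t -` B \<inter> space M | t B. 0 \<le> t \<and> B \<in> sets borel})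
       (sigma_sets (space M)
          {(\<lambda>\<omega>. emeasure (\<mu> \<omega>) A) -` B \<inter> space M | A B. A \<in> sets \<nu> \<and> B \<in> sets borel})"

text \<open>A list of pairs \<open>(a, A)\<close> stands for the simple function \<open>\<Sum> a * indicator A\<close>.
  For deterministic square integrable \<open>h\<close> the integral of \<open>h\<close> against \<open>\<mu> - \<nu>\<close> is the mean square
  limit of the elementary integrals of simple functions converging to \<open>h\<close> in \<open>L\<^sup>2(\<nu>)\<close>.
  By the isometry the limit does not depend, up to null sets, on the approximating sequence.\<close>

definition simple_fun :: "(real \<times> 'b set) list \<Rightarrow> 'b \<Rightarrow> real" where
  "simple_fun p u = (\<Sum>(a, A)\<leftarrow>p. a * indicator A u)"

definition simple_compensated_integral ::
  "('a \<Rightarrow> 'b measure) \<Rightarrow> 'b measure \<Rightarrow> (real \<times> 'b set) list \<Rightarrow> 'a \<Rightarrow> real" where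
  "simple_compensated_integral \<mu> \<nu> p \<omega> = (\<Sum>(a, A)\<leftarrow>p. a * (measure (\<mu> \<omega>) A - measure \<nu> A))"

definition has_compensated_integral ::
  "'a measure \<Rightarrow> ('a \<Rightarrow> 'b measure) \<Rightarrow> 'b measure \<Rightarrow> ('b \<Rightarrow> real) \<Rightarrow> ('a \<Rightarrow> real) \<Rightarrow> bool" where
  "has_compensated_integral M \<mu> \<nu> h X \<longleftrightarrow>
     (\<exists>p. (\<forall>k. \<forall>(a, A)\<in>set (p k). A \<in> sets \<nu> \<and> emeasure \<nu> A < \<infinity>) \<and>
          L2_tendsto \<nu> (\<lambda>k. simple_fun (p k)) h \<and>
          L2_tendsto M (\<lambda>k. simple_compensated_integral \<mu> \<nu> (p k)) X)"

definition cadlag_on :: "real set \<Rightarrow> (real \<Rightarrow> real) \<Rightarrow> bool" where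
  "cadlag_on I f \<longleftrightarrow>
     (\<forall>t\<in>I. (f \<longlongrightarrow> f t) (at t within (I \<inter> {t<..}))) \<and>
     (\<forall>t\<in>I. \<exists>l. (f \<longlongrightarrow> l) (at t within (I \<inter> {..<t})))"

text \<open>For each \<open>t\<close> the compensated integral is determined only up to a null set;
  the process is a version with right-continuous paths with left limits.\<close>

definition compensated_jump_process ::
  "'a measure \<Rightarrow> ('a \<Rightarrow> (real \<times> real) measure) \<Rightarrow> (real \<times> real) measure
     \<Rightarrow> (real \<Rightarrow> 'a \<Rightarrow> real) \<Rightarrow> bool" where
  "compensated_jump_process M \<mu> \<nu> z \<longleftrightarrow>
     (\<forall>t\<ge>0. has_compensated_integral M \<mu> \<nu> (\<lambda>(s, x). indicator {0<..t} s * x) (z t)) \<and>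
     (\<forall>\<omega>\<in>space M. cadlag_on {0..} (\<lambda>t. z t \<omega>))"

text \<open>The Borel sets of the Skorokhod topology on \<open>D[0,T]\<close> are those generated by the coordinate
  maps. Paths are extended by \<open>undefined\<close> outside \<open>[0,T]\<close>.\<close>

definition skorokhod_space :: "real \<Rightarrow> (real \<Rightarrow> real) measure" where
  "skorokhod_space T = restrict_space (Pi\<^sub>M {0..T} (\<lambda>_. borel)) {f. cadlag_on {0..T} f}"

text \<open>The type argument is the type of the sample points of the underlying probability space.\<close>

definition noise_laws ::
  "'a itself \<Rightarrow> real measure \<Rightarrow> real \<Rightarrow> real \<Rightarrow> real \<Rightarrow> (real \<Rightarrow> real) measure set" where
  "noise_laws ty levy T lo hi =
     {Q. \<exists>(M :: 'a measure) w \<mu> z \<sigma>\<^sub>1 \<sigma>\<^sub>2.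
        prob_space M \<and>
        standard_brownian_motion M w \<and>
        poisson_random_measure M \<mu> (jump_compensator levy) \<and>
        brownian_jump_independent M w \<mu> (jump_compensator levy) \<and>
        compensated_jump_process M \<mu> (jump_compensator levy) z \<and>
        lo \<le> \<sigma>\<^sub>1\<^sup>2 \<and> \<sigma>\<^sub>1\<^sup>2 + \<sigma>\<^sub>2\<^sup>2 \<le> hi \<and>
        Q = distr M (skorokhod_space T) (\<lambda>\<omega>. \<lambda>t\<in>{0..T}. \<sigma>\<^sub>1 * w t \<omega> + \<sigma>\<^sub>2 * z t \<omega>)}"

section \<open>Observations and estimators\<close>

definition observation_law ::
  "real \<Rightarrow> (real \<Rightarrow> real) measure \<Rightarrow> (real \<Rightarrow> real) \<Rightarrow> (real \<Rightarrow> real) measure" where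
  "observation_law T Q S =
     distr Q (skorokhod_space T) (\<lambda>\<xi>. \<lambda>t\<in>{0..T}. (\<integral>s. S s \<partial>lebesgue_on {0..t}) + \<xi> t)"

text \<open>A list of triples \<open>(a, s, u)\<close> stands for the step function \<open>\<Sum> a * indicator {s<..u}\<close>.
  The integral of a deterministic square integrable function against the coordinate process
  under \<open>P\<close> is the mean square limit of the integrals of approximating step functions.
  It is determined up to \<open>P\<close>-null sets, and \<open>stochastic_integral\<close> is a fixed version.\<close>

definition step_fun :: "(real \<times> real \<times> real) list \<Rightarrow> real \<Rightarrow> real" where
  "step_fun p t = (\<Sum>(a, s, u)\<leftarrow>p. a * indicator {s<..u} t)"

definition step_integral :: "(real \<times> real \<times> real) list \<Rightarrow> (real \<Rightarrow> real) \<Rightarrow> real" where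
  "step_integral p y = (\<Sum>(a, s, u)\<leftarrow>p. a * (y u - y s))"

definition has_stochastic_integral ::
  "(real \<Rightarrow> real) measure \<Rightarrow> real \<Rightarrow> (real \<Rightarrow> real) \<Rightarrow> ((real \<Rightarrow> real) \<Rightarrow> real) \<Rightarrow> bool" where
  "has_stochastic_integral P T f X \<longleftrightarrow>
     (\<exists>p. (\<forall>k. \<forall>(a, s, u)\<in>set (p k). 0 \<le> s \<and> s \<le> u \<and> u \<le> T) \<and>
          L2_tendsto (lebesgue_on {0..T}) (\<lambda>k. step_fun (p k)) f \<and>
          L2_tendsto P (\<lambda>k. step_integral (p k)) X)"

definition stochastic_integral ::
  "(real \<Rightarrow> real) measure \<Rightarrow> real \<Rightarrow> (real \<Rightarrow> real) \<Rightarrow> (real \<Rightarrow> real) \<Rightarrow> real" where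
  "stochastic_integral P T f = (SOME X. has_stochastic_integral P T f X)"

definition theta_hat ::
  "(real \<Rightarrow> real) measure \<Rightarrow> nat \<Rightarrow> (nat \<Rightarrow> real \<Rightarrow> real) \<Rightarrow> nat \<Rightarrow> (real \<Rightarrow> real) \<Rightarrow> real" where
  "theta_hat P n \<phi> j y = stochastic_integral P (real n) (\<phi> j) y / real n"

definition weighted_lse ::
  "(real \<Rightarrow> real) measure \<Rightarrow> nat \<Rightarrow> (nat \<Rightarrow> real \<Rightarrow> real) \<Rightarrow> (nat \<Rightarrow> real)
     \<Rightarrow> (real \<Rightarrow> real) \<Rightarrow> real \<Rightarrow> real" where
  "weighted_lse P n \<phi> lam y t = (\<Sum>j=1..n. lam j * theta_hat P n \<phi> j y * \<phi> j t)"

definition shrinkage_weight ::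
  "(real \<Rightarrow> real) measure \<Rightarrow> nat \<Rightarrow> (nat \<Rightarrow> real \<Rightarrow> real) \<Rightarrow> nat \<Rightarrow> real
     \<Rightarrow> nat \<Rightarrow> (real \<Rightarrow> real) \<Rightarrow> real" where
  "shrinkage_weight P n \<phi> d c j y =
     c / L2_set (\<lambda>i. theta_hat P n \<phi> i y) {1..d} * indicator {1..d} j"

definition shrinkage_estimator ::
  "(real \<Rightarrow> real) measure \<Rightarrow> nat \<Rightarrow> (nat \<Rightarrow> real \<Rightarrow> real) \<Rightarrow> (nat \<Rightarrow> real) \<Rightarrow> nat \<Rightarrow> real
     \<Rightarrow> (real \<Rightarrow> real) \<Rightarrow> real \<Rightarrow> real" where
  "shrinkage_estimator P n \<phi> lam d c y t =
     (\<Sum>j=1..n. lam j * ((1 - shrinkage_weight P n \<phi> d c j y) * theta_hat P n \<phi> j y) * \<phi> j t)"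

definition shrinkage_const :: "nat \<Rightarrow> nat \<Rightarrow> real \<Rightarrow> real \<Rightarrow> real \<Rightarrow> real" where
  "shrinkage_const n d lo hi r =
     (real d - 1) * lo / ((r + sqrt (real d * hi / real n)) * real n)"

definition quadratic_risk ::
  "(real \<Rightarrow> real) measure \<Rightarrow> ((real \<Rightarrow> real) \<Rightarrow> real \<Rightarrow> real) \<Rightarrow> (real \<Rightarrow> real) \<Rightarrow> ereal" where
  "quadratic_risk P est S =
     enn2ereal (\<integral>\<^sup>+y. ennreal ((L2_norm (\<lambda>t. est y t - S t))\<^sup>2) \<partial>P)"

text \<open>In \<open>ereal\<close> one has \<open>\<infinity> - \<infinity> = \<infinity>\<close>, so a real upper bound for this difference
  entails that the risk of the shrinkage estimator is finite.\<close>

definition risk_difference ::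
  "nat \<Rightarrow> (nat \<Rightarrow> real \<Rightarrow> real) \<Rightarrow> (nat \<Rightarrow> real) \<Rightarrow> nat \<Rightarrow> real
     \<Rightarrow> (real \<Rightarrow> real) measure \<Rightarrow> (real \<Rightarrow> real) \<Rightarrow> ereal" where
  "risk_difference n \<phi> lam d c Q S =
     (let P = observation_law (real n) Q S in
        quadratic_risk P (shrinkage_estimator P n \<phi> lam d c) S
        - quadratic_risk P (weighted_lse P n \<phi> lam) S)"

definition signals :: "(real \<Rightarrow> real) set" where
  "signals = {S. one_periodic S \<and> square_integrable_on S {0..1}}"

end

(* Write theta_hat - theta = N and h(x) = x / |x|, on the first d coordinates. Expanding the squares,
   the difference of the risks is at most c^2 - 2 c E[h(theta + N) . N], so it suffices to show
   E[h(theta + N) . N] >= c. The noise N = G + V splits into a Gaussian part G (from the Brownian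
   motion) and an independent centred part V (from the jumps).

   Jumps: h is the gradient of a convex function, hence monotone, so conditionally on G
   E[h(theta + G + V) . V] >= E[h(theta + G) . V] = 0.

   Gaussian part: conditionally on V, Stein's identity gives
   E[h(theta + G + V) . G] = (sigma_1^2 / n) E[div h(theta_hat)] = (sigma_1^2 / n) (d - 1) E[1 / |theta_hat|],
   and E[1 / |theta_hat|] >= 1 / R as soon as E|theta_hat|^2 <= R^2, by convexity of t |-> t^(-1/2).

   To avoid the singularity of h at 0, |x| is replaced by sqrt (eps^2 + |x|^2) with eps -> 0. The
   identities are proved for step integrals of the Brownian motion over a uniform grid and for
   compensated integrals of simple functions, and carried over to mean square limits. *)

theory Submission
  imports Defs
begin

section \<open>Square integrable functions and mean square limits\<close>

text \<open>The obstacle is that the random objects here are mean square limits, fixed only up to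
  null sets: the jump process, the stochastic integrals, hence \<open>theta_hat\<close>.
  Independence of the Brownian and the jump part, on which both conditional arguments rest, is
  available only for approximants. So the estimate is proved for these, in a form built from second
  moments, inner products and Lipschitz functions of the coordinates, all of which pass to the
  limit. The price depends on \<epsilon>: step functions approximating the basis are orthogonal only
  in the limit, and the defect of their Gram matrix enters Stein's identity with a factor of order
  1/\<epsilon>, which is also the order of the Lipschitz constant. Hence the mean square limit is
  taken at fixed \<epsilon>, and \<epsilon> tends to 0 afterwards. The integrals are not divided by
  n until the end. The second moment of the first d of them is at most n^2 (r_n^2 + d hi / n), and R
  = n (r_n + sqrt (d hi / n)) is chosen so that its square exceeds this by a cross term, which makes
  room for \<open>\<epsilon>\<^sup>2\<close>. Finally c_n = (d - 1) lo / R.\<close>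

definition sqint :: "'a measure \<Rightarrow> ('a \<Rightarrow> real) \<Rightarrow> bool" where
  "sqint M X \<longleftrightarrow> X \<in> borel_measurable M \<and> integrable M (\<lambda>x. (X x)\<^sup>2)"

lemma sqint_measurable: "sqint M X \<Longrightarrow> X \<in> borel_measurable M"
  and sqint_square: "sqint M X \<Longrightarrow> integrable M (\<lambda>x. (X x)\<^sup>2)"
  by (auto simp: sqint_def)

lemma square_integrable_on_iff: "square_integrable_on f A \<longleftrightarrow> sqint (lebesgue_on A) f"
  by (simp add: square_integrable_on_def sqint_def)

lemma abs_mult_le_squares: "\<bar>a * b :: real\<bar> \<le> a\<^sup>2 + b\<^sup>2"
proof -
  have "2 * (\<bar>a\<bar> * \<bar>b\<bar>) \<le> \<bar>a\<bar>\<^sup>2 + \<bar>b\<bar>\<^sup>2"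
    using sum_squares_bound[of "\<bar>a\<bar>" "\<bar>b\<bar>"] by simp
  moreover have "0 \<le> \<bar>a\<bar> * \<bar>b\<bar>" by simp
  ultimately have "\<bar>a\<bar> * \<bar>b\<bar> \<le> \<bar>a\<bar>\<^sup>2 + \<bar>b\<bar>\<^sup>2" by linarith
  then show ?thesis by (simp add: abs_mult)
qed

lemma sqint_mult:
  assumes "sqint M X" "sqint M Y"
  shows "integrable M (\<lambda>x. X x * Y x)"
proof (rule Bochner_Integration.integrable_bound)
  show "integrable M (\<lambda>x. (X x)\<^sup>2 + (Y x)\<^sup>2)"
    using assms by (auto simp: sqint_def)
  show "(\<lambda>x. X x * Y x) \<in> borel_measurable M"
    using assms by (auto simp: sqint_def)
  show "AE x in M. norm (X x * Y x) \<le> norm ((X x)\<^sup>2 + (Y x)\<^sup>2)"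
    using abs_mult_le_squares by auto
qed

lemma sqint_cmult: "sqint M X \<Longrightarrow> sqint M (\<lambda>x. c * X x)"
  by (auto simp: sqint_def power_mult_distrib)

lemma sqint_add:
  assumes "sqint M X" "sqint M Y"
  shows "sqint M (\<lambda>x. X x + Y x)"
proof -
  have "integrable M (\<lambda>x. (X x)\<^sup>2 + (Y x)\<^sup>2 + 2 * (X x * Y x))"
    using assms sqint_mult[OF assms] by (auto simp: sqint_def)
  then show ?thesis
    using assms by (auto simp: sqint_def power2_sum algebra_simps)
qed

lemma sqint_diff: "sqint M X \<Longrightarrow> sqint M Y \<Longrightarrow> sqint M (\<lambda>x. X x - Y x)"
  using sqint_add[of M X "\<lambda>x. (-1) * Y x"] sqint_cmult[of M Y "-1"] by simp

lemma sqint_zero: "sqint M (\<lambda>_. 0)"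
  by (simp add: sqint_def)

lemma sqint_bounded:
  assumes "finite_measure M" "f \<in> borel_measurable M" "\<And>x. x \<in> space M \<Longrightarrow> \<bar>f x\<bar> \<le> B"
  shows "sqint M f"
proof -
  interpret finite_measure M by fact
  have "integrable M (\<lambda>x. (f x)\<^sup>2)"
  proof (rule integrable_const_bound[of _ "B\<^sup>2"])
    show "AE x in M. norm ((f x)\<^sup>2) \<le> B\<^sup>2"
      using assms(3) by (intro AE_I2) (simp add: abs_le_square_iff[symmetric] order_trans[OF _ abs_ge_self])
  qed (use assms in auto)
  with assms show ?thesis by (simp add: sqint_def)
qed

lemma sqint_const: "finite_measure M \<Longrightarrow> sqint M (\<lambda>_. c)"
  by (rule sqint_bounded[where B = "\<bar>c\<bar>"]) auto

lemma sqint_integrable: "finite_measure M \<Longrightarrow> sqint M X \<Longrightarrow> integrable M X"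
  using sqint_mult[of M X "\<lambda>_. 1"] sqint_const[of M 1] by simp

lemma sqint_indicator:
  assumes "A \<in> sets K" "emeasure K A < \<infinity>" shows "sqint K (indicator A)"
proof -
  have "(\<lambda>x. (indicator A x :: real)\<^sup>2) = indicator A" by (auto simp: indicator_def)
  with assms show ?thesis by (simp add: sqint_def integrable_real_indicator)
qed

text \<open>Discriminant argument: the quadratic form in \<open>s\<close> and \<open>t\<close> given
  by the integral of \<open>(s * X x + t * Y x)\<^sup>2\<close> is nonnegative.\<close>

lemma Cauchy_Schwarz_sqint:
  assumes "sqint M X" "sqint M Y"
  shows "\<bar>\<integral>x. X x * Y x \<partial>M\<bar> \<le> sqrt (\<integral>x. (X x)\<^sup>2 \<partial>M) * sqrt (\<integral>x. (Y x)\<^sup>2 \<partial>M)"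
proof -
  let ?a = "\<integral>x. (X x)\<^sup>2 \<partial>M" and ?b = "\<integral>x. (Y x)\<^sup>2 \<partial>M" and ?c = "\<integral>x. X x * Y x \<partial>M"
  have i: "integrable M (\<lambda>x. (X x)\<^sup>2)" "integrable M (\<lambda>x. (Y x)\<^sup>2)" "integrable M (\<lambda>x. X x * Y x)"
    using assms sqint_mult by (auto simp: sqint_def)
  have q: "0 \<le> ?a * s\<^sup>2 + 2 * ?c * s * t + ?b * t\<^sup>2" for s t :: real
  proof -
    have "0 \<le> (\<integral>x. (s * X x + t * Y x)\<^sup>2 \<partial>M)" by simp
    also have "\<dots> = (\<integral>x. s\<^sup>2 * (X x)\<^sup>2 + (2 * s * t) * (X x * Y x) + t\<^sup>2 * (Y x)\<^sup>2 \<partial>M)"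
      by (intro Bochner_Integration.integral_cong) (auto simp: power2_eq_square algebra_simps)
    also have "\<dots> = s\<^sup>2 * ?a + (2 * s * t) * ?c + t\<^sup>2 * ?b"
      using i by simp
    finally show ?thesis by (simp add: algebra_simps)
  qed
  have nn: "0 \<le> ?a" "0 \<le> ?b" by simp_all
  have "?c\<^sup>2 \<le> ?a * ?b"
  proof (cases "?b = 0")
    case True
    have "?c = 0"
    proof (rule ccontr)
      assume "?c \<noteq> 0"
      then show False
        \<comment> \<open>At this point the form would take the value -1.\<close>
        using q[of 1 "- (?a + 1) / (2 * ?c)"] nn True by (simp add: field_simps)
    qed
    then show ?thesis using nn by simp
  next
    case False
    then have "0 < ?b" using nn(2) by (metis less_le)
    \<comment> \<open>The form in its minimising direction \<open>s = ?b\<close>,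
      \<open>t = - ?c\<close>.\<close>
    moreover have "0 \<le> ?b * (?a * ?b - ?c\<^sup>2)"
      using q[of "?b" "- ?c"] by (simp add: power2_eq_square algebra_simps)
    ultimately show ?thesis by (simp add: zero_le_mult_iff)
  qed
  then show ?thesis
    by (metis real_sqrt_abs real_sqrt_le_iff real_sqrt_mult)
qed

text \<open>In contrast to \<open>L2_tendsto\<close>, all functions involved are square integrable.\<close>

definition l2lim :: "'a measure \<Rightarrow> (nat \<Rightarrow> 'a \<Rightarrow> real) \<Rightarrow> ('a \<Rightarrow> real) \<Rightarrow> bool" where
  "l2lim M X Y \<longleftrightarrow> (\<forall>k. sqint M (X k)) \<and> sqint M Y \<and>
     (\<lambda>k. \<integral>x. (X k x - Y x)\<^sup>2 \<partial>M) \<longlonglongrightarrow> 0"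

lemma l2lim_const: "sqint M X \<Longrightarrow> l2lim M (\<lambda>_. X) X"
  by (simp add: l2lim_def)

lemma nn_integral_sqint:
  assumes "sqint M X"
  shows "(\<integral>\<^sup>+x. ennreal ((X x)\<^sup>2) \<partial>M) = ennreal (\<integral>x. (X x)\<^sup>2 \<partial>M)"
  by (rule nn_integral_eq_integral) (use assms in \<open>auto simp: sqint_def\<close>)

lemma sqint_nn_integral:
  assumes "X \<in> borel_measurable M" "(\<integral>\<^sup>+x. ennreal ((X x)\<^sup>2) \<partial>M) < \<infinity>"
  shows "sqint M X"
  using assms by (auto simp: sqint_def intro!: integrableI_bounded)

text \<open>A finite distance to one square integrable \<open>X k\<close> makes the limit
  \<open>Y = X k - (X k - Y)\<close> square integrable as well, so only the approximants have to be
  checked.\<close>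

lemma l2lim_iff_L2_tendsto:
  "l2lim M X Y \<longleftrightarrow> (\<forall>k. sqint M (X k)) \<and> L2_tendsto M X Y"
proof (intro iffI conjI)
  assume l: "l2lim M X Y"
  then show "\<forall>k. sqint M (X k)" by (auto simp: l2lim_def)
  have "(\<lambda>k. ennreal (\<integral>x. (X k x - Y x)\<^sup>2 \<partial>M)) \<longlonglongrightarrow> ennreal 0"
    using l by (intro tendsto_ennrealI) (auto simp: l2lim_def)
  moreover have "sqint M (\<lambda>x. X k x - Y x)" for k
    using l by (auto simp: l2lim_def intro: sqint_diff)
  ultimately show "L2_tendsto M X Y"
    using l by (auto simp: L2_tendsto_def l2lim_def sqint_measurable nn_integral_sqint)
next
  assume a: "(\<forall>k. sqint M (X k)) \<and> L2_tendsto M X Y"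
  then have m: "X k \<in> borel_measurable M" "Y \<in> borel_measurable M" "sqint M (X k)" for k
    by (auto simp: L2_tendsto_def)
  have lim: "(\<lambda>k. \<integral>\<^sup>+x. ennreal ((X k x - Y x)\<^sup>2) \<partial>M) \<longlonglongrightarrow> 0"
    using a by (auto simp: L2_tendsto_def)
  then have "\<forall>\<^sub>F k in sequentially. (\<integral>\<^sup>+x. ennreal ((X k x - Y x)\<^sup>2) \<partial>M) < 1"
    by (rule order_tendstoD) simp
  then obtain k where "(\<integral>\<^sup>+x. ennreal ((X k x - Y x)\<^sup>2) \<partial>M) < 1"
    by (auto simp: eventually_sequentially)
  then have "sqint M (\<lambda>x. X k x - Y x)"
    using m by (intro sqint_nn_integral) (auto intro: less_trans)
  then have Y: "sqint M Y"
    using sqint_diff[OF m(3)[of k]] by fastforce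
  have "(\<lambda>k. ennreal (\<integral>x. (X k x - Y x)\<^sup>2 \<partial>M)) \<longlonglongrightarrow> ennreal 0"
    using lim by (simp add: nn_integral_sqint sqint_diff Y m)
  then have "(\<lambda>k. \<integral>x. (X k x - Y x)\<^sup>2 \<partial>M) \<longlonglongrightarrow> 0"
    by (subst (asm) tendsto_ennreal_iff) auto
  with m Y show "l2lim M X Y" by (auto simp: l2lim_def)
qed

lemma l2lim_cmult: "l2lim M X Y \<Longrightarrow> l2lim M (\<lambda>k x. c * X k x) (\<lambda>x. c * Y x)"
proof -
  assume l: "l2lim M X Y"
  have "(\<lambda>k. c\<^sup>2 * (\<integral>x. (X k x - Y x)\<^sup>2 \<partial>M)) \<longlonglongrightarrow> c\<^sup>2 * 0"
    using l by (intro tendsto_intros) (auto simp: l2lim_def)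
  then show ?thesis
    using l by (auto simp: l2lim_def sqint_cmult power_mult_distrib right_diff_distrib[symmetric])
qed

text \<open>Stands in for the triangle inequality: the factor 2 is harmless for limits, and no
  square roots appear.\<close>

lemma integral_square_add_le:
  assumes "sqint M X" "sqint M Y"
  shows "(\<integral>x. (X x + Y x)\<^sup>2 \<partial>M) \<le> 2 * (\<integral>x. (X x)\<^sup>2 \<partial>M) + 2 * (\<integral>x. (Y x)\<^sup>2 \<partial>M)"
proof -
  have "(\<integral>x. (X x + Y x)\<^sup>2 \<partial>M) \<le> (\<integral>x. 2 * (X x)\<^sup>2 + 2 * (Y x)\<^sup>2 \<partial>M)"
  proof (rule integral_mono)
    show "(X x + Y x)\<^sup>2 \<le> 2 * (X x)\<^sup>2 + 2 * (Y x)\<^sup>2" for x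
      using sum_squares_bound[of "X x" "Y x"] by (simp add: power2_sum)
  qed (use assms sqint_add[OF assms] in \<open>auto simp: sqint_def\<close>)
  also have "\<dots> = 2 * (\<integral>x. (X x)\<^sup>2 \<partial>M) + 2 * (\<integral>x. (Y x)\<^sup>2 \<partial>M)"
    using assms by (simp add: sqint_def)
  finally show ?thesis .
qed

lemma l2lim_add:
  assumes "l2lim M X Y" "l2lim M X' Y'"
  shows "l2lim M (\<lambda>k x. X k x + X' k x) (\<lambda>x. Y x + Y' x)"
proof -
  have s: "sqint M (X k)" "sqint M (X' k)" "sqint M Y" "sqint M Y'" for k
    using assms by (auto simp: l2lim_def)
  have "(\<lambda>k. \<integral>x. (X k x + X' k x - (Y x + Y' x))\<^sup>2 \<partial>M) \<longlonglongrightarrow> 0"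
  proof (rule tendsto_sandwich[OF _ _ tendsto_const])
    have "(\<lambda>k. 2 * (\<integral>x. (X k x - Y x)\<^sup>2 \<partial>M) + 2 * (\<integral>x. (X' k x - Y' x)\<^sup>2 \<partial>M))
       \<longlonglongrightarrow> 2 * 0 + 2 * 0"
      using assms by (intro tendsto_intros) (auto simp: l2lim_def)
    then show "(\<lambda>k. 2 * (\<integral>x. (X k x - Y x)\<^sup>2 \<partial>M) + 2 * (\<integral>x. (X' k x - Y' x)\<^sup>2 \<partial>M))
       \<longlonglongrightarrow> 0" by simp
    have "(\<integral>x. (X k x + X' k x - (Y x + Y' x))\<^sup>2 \<partial>M) \<le>
        2 * (\<integral>x. (X k x - Y x)\<^sup>2 \<partial>M) + 2 * (\<integral>x. (X' k x - Y' x)\<^sup>2 \<partial>M)" for k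
      using integral_square_add_le[OF sqint_diff[OF s(1,3)] sqint_diff[OF s(2,4)], of k k]
      by (simp add: algebra_simps)
    then show "\<forall>\<^sub>F k in sequentially. (\<integral>x. (X k x + X' k x - (Y x + Y' x))\<^sup>2 \<partial>M) \<le>
        2 * (\<integral>x. (X k x - Y x)\<^sup>2 \<partial>M) + 2 * (\<integral>x. (X' k x - Y' x)\<^sup>2 \<partial>M)"
      by (rule always_eventually[OF allI])
  qed auto
  with s show ?thesis by (auto simp: l2lim_def sqint_add)
qed

text \<open>Expand the product around the limits and apply Cauchy-Schwarz to the three differences.
  This continuity of the inner product carries isometries and Stein bounds over to mean square
  limits.\<close>

lemma l2lim_mult:
  assumes l: "l2lim M X Y" "l2lim M X' Y'"
  shows "(\<lambda>k. \<integral>x. X k x * X' k x \<partial>M) \<longlonglongrightarrow> (\<integral>x. Y x * Y' x \<partial>M)"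
proof -
  have s: "sqint M (X k)" "sqint M (X' k)" "sqint M Y" "sqint M Y'" for k
    using assms by (auto simp: l2lim_def)
  define e e' where "e k = (\<integral>x. (X k x - Y x)\<^sup>2 \<partial>M)" "e' k = (\<integral>x. (X' k x - Y' x)\<^sup>2 \<partial>M)" for k
  have e: "e \<longlonglongrightarrow> 0" "e' \<longlonglongrightarrow> 0"
    using l by (auto simp: l2lim_def e_e'_def[abs_def])
  have d: "sqint M (\<lambda>x. X k x - Y x)" "sqint M (\<lambda>x. X' k x - Y' x)" for k
    using s by (auto intro: sqint_diff)
  define A B where "A = sqrt (\<integral>x. (Y x)\<^sup>2 \<partial>M)" "B = sqrt (\<integral>x. (Y' x)\<^sup>2 \<partial>M)"
  have split: "(\<integral>x. X k x * X' k x \<partial>M) - (\<integral>x. Y x * Y' x \<partial>M) =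
     (\<integral>x. (X k x - Y x) * (X' k x - Y' x) \<partial>M) + (\<integral>x. Y x * (X' k x - Y' x) \<partial>M)
       + (\<integral>x. (X k x - Y x) * Y' x \<partial>M)" for k
  proof -
    have "(\<integral>x. X k x * X' k x \<partial>M) = (\<integral>x. (X k x - Y x) * (X' k x - Y' x) + Y x * (X' k x - Y' x)
       + (X k x - Y x) * Y' x + Y x * Y' x \<partial>M)"
      by (intro Bochner_Integration.integral_cong) (auto simp: algebra_simps)
    then show ?thesis
      by (simp add: sqint_mult[OF d(1) d(2)] sqint_mult[OF s(3) d(2)] sqint_mult[OF d(1) s(4)]
          sqint_mult[OF s(3) s(4)])
  qed
  have "(\<lambda>k. (\<integral>x. X k x * X' k x \<partial>M) - (\<integral>x. Y x * Y' x \<partial>M)) \<longlonglongrightarrow> 0"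
  proof (rule tendsto_rabs_zero_cancel, rule tendsto_sandwich[OF _ _ tendsto_const])
    have "(\<lambda>k. sqrt (e k) * sqrt (e' k) + A * sqrt (e' k) + sqrt (e k) * B) \<longlonglongrightarrow>
       sqrt 0 * sqrt 0 + A * sqrt 0 + sqrt 0 * B"
      by (intro tendsto_intros e)
    then show "(\<lambda>k. sqrt (e k) * sqrt (e' k) + A * sqrt (e' k) + sqrt (e k) * B) \<longlonglongrightarrow> 0" by simp
    show "\<forall>\<^sub>F k in sequentially. \<bar>(\<integral>x. X k x * X' k x \<partial>M) - (\<integral>x. Y x * Y' x \<partial>M)\<bar> \<le>
        sqrt (e k) * sqrt (e' k) + A * sqrt (e' k) + sqrt (e k) * B"
    proof (intro always_eventually allI)
      fix k
      show "\<bar>(\<integral>x. X k x * X' k x \<partial>M) - (\<integral>x. Y x * Y' x \<partial>M)\<bar> \<le>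
        sqrt (e k) * sqrt (e' k) + A * sqrt (e' k) + sqrt (e k) * B"
        unfolding split e_e'_def A_B_def
        using Cauchy_Schwarz_sqint[OF d(1)[of k] d(2)[of k]] Cauchy_Schwarz_sqint[OF s(3) d(2)[of k]]
          Cauchy_Schwarz_sqint[OF d(1)[of k] s(4)]
        by linarith
    qed
  qed auto
  then show ?thesis by (simp add: LIM_zero_iff)
qed

lemma l2lim_square:
  "l2lim M X Y \<Longrightarrow> (\<lambda>k. \<integral>x. (X k x)\<^sup>2 \<partial>M) \<longlonglongrightarrow> (\<integral>x. (Y x)\<^sup>2 \<partial>M)"
  using l2lim_mult[of M X Y X Y] by (simp add: power2_eq_square)

lemma l2lim_integral:
  "finite_measure M \<Longrightarrow> l2lim M X Y \<Longrightarrow> (\<lambda>k. \<integral>x. X k x \<partial>M) \<longlonglongrightarrow> (\<integral>x. Y x \<partial>M)"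
  using l2lim_mult[of M X Y "\<lambda>_ _. 1" "\<lambda>_. 1"] l2lim_const[OF sqint_const[of M 1]] by simp

lemma l2lim_cauchy:
  assumes l: "l2lim M X Y" and e: "e > 0"
  shows "\<exists>N. \<forall>m\<ge>N. \<forall>n\<ge>N. (\<integral>x. (X m x - X n x)\<^sup>2 \<partial>M) < e"
proof -
  have s: "sqint M (X k)" "sqint M Y" for k using l by (auto simp: l2lim_def)
  \<comment> \<open>Each of the two distances to \<open>Y\<close> enters below with a factor
    2.\<close>
  have "\<forall>\<^sub>F k in sequentially. (\<integral>x. (X k x - Y x)\<^sup>2 \<partial>M) < e / 4"
    using l e by (intro order_tendstoD(2)[of _ 0]) (auto simp: l2lim_def)
  then obtain N where N: "\<And>k. k \<ge> N \<Longrightarrow> (\<integral>x. (X k x - Y x)\<^sup>2 \<partial>M) < e / 4"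
    by (auto simp: eventually_sequentially)
  have "(\<integral>x. (X m x - X n x)\<^sup>2 \<partial>M) < e" if "m \<ge> N" "n \<ge> N" for m n
  proof -
    have "(\<integral>x. (X m x - X n x)\<^sup>2 \<partial>M) \<le> 2 * (\<integral>x. (X m x - Y x)\<^sup>2 \<partial>M) + 2 * (\<integral>x. (Y x - X n x)\<^sup>2 \<partial>M)"
      using integral_square_add_le[OF sqint_diff[OF s(1)[of m] s(2)] sqint_diff[OF s(2) s(1)[of n]]] by simp
    then show ?thesis using N[OF that(1)] N[OF that(2)] by (simp add: power2_commute[of "Y _"])
  qed
  then show ?thesis by blast
qed

text \<open>Riesz-Fischer: a rapidly Cauchy subsequence converges almost everywhere, and Fatou's
  lemma along it bounds the distance of every late \<open>X n\<close> to the pointwise limit.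
  Completeness is what provides the stochastic integrals, both on the probability space and on path
  space.\<close>

lemma l2_complete:
  assumes s: "\<And>k. sqint M (X k)"
    and c: "\<And>e. e > 0 \<Longrightarrow> \<exists>N. \<forall>m\<ge>N. \<forall>n\<ge>N. (\<integral>x. (X m x - X n x)\<^sup>2 \<partial>M) < e"
  shows "\<exists>Y. l2lim M X Y"
proof -
  have "\<exists>N. \<forall>m\<ge>N. \<forall>n\<ge>N. (\<integral>x. (X m x - X n x)\<^sup>2 \<partial>M) < (1/4)^k" for k :: nat
    by (rule c) simp
  then obtain N where N: "\<And>k m n. m \<ge> N k \<Longrightarrow> n \<ge> N k \<Longrightarrow> (\<integral>x. (X m x - X n x)\<^sup>2 \<partial>M) < (1/4)^k"
    by metis
  \<comment> \<open>Summing the thresholds makes \<open>r\<close> dominate \<open>N k\<close> at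
    \<open>k\<close> and at \<open>Suc k\<close>; adding \<open>k\<close> sends it to infinity,
    which the Fatou step requires.\<close>
  define r where "r k = k + (\<Sum>i\<le>k. N i)" for k
  have rN: "N k \<le> r k" "N k \<le> r (Suc k)" "k \<le> r k" for k
  proof -
    have "N k \<le> (\<Sum>i\<le>k. N i)" by (rule member_le_sum) auto
    then show "N k \<le> r k" "N k \<le> r (Suc k)" "k \<le> r k" by (auto simp: r_def)
  qed
  have mX[measurable]: "X k \<in> borel_measurable M" for k using s by (rule sqint_measurable)
  \<comment> \<open>The weights \<open>2^k\<close> give \<open>\<bar>D k x\<bar> \<le> (1/2)^k + 2^k * (D k x)\<^sup>2\<close>, which is summable for almost every \<open>x\<close>.\<close>
  define D where "D k x = X (r (Suc k)) x - X (r k) x" for k x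
  have mD[measurable]: "D k \<in> borel_measurable M" for k by (simp add: D_def[abs_def])
  have sD: "sqint M (D k)" for k unfolding D_def by (intro sqint_diff s)
  have D: "(\<integral>x. (D k x)\<^sup>2 \<partial>M) \<le> (1/4)^k" for k
    unfolding D_def using N[OF rN(2) rN(1), of k] by simp
  have "(\<integral>\<^sup>+x. (\<Sum>k. ennreal (2^k * (D k x)\<^sup>2)) \<partial>M) = (\<Sum>k. \<integral>\<^sup>+x. ennreal (2^k * (D k x)\<^sup>2) \<partial>M)"
    by (rule nn_integral_suminf) auto
  also have "\<dots> \<le> (\<Sum>k. ennreal ((1/2)^k))"
  proof (rule suminf_le)
    fix k
    have "(\<integral>\<^sup>+x. ennreal (2^k * (D k x)\<^sup>2) \<partial>M) = ennreal (\<integral>x. 2^k * (D k x)\<^sup>2 \<partial>M)"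
      using sD[of k] by (intro nn_integral_eq_integral) (auto simp: sqint_def)
    also have "\<dots> \<le> ennreal (2^k * (1/4)^k)"
      using D[of k] by (intro ennreal_leI) simp
    also have "2^k * (1/4)^k = ((1/2)^k :: real)"
      by (simp flip: power_mult_distrib)
    finally show "(\<integral>\<^sup>+x. ennreal (2^k * (D k x)\<^sup>2) \<partial>M) \<le> ennreal ((1/2)^k)" .
  qed auto
  also have "\<dots> = ennreal (\<Sum>k. (1/2)^k)"
    by (rule suminf_ennreal2) (auto intro: summable_geometric)
  also have "\<dots> < \<infinity>" by simp
  finally have "AE x in M. (\<Sum>k. ennreal (2^k * (D k x)\<^sup>2)) \<noteq> \<infinity>"
    by (intro nn_integral_noteq_infinite) auto
  then have ae: "AE x in M. convergent (\<lambda>k. X (r k) x)"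
  proof (eventually_elim)
    fix x assume "(\<Sum>k. ennreal (2^k * (D k x)\<^sup>2)) \<noteq> \<infinity>"
    then have 1: "summable (\<lambda>k. 2^k * (D k x)\<^sup>2)"
      by (intro summable_suminf_not_top) auto
    have "summable (\<lambda>k. (1/2)^k + 2^k * (D k x)\<^sup>2)"
      by (intro summable_add 1 summable_geometric) simp
    then have "summable (\<lambda>k. D k x)"
    proof (rule summable_comparison_test'[where N = 0])
      fix k
      have "D k x = sqrt ((1/2)^k) * (sqrt (2^k) * D k x)"
        by (simp add: real_sqrt_mult[symmetric] mult.assoc[symmetric] flip: power_mult_distrib)
      then have "norm (D k x) = \<bar>sqrt ((1/2)^k) * (sqrt (2^k) * D k x)\<bar>"
        by (metis real_norm_def)
      also have "\<dots> \<le> (sqrt ((1/2)^k))\<^sup>2 + (sqrt (2^k) * D k x)\<^sup>2"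
        by (rule abs_mult_le_squares)
      also have "\<dots> = (1/2)^k + 2^k * (D k x)\<^sup>2"
        by (simp add: power_mult_distrib)
      finally show "norm (D k x) \<le> (1/2)^k + 2^k * (D k x)\<^sup>2" .
    qed
    then have "(\<lambda>n. X (r 0) x + (\<Sum>k<n. D k x)) \<longlonglongrightarrow> X (r 0) x + (\<Sum>k. D k x)"
      by (intro tendsto_intros summable_LIMSEQ)
    moreover have "X (r 0) x + (\<Sum>k<n. D k x) = X (r n) x" for n
      by (simp add: D_def sum_lessThan_telescope[of "\<lambda>k. X (r k) x"])
    ultimately show "convergent (\<lambda>k. X (r k) x)" by (auto simp: convergent_def)
  qed
  \<comment> \<open>\<open>lim\<close> is total; its values on the null set of divergence do not
    affect the distance.\<close>
  define Y where "Y x = lim (\<lambda>k. X (r k) x)" for x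
  have mY[measurable]: "Y \<in> borel_measurable M"
    unfolding Y_def[abs_def] by measurable
  have aeY: "AE x in M. (\<lambda>k. X (r k) x) \<longlonglongrightarrow> Y x"
    using ae by eventually_elim (simp add: Y_def convergent_LIMSEQ_iff)
  \<comment> \<open>Fatou compares an arbitrary \<open>X n\<close> with the subsequence, so the
    whole sequence is controlled at once.\<close>
  have bound: "(\<integral>\<^sup>+x. ennreal ((X n x - Y x)\<^sup>2) \<partial>M) \<le> ennreal ((1/4)^k)" if "n \<ge> N k" for n k
  proof -
    have "(\<integral>\<^sup>+x. ennreal ((X n x - Y x)\<^sup>2) \<partial>M) =
        (\<integral>\<^sup>+x. liminf (\<lambda>i. ennreal ((X n x - X (r i) x)\<^sup>2)) \<partial>M)"
      using aeY
    proof (intro nn_integral_cong_AE, eventually_elim)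
      fix x assume "(\<lambda>k. X (r k) x) \<longlonglongrightarrow> Y x"
      then have "(\<lambda>i. ennreal ((X n x - X (r i) x)\<^sup>2)) \<longlonglongrightarrow> ennreal ((X n x - Y x)\<^sup>2)"
        by (intro tendsto_intros)
      then show "ennreal ((X n x - Y x)\<^sup>2) = liminf (\<lambda>i. ennreal ((X n x - X (r i) x)\<^sup>2))"
        by (intro lim_imp_Liminf[symmetric]) auto
    qed
    also have "\<dots> \<le> liminf (\<lambda>i. \<integral>\<^sup>+x. ennreal ((X n x - X (r i) x)\<^sup>2) \<partial>M)"
      by (rule nn_integral_liminf) auto
    also have "\<dots> \<le> liminf (\<lambda>i. ennreal ((1/4)^k))"
    proof (rule Liminf_mono)
      show "\<forall>\<^sub>F i in sequentially. (\<integral>\<^sup>+x. ennreal ((X n x - X (r i) x)\<^sup>2) \<partial>M) \<le> ennreal ((1/4)^k)"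
        unfolding eventually_sequentially
      proof (intro exI allI impI)
        fix i assume "N k \<le> i"
        then have "N k \<le> r i" using rN(3)[of i] by simp
        with N[OF that this] show "(\<integral>\<^sup>+x. ennreal ((X n x - X (r i) x)\<^sup>2) \<partial>M) \<le> ennreal ((1/4)^k)"
          by (subst nn_integral_sqint) (auto intro!: sqint_diff s ennreal_leI)
      qed
    qed
    also have "\<dots> = ennreal ((1/4)^k)" by (simp add: Liminf_const)
    finally show ?thesis .
  qed
  have "(\<lambda>n. \<integral>\<^sup>+x. ennreal ((X n x - Y x)\<^sup>2) \<partial>M) \<longlonglongrightarrow> 0"
  proof (rule order_tendstoI)
    fix a :: ennreal assume "0 < a"
    have "(\<lambda>k. ennreal ((1/4)^k)) \<longlonglongrightarrow> ennreal 0"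
      by (intro tendsto_ennrealI LIMSEQ_realpow_zero) auto
    then have "\<forall>\<^sub>F k in sequentially. ennreal ((1/4)^k) < a"
      using \<open>0 < a\<close> by (intro order_tendstoD(2)) auto
    then obtain k where "ennreal ((1/4)^k) < a"
      by (auto simp: eventually_sequentially)
    then show "\<forall>\<^sub>F n in sequentially. (\<integral>\<^sup>+x. ennreal ((X n x - Y x)\<^sup>2) \<partial>M) < a"
      unfolding eventually_sequentially using bound[of k] by (intro exI[of _ "N k"]) (auto intro: le_less_trans)
  qed simp
  then have "L2_tendsto M X Y" by (auto simp: L2_tendsto_def)
  with s show ?thesis by (auto simp: l2lim_iff_L2_tendsto)
qed

section \<open>Finite sums of square integrable terms and bilinear isometries\<close>

lemma sqint_sum_list:
  "(\<And>x. x \<in> set p \<Longrightarrow> sqint M (e x)) \<Longrightarrow> sqint M (\<lambda>\<omega>. \<Sum>x\<leftarrow>p. e x \<omega>)"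
  by (induction p) (auto simp: sqint_zero sqint_add)

lemma integral_sum_list_mult:
  assumes "\<And>x. x \<in> set p \<Longrightarrow> sqint M (e x)" "sqint M Y"
  shows "(\<integral>\<omega>. (\<Sum>x\<leftarrow>p. e x \<omega>) * Y \<omega> \<partial>M) = (\<Sum>x\<leftarrow>p. \<integral>\<omega>. e x \<omega> * Y \<omega> \<partial>M)"
  using assms(1)
proof (induction p)
  case (Cons x p)
  have "integrable M (\<lambda>\<omega>. e x \<omega> * Y \<omega>)" "integrable M (\<lambda>\<omega>. (\<Sum>x\<leftarrow>p. e x \<omega>) * Y \<omega>)"
    using Cons.prems assms(2) by (auto intro!: sqint_mult sqint_sum_list)
  with Cons show ?case by (simp add: distrib_right)
qed simp

text \<open>Bilinearity extends an isometry from single terms to finite sums. It serves twice: for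
  step functions with Lebesgue measure as \<open>K\<close>, and for simple functions with the
  compensator as \<open>K\<close> and \<open>C = 1\<close>.\<close>

lemma integral_sum_list_isometry:
  assumes e: "\<And>x. x \<in> set p \<union> set q \<Longrightarrow> sqint M (e x)"
    and f: "\<And>x. x \<in> set p \<union> set q \<Longrightarrow> sqint K (f x)"
    and eq: "\<And>x y. x \<in> set p \<Longrightarrow> y \<in> set q \<Longrightarrow>
      (\<integral>\<omega>. e x \<omega> * e y \<omega> \<partial>M) = C * (\<integral>t. f x t * f y t \<partial>K)"
  shows "(\<integral>\<omega>. (\<Sum>x\<leftarrow>p. e x \<omega>) * (\<Sum>y\<leftarrow>q. e y \<omega>) \<partial>M) =
    C * (\<integral>t. (\<Sum>x\<leftarrow>p. f x t) * (\<Sum>y\<leftarrow>q. f y t) \<partial>K)"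
proof -
  have "(\<integral>\<omega>. (\<Sum>x\<leftarrow>p. e x \<omega>) * (\<Sum>y\<leftarrow>q. e y \<omega>) \<partial>M) = (\<Sum>x\<leftarrow>p. \<integral>\<omega>. e x \<omega> * (\<Sum>y\<leftarrow>q. e y \<omega>) \<partial>M)"
    using e by (intro integral_sum_list_mult sqint_sum_list) auto
  also have "\<dots> = (\<Sum>x\<leftarrow>p. C * (\<integral>t. f x t * (\<Sum>y\<leftarrow>q. f y t) \<partial>K))"
  proof (rule arg_cong[where f = sum_list], rule map_cong[OF refl])
    fix x assume x: "x \<in> set p"
    have "(\<integral>\<omega>. e x \<omega> * (\<Sum>y\<leftarrow>q. e y \<omega>) \<partial>M) = (\<Sum>y\<leftarrow>q. \<integral>\<omega>. e x \<omega> * e y \<omega> \<partial>M)"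
      using integral_sum_list_mult[of q M e "e x"] e x by (auto simp: mult.commute)
    also have "\<dots> = (\<Sum>y\<leftarrow>q. C * (\<integral>t. f x t * f y t \<partial>K))"
      by (rule arg_cong[where f = sum_list], rule map_cong[OF refl]) (use eq x in auto)
    also have "\<dots> = C * (\<integral>t. f x t * (\<Sum>y\<leftarrow>q. f y t) \<partial>K)"
      using integral_sum_list_mult[of q K f "f x"] f x by (auto simp: mult.commute sum_list_const_mult)
    finally show "(\<integral>\<omega>. e x \<omega> * (\<Sum>y\<leftarrow>q. e y \<omega>) \<partial>M) = C * (\<integral>t. f x t * (\<Sum>y\<leftarrow>q. f y t) \<partial>K)" .
  qed
  also have "\<dots> = C * (\<integral>t. (\<Sum>x\<leftarrow>p. f x t) * (\<Sum>y\<leftarrow>q. f y t) \<partial>K)"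
    using f by (subst integral_sum_list_mult) (auto simp: sum_list_const_mult intro!: sqint_sum_list)
  finally show ?thesis .
qed

section \<open>Step functions and step integrals\<close>

text \<open>The mesh is uniform, so all Brownian increments over it have the same variance
  \<open>T / m\<close>, and a single standard deviation serves in Stein's identity.\<close>

definition grid :: "real \<Rightarrow> nat \<Rightarrow> nat \<Rightarrow> real" where
  "grid T m i = T * real i / real m"

definition grid_list :: "real \<Rightarrow> nat \<Rightarrow> (real \<Rightarrow> real) \<Rightarrow> (real \<times> real \<times> real) list" where
  "grid_list T m g = map (\<lambda>i. (g (grid T m i), grid T m i, grid T m (Suc i))) [0..<m]"

definition valid_steps :: "real \<Rightarrow> (real \<times> real \<times> real) list \<Rightarrow> bool" where
  "valid_steps T p \<longleftrightarrow> (\<forall>(a, s, u)\<in>set p. 0 \<le> s \<and> s \<le> u \<and> u \<le> T)"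

lemma grid_bounds:
  assumes "T > 0" "i \<le> m" shows "0 \<le> grid T m i" "grid T m i \<le> T" "grid T m i \<le> grid T m (Suc i)"
proof -
  show "0 \<le> grid T m i" using assms by (simp add: grid_def)
  show "grid T m i \<le> T" using assms by (cases "m = 0") (auto simp: grid_def field_simps)
  show "grid T m i \<le> grid T m (Suc i)" using assms by (auto simp: grid_def intro!: divide_right_mono mult_left_mono)
qed

lemma valid_grid_list: "T > 0 \<Longrightarrow> valid_steps T (grid_list T m g)"
  using grid_bounds[of T _ m] by (fastforce simp: valid_steps_def grid_list_def)

lemma step_fun_grid_list:
  "step_fun (grid_list T m g) t = (\<Sum>i<m. g (grid T m i) * indicator {grid T m i<..grid T m (Suc i)} t)"
  by (simp add: step_fun_def grid_list_def comp_def interv_sum_list_conv_sum_set_nat atLeast0LessThan)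

lemma step_integral_grid_list:
  "step_integral (grid_list T m g) y = (\<Sum>i<m. g (grid T m i) * (y (grid T m (Suc i)) - y (grid T m i)))"
  by (simp add: step_integral_def grid_list_def comp_def interv_sum_list_conv_sum_set_nat atLeast0LessThan)

lemma step_fun_grid_list_eq:
  assumes "T > 0" "m > 0" "0 < t" "t \<le> T"
  obtains i where "i < m" "grid T m i < t" "t \<le> grid T m (Suc i)" "step_fun (grid_list T m g) t = g (grid T m i)"
proof -
  \<comment> \<open>Cells are open on the left and closed on the right, so the index of the cell
    containing \<open>t\<close> is the ceiling minus one; \<open>0 < t\<close> keeps this from being
    negative.\<close>
  define i where "i = nat \<lceil>t * m / T\<rceil> - 1"
  have pos: "0 < t * m / T" using assms by simp
  then have c: "0 < \<lceil>t * m / T\<rceil>" by simp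
  have "real i = real (nat \<lceil>t * m / T\<rceil>) - real 1"
    unfolding i_def using c by (intro of_nat_diff) linarith
  then have ri: "real i = real_of_int \<lceil>t * m / T\<rceil> - 1"
    using c by simp
  have "real i < t * m / T" "t * m / T \<le> real i + 1"
    unfolding ri by linarith+
  then have i: "grid T m i < t" "t \<le> grid T m (Suc i)"
    using assms by (auto simp: grid_def field_simps)
  have "t * m / T \<le> m" using assms by (simp add: field_simps)
  with \<open>real i < t * m / T\<close> have "i < m" by linarith
  have uniq: "j = i" if "grid T m j < t" "t \<le> grid T m (Suc j)" for j
  proof -
    have "grid T m j < grid T m (Suc i)" "grid T m i < grid T m (Suc j)" using that i by linarith+
    then have "real j < real (Suc i)" "real i < real (Suc j)"
      using assms by (auto simp: grid_def divide_less_cancel)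
    then show ?thesis by linarith
  qed
  have "step_fun (grid_list T m g) t = (\<Sum>j\<in>{i}. g (grid T m j) * indicator {grid T m j<..grid T m (Suc j)} t)"
    unfolding step_fun_grid_list
    by (rule sum.mono_neutral_right) (use \<open>i < m\<close> uniq in \<open>auto simp: indicator_def\<close>)
  also have "\<dots> = g (grid T m i)" using i by simp
  finally show thesis using that \<open>i < m\<close> i by blast
qed

lemma finite_measure_lebesgue_on_Icc: "finite_measure (lebesgue_on {a..b::real})"
  by (metis cbox_interval finite_measure_lebesgue_on lmeasurable_cbox)

lemma sqint_step_fun: "sqint (lebesgue_on {a..b}) (step_fun p)"
  unfolding step_fun_def[abs_def]
proof (rule sqint_sum_list)
  fix x :: "real \<times> real \<times> real"
  obtain c s u where x: "x = (c, s, u)" by (cases x)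
  have "indicator {s<..u} \<in> borel_measurable (lebesgue_on {a..b})"
    by (intro measurable_restrict_space1 borel_measurable_indicator) simp
  then have "sqint (lebesgue_on {a..b}) (indicator {s<..u})"
    by (intro sqint_bounded[of _ _ 1] finite_measure_lebesgue_on_Icc) (auto simp: indicator_def)
  then show "sqint (lebesgue_on {a..b}) (\<lambda>t. case x of (c, s, u) \<Rightarrow> c * indicator {s<..u} t)"
    unfolding x prod.case by (rule sqint_cmult)
qed

text \<open>\<open>measurable_on\<close> gives continuous functions converging almost everywhere.
  Truncating them at \<open>B\<close> keeps the limit \<open>f\<close>, itself bounded by
  \<open>B\<close>, and supplies the dominating constant. The disjunct \<open>B < 0\<close> covers
  the empty interval, where \<open>f\<close> satisfies a bound that no \<open>g\<close> can.\<close>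

lemma continuous_l2_dense:
  assumes f: "f \<in> borel_measurable (lebesgue_on {0..T::real})" and B: "\<And>t. t \<in> {0..T} \<Longrightarrow> \<bar>f t\<bar> \<le> B"
    and e: "e > (0::real)"
  shows "\<exists>g. continuous_on UNIV g \<and> (\<forall>t. \<bar>g t\<bar> \<le> B \<or> B < 0) \<and> (\<integral>t. (g t - f t)\<^sup>2 \<partial>lebesgue_on {0..T}) < e"
proof (cases "B < 0")
  case True
  have "{0..T} = {}"
  proof (rule equals0I)
    fix t assume "t \<in> {0..T}"
    from B[OF this] True show False by simp
  qed
  with e True show ?thesis by (intro exI[of _ "\<lambda>_. 0"]) auto
next
  case False
  have "f measurable_on {0..T}"
    using f by (subst measurable_on_iff_borel_measurable) auto
  then obtain N g where N: "negligible N" and g: "\<And>n. continuous_on UNIV (g n)"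
    and lim: "\<And>x. x \<notin> N \<Longrightarrow> (\<lambda>n::nat. g n x) \<longlonglongrightarrow> (if x \<in> {0..T} then f x else 0)"
    by (auto simp: measurable_on_def)
  define h where "h n t = max (- B) (min B (g n t))" for n t
  have h: "continuous_on UNIV (h n)" for n
    unfolding h_def[abs_def] by (intro continuous_intros g)
  have hB: "\<bar>h n t\<bar> \<le> B" for n t using False by (auto simp: h_def)
  have mh[measurable]: "h n \<in> borel_measurable (lebesgue_on {0..T})" for n
    using borel_measurable_continuous_onI[OF h[of n]]
    by (simp add: measurable_completion measurable_restrict_space1)
  interpret finite_measure "lebesgue_on {0..T}" by (rule finite_measure_lebesgue_on_Icc)
  have N0: "N \<inter> {0..T} \<in> null_sets (lebesgue_on {0..T})"
    using N by (simp add: null_sets_restrict_space negligible_iff_null_sets null_set_Int2)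
  have "(\<lambda>n. \<integral>t. (h n t - f t)\<^sup>2 \<partial>lebesgue_on {0..T}) \<longlonglongrightarrow> (\<integral>t. 0 \<partial>lebesgue_on {0..T})"
  proof (rule integral_dominated_convergence[where w = "\<lambda>_. (2 * B)\<^sup>2"])
    have "AE t in lebesgue_on {0..T}. t \<notin> N"
      by (rule AE_I'[OF N0]) auto
    then show "AE t in lebesgue_on {0..T}. (\<lambda>n. (h n t - f t)\<^sup>2) \<longlonglongrightarrow> 0"
    proof (rule AE_mp, intro AE_I2 impI)
      fix t assume t: "t \<in> space (lebesgue_on {0..T})" "t \<notin> N"
      then have "(\<lambda>n. (h n t - f t)\<^sup>2) \<longlonglongrightarrow> (max (- B) (min B (f t)) - f t)\<^sup>2"
        unfolding h_def using lim[OF t(2)] by (intro tendsto_intros) auto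
      moreover have "max (- B) (min B (f t)) = f t" using B[of t] t by auto
      ultimately show "(\<lambda>n. (h n t - f t)\<^sup>2) \<longlonglongrightarrow> 0" by simp
    qed
    show "AE t in lebesgue_on {0..T}. norm ((h n t - f t)\<^sup>2) \<le> (2 * B)\<^sup>2" for n
    proof (rule AE_I2)
      fix t assume "t \<in> space (lebesgue_on {0..T})"
      then have "\<bar>h n t - f t\<bar> \<le> \<bar>2 * B\<bar>" using hB[of n t] B[of t] by auto
      then show "norm ((h n t - f t)\<^sup>2) \<le> (2 * B)\<^sup>2" by (simp only: abs_le_square_iff) simp
    qed
  qed (use f in auto)
  then have "(\<lambda>n. \<integral>t. (h n t - f t)\<^sup>2 \<partial>lebesgue_on {0..T}) \<longlonglongrightarrow> 0" by simp
  from order_tendstoD(2)[OF this e]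
  obtain n where "(\<integral>t. (h n t - f t)\<^sup>2 \<partial>lebesgue_on {0..T}) < e"
    by (auto simp: eventually_sequentially)
  with h[of n] hB[of n] show ?thesis by (intro exI[of _ "h n"]) simp
qed

lemma measure_lebesgue_on_Icc: "T \<ge> 0 \<Longrightarrow> measure (lebesgue_on {0..T}) {0..T::real} = T"
  by (simp add: measure_restrict_space)

text \<open>A continuous approximant is uniformly continuous on the interval, so sampling it on any
  sufficiently fine grid works. The form with a threshold \<open>m0\<close> matters: it lets several
  functions share one grid.\<close>

lemma grid_l2_dense:
  assumes T: "T > 0" and f: "f \<in> borel_measurable (lebesgue_on {0..T})"
    and B: "\<And>t. t \<in> {0..T} \<Longrightarrow> \<bar>f t\<bar> \<le> B" and e: "e > (0::real)"
  shows "\<exists>g. \<exists>m0>0. \<forall>m\<ge>m0. (\<integral>t. (step_fun (grid_list T m g) t - f t)\<^sup>2 \<partial>lebesgue_on {0..T}) < e"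
proof -
  let ?K = "lebesgue_on {0..T}"
  interpret finite_measure ?K by (rule finite_measure_lebesgue_on_Icc)
  have sf: "sqint ?K f" by (rule sqint_bounded[OF finite_measure_lebesgue_on_Icc f]) (use B in auto)
  obtain g where g: "continuous_on UNIV g" "(\<integral>t. (g t - f t)\<^sup>2 \<partial>?K) < e / 4"
    using continuous_l2_dense[OF f B, of "e / 4"] e by auto
  \<comment> \<open>Chosen so that \<open>\<delta>\<^sup>2 * T\<close> is \<open>e / 8\<close>;
    doubled, this fits below \<open>e\<close> next to twice the error \<open>e / 4\<close> of
    \<open>g\<close>.\<close>
  define \<delta> where "\<delta> = sqrt (e / (8 * T))"
  have "\<delta> > 0" using e T by (simp add: \<delta>_def)
  have "uniformly_continuous_on {0..T} g"
    using g(1) by (intro compact_uniformly_continuous) (auto intro: continuous_on_subset)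
  with \<open>\<delta> > 0\<close> obtain \<eta> where "\<eta> > 0"
    and \<eta>: "\<And>s t. s \<in> {0..T} \<Longrightarrow> t \<in> {0..T} \<Longrightarrow> \<bar>s - t\<bar> < \<eta> \<Longrightarrow> \<bar>g s - g t\<bar> < \<delta>"
    unfolding uniformly_continuous_on_def dist_real_def by metis
  obtain m0 where m0: "T / \<eta> < real m0" using reals_Archimedean2 by blast
  have m0_pos: "0 < m0" using m0 T \<open>\<eta> > 0\<close> by (metis divide_pos_pos less_trans of_nat_0_less_iff)
  have gm: "g \<in> borel_measurable ?K"
    using borel_measurable_continuous_onI[OF g(1)]
    by (simp add: measurable_completion measurable_restrict_space1)
  have "bounded (g ` {0..T})"
    using g(1) by (intro compact_imp_bounded compact_continuous_image) (auto intro: continuous_on_subset)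
  then obtain C where C: "\<And>t. t \<in> {0..T} \<Longrightarrow> \<bar>g t\<bar> \<le> C" unfolding bounded_iff by fastforce
  have sg: "sqint ?K g" by (rule sqint_bounded[OF finite_measure_lebesgue_on_Icc gm]) (use C in auto)
  have "(\<integral>t. (step_fun (grid_list T m g) t - f t)\<^sup>2 \<partial>?K) < e" if "m \<ge> m0" for m
  proof -
    have m: "m > 0" "T / m < \<eta>"
    proof -
      show "m > 0" using m0_pos that by simp
      have "T / \<eta> < m" using m0 that by linarith
      with \<open>m > 0\<close> \<open>\<eta> > 0\<close> show "T / m < \<eta>" by (simp add: field_simps)
    qed
    have close: "\<bar>step_fun (grid_list T m g) t - g t\<bar> \<le> \<delta>" if t: "0 < t" "t \<le> T" for t
    proof -
      obtain i where i: "i < m" "grid T m i < t" "t \<le> grid T m (Suc i)"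
        "step_fun (grid_list T m g) t = g (grid T m i)"
        using step_fun_grid_list_eq[OF T m(1) t] by metis
      have "grid T m (Suc i) = grid T m i + T / m" by (simp add: grid_def add_divide_distrib distrib_left)
      then have "\<bar>grid T m i - t\<bar> < \<eta>" using i m by linarith
      with \<eta>[of "grid T m i" t] i(1,4) t grid_bounds[OF T, of i m] show ?thesis by auto
    qed
    have s: "sqint ?K (step_fun (grid_list T m g))" by (rule sqint_step_fun)
    \<comment> \<open>No cell contains the left end point 0, where the step function vanishes
      whatever \<open>g\<close> is.\<close>
    have "AE t in ?K. t \<noteq> 0"
    proof (rule AE_I'[where N = "{0}"])
      show "{0} \<in> null_sets ?K" using T by (auto simp: null_sets_restrict_space)
    qed auto
    then have "(\<integral>t. (step_fun (grid_list T m g) t - g t)\<^sup>2 \<partial>?K) \<le> (\<integral>t. \<delta>\<^sup>2 \<partial>?K)"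
    proof (intro integral_mono_AE, goal_cases)
      case 1 then show ?case using sqint_diff[OF s sg] by (simp add: sqint_def)
    next
      case 2 show ?case by simp
    next
      case 3
      show ?case
        using 3
      proof (rule AE_mp, intro AE_I2 impI)
        fix t assume "t \<in> space ?K" "t \<noteq> 0"
        then have "\<bar>step_fun (grid_list T m g) t - g t\<bar> \<le> \<bar>\<delta>\<bar>" using close[of t] by auto
        then show "(step_fun (grid_list T m g) t - g t)\<^sup>2 \<le> \<delta>\<^sup>2" by (simp only: abs_le_square_iff)
      qed
    qed
    also have "\<dots> = e / 8" using T e by (simp add: measure_lebesgue_on_Icc \<delta>_def)
    finally have 1: "(\<integral>t. (step_fun (grid_list T m g) t - g t)\<^sup>2 \<partial>?K) \<le> e / 8" .
    have "(\<integral>t. (step_fun (grid_list T m g) t - f t)\<^sup>2 \<partial>?K) \<le>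
        2 * (\<integral>t. (step_fun (grid_list T m g) t - g t)\<^sup>2 \<partial>?K) + 2 * (\<integral>t. (g t - f t)\<^sup>2 \<partial>?K)"
      using integral_square_add_le[OF sqint_diff[OF s sg] sqint_diff[OF sg sf]] by simp
    also have "\<dots> < e" using 1 g(2) e by linarith
    finally show ?thesis .
  qed
  with m0_pos show ?thesis by blast
qed

text \<open>All functions are approximated on the same grid \<open>m k\<close>, so that their
  Brownian step integrals are linear combinations of one family of independent increments.\<close>

lemma grid_l2_approx:
  assumes T: "T > 0" and J: "finite J" and f: "\<And>j. j \<in> J \<Longrightarrow> f j \<in> borel_measurable (lebesgue_on {0..T})"
    and B: "\<And>j t. j \<in> J \<Longrightarrow> t \<in> {0..T} \<Longrightarrow> \<bar>f j t\<bar> \<le> B"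
  obtains m g where "\<And>k. m k > 0"
    "\<And>j. j \<in> J \<Longrightarrow> l2lim (lebesgue_on {0..T}) (\<lambda>k. step_fun (grid_list T (m k) (g j k))) (f j)"
proof -
  have "\<exists>g. \<exists>m0>0. \<forall>m\<ge>m0. (\<integral>t. (step_fun (grid_list T m g) t - f j t)\<^sup>2 \<partial>lebesgue_on {0..T}) < 1 / real (Suc k)"
    if "j \<in> J" for j k
    by (rule grid_l2_dense[OF T f B]) (use that in auto)
  then obtain g m0 where gm: "\<And>j k m. j \<in> J \<Longrightarrow> m \<ge> m0 j k \<Longrightarrow>
     (\<integral>t. (step_fun (grid_list T m (g j k)) t - f j t)\<^sup>2 \<partial>lebesgue_on {0..T}) < 1 / real (Suc k)"
    by metis
  define m where "m k = Suc (\<Sum>j\<in>J. m0 j k)" for k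
  have le: "m0 j k \<le> m k" if "j \<in> J" for j k
    using member_le_sum[of j J "\<lambda>j. m0 j k"] that J by (auto simp: m_def)
  show thesis
  proof (rule that)
    show "m k > 0" for k by (simp add: m_def)
    fix j assume j: "j \<in> J"
    have "(\<lambda>k. \<integral>t. (step_fun (grid_list T (m k) (g j k)) t - f j t)\<^sup>2 \<partial>lebesgue_on {0..T}) \<longlonglongrightarrow> 0"
    proof (rule tendsto_sandwich[OF _ _ tendsto_const LIMSEQ_Suc[OF lim_inverse_n']])
      show "\<forall>\<^sub>F k in sequentially. (\<integral>t. (step_fun (grid_list T (m k) (g j k)) t - f j t)\<^sup>2 \<partial>lebesgue_on {0..T})
          \<le> 1 / real (Suc k)"
        using gm[OF j le[OF j]] by (intro always_eventually allI less_imp_le) auto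
    qed auto
    moreover have "sqint (lebesgue_on {0..T}) (f j)"
      by (rule sqint_bounded[OF finite_measure_lebesgue_on_Icc f[OF j]]) (use B j in auto)
    ultimately show "l2lim (lebesgue_on {0..T}) (\<lambda>k. step_fun (grid_list T (m k) (g j k))) (f j)"
      by (simp add: l2lim_def sqint_step_fun)
  qed
qed

section \<open>Isometry of step integrals for the covariance \<open>C * min s t\<close>\<close>

lemma min_increment:
  fixes s u t v :: real
  assumes "s \<le> u" "t \<le> v"
  shows "min u v - min u t - min s v + min s t = max 0 (min u v - max s t)"
  using assms unfolding min_def max_def by (simp split: if_split)

text \<open>The length of the overlap is written with four minima because covariances of increments
  come out in this form.\<close>

lemma integral_indicator_mult_lebesgue_on:
  fixes s u t v T :: real
  assumes "0 \<le> s" "s \<le> u" "u \<le> T" "0 \<le> t" "t \<le> v" "v \<le> T"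
  shows "(\<integral>x. indicator {s<..u} x * indicator {t<..v} x \<partial>lebesgue_on {0..T}) = min u v - min u t - min s v + min s t"
proof -
  have "(\<integral>x. indicator {s<..u} x * indicator {t<..v} x \<partial>lebesgue_on {0..T}) =
       (\<integral>x. indicator {max s t<..min u v} x \<partial>lebesgue_on {0..T} :: real)"
    by (intro Bochner_Integration.integral_cong) (auto simp: indicator_def)
  also have "\<dots> = measure (lebesgue_on {0..T}) {max s t<..min u v}"
  proof -
   have "{max s t<..min u v} \<inter> {0..T} = {max s t<..min u v}" using assms by auto
   then show ?thesis  by simp
  qed
  also have "\<dots> = measure lebesgue {max s t<..min u v}"
    using assms by (intro measure_restrict_space) auto
  also have "\<dots> = max 0 (min u v - max s t)"
  proof (cases "max s t \<le> min u v")
    case True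
    then show ?thesis by (simp only: measure_completion measure_lborel_Ioc sets_lborel greaterThanAtMost_borel max_absorb2 diff_ge_0_iff_ge)
  next
    case False
    then have "{max s t<..min u v} = {}" by auto
    with False show ?thesis by (simp only: measure_empty)
  qed
  finally show ?thesis using min_increment[OF assms(2,5)] by simp
qed

lemma sqint_step_integral:
  assumes "\<And>t. t \<in> {0..T} \<Longrightarrow> sqint M (\<lambda>\<omega>. \<xi> t \<omega>)" "valid_steps T p"
  shows "sqint M (\<lambda>\<omega>. step_integral p (\<lambda>t. \<xi> t \<omega>))"
  unfolding step_integral_def
proof (rule sqint_sum_list)
  fix x assume "x \<in> set p"
  then show "sqint M (\<lambda>\<omega>. case x of (a, s, u) \<Rightarrow> a * (\<xi> u \<omega> - \<xi> s \<omega>))"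
    using assms(2) by (cases x) (auto simp: valid_steps_def intro!: sqint_cmult sqint_diff assms(1))
qed

text \<open>The isometry rests on the covariance function: by bilinearity it reduces to two
  increments, whose covariance is \<open>C\<close> times the length of the common part of the two
  intervals.\<close>

lemma step_integral_inner:
  assumes \<xi>: "\<And>t. t \<in> {0..T} \<Longrightarrow> sqint M (\<lambda>\<omega>. \<xi> t \<omega>)"
    and cov: "\<And>s t. s \<in> {0..T} \<Longrightarrow> t \<in> {0..T} \<Longrightarrow> (\<integral>\<omega>. \<xi> s \<omega> * \<xi> t \<omega> \<partial>M) = C * min s t"
    and p: "valid_steps T p" and q: "valid_steps T q"
  shows "(\<integral>\<omega>. step_integral p (\<lambda>t. \<xi> t \<omega>) * step_integral q (\<lambda>t. \<xi> t \<omega>) \<partial>M) =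
     C * (\<integral>t. step_fun p t * step_fun q t \<partial>lebesgue_on {0..T})"
  unfolding step_integral_def step_fun_def
proof (rule integral_sum_list_isometry)
  fix x assume x: "x \<in> set p \<union> set q"
  then show "sqint M (\<lambda>\<omega>. case x of (a, s, u) \<Rightarrow> a * (\<xi> u \<omega> - \<xi> s \<omega>))"
    using p q by (cases x) (auto simp: valid_steps_def intro!: sqint_cmult sqint_diff \<xi>)
  show "sqint (lebesgue_on {0..T}) (\<lambda>t. case x of (a, s, u) \<Rightarrow> a * indicator {s<..u} t)"
    using sqint_step_fun[of 0 T "[x]"] by (simp add: step_fun_def[abs_def])
next
  fix x y assume xy: "x \<in> set p" "y \<in> set q"
  obtain a s u b t v where x: "x = (a, s, u)" and y: "y = (b, t, v)" by (cases x, cases y)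
  have b: "0 \<le> s" "s \<le> u" "u \<le> T" "0 \<le> t" "t \<le> v" "v \<le> T"
    using p q xy by (auto simp: valid_steps_def x y)
  have i: "integrable M (\<lambda>\<omega>. \<xi> x \<omega> * \<xi> y \<omega>)" if "x \<in> {0..T}" "y \<in> {0..T}" for x y
    using that \<xi> by (auto intro: sqint_mult)
  have "(\<integral>\<omega>. (\<xi> u \<omega> - \<xi> s \<omega>) * (\<xi> v \<omega> - \<xi> t \<omega>) \<partial>M) =
     C * (min u v - min u t - min s v + min s t)"
    using b i by (simp add: left_diff_distrib right_diff_distrib cov min.commute algebra_simps)
  then have "(\<integral>\<omega>. a * b * ((\<xi> u \<omega> - \<xi> s \<omega>) * (\<xi> v \<omega> - \<xi> t \<omega>)) \<partial>M) =
     C * (\<integral>r. a * b * (indicator {s<..u} r * indicator {t<..v} r) \<partial>lebesgue_on {0..T})"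
    using integral_indicator_mult_lebesgue_on[OF b] by simp
  then show "(\<integral>\<omega>. (case x of (a, s, u) \<Rightarrow> a * (\<xi> u \<omega> - \<xi> s \<omega>)) * (case y of (a, s, u) \<Rightarrow> a * (\<xi> u \<omega> - \<xi> s \<omega>)) \<partial>M) =
     C * (\<integral>r. (case x of (a, s, u) \<Rightarrow> a * indicator {s<..u} r) *
                (case y of (a, s, u) \<Rightarrow> a * indicator {s<..u} r) \<partial>lebesgue_on {0..T})"
    unfolding x y prod.case by (simp only: mult_ac)
qed

section \<open>Poisson random measures\<close>

lemma poisson_sums_mean: "(\<lambda>k. real k * (exp (- m) * m ^ k / fact k)) sums m"
proof -
  have "(\<lambda>k. exp (- m) * m * (m ^ k /\<^sub>R fact k)) sums (exp (- m) * m * exp m)"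
    by (intro sums_mult exp_converges)
  also have "exp (- m) * m * exp m = m" by (simp add: exp_minus)
  also have "(\<lambda>k. exp (- m) * m * (m ^ k /\<^sub>R fact k)) =
      (\<lambda>k. real (Suc k) * (exp (- m) * m ^ Suc k / fact (Suc k)))"
    by (rule ext) (simp add: field_simps del: of_nat_Suc)
  finally show ?thesis
    using sums_Suc[of "\<lambda>k. real k * (exp (- m) * m ^ k / fact k)" m] by simp
qed

text \<open>Shifting the index cancels one factor \<open>k\<close> against the factorial; the other
  becomes \<open>k + 1\<close> and splits into the mean and the total mass.\<close>

lemma poisson_sums_square: "(\<lambda>k. (real k)\<^sup>2 * (exp (- m) * m ^ k / fact k)) sums (m + m\<^sup>2)"
proof -
  have "(\<lambda>k. m * (real k * (exp (- m) * m ^ k / fact k) + exp (- m) * (m ^ k /\<^sub>R fact k)))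
     sums (m * (m + exp (- m) * exp m))"
    by (intro sums_mult sums_add poisson_sums_mean exp_converges)
  also have "m * (m + exp (- m) * exp m) = m + m\<^sup>2"
    by (simp add: exp_minus power2_eq_square algebra_simps)
  also have "(\<lambda>k. m * (real k * (exp (- m) * m ^ k / fact k) + exp (- m) * (m ^ k /\<^sub>R fact k))) =
      (\<lambda>k. (real (Suc k))\<^sup>2 * (exp (- m) * m ^ Suc k / fact (Suc k)))"
  proof (rule ext)
    fix k
    have "(real (Suc k))\<^sup>2 * (exp (- m) * m ^ Suc k / fact (Suc k)) = real (Suc k) * (exp (- m) * m ^ Suc k / fact k)"
      by (simp add: power2_eq_square del: of_nat_Suc power_Suc)
    then show "m * (real k * (exp (- m) * m ^ k / fact k) + exp (- m) * (m ^ k /\<^sub>R fact k)) =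
      (real (Suc k))\<^sup>2 * (exp (- m) * m ^ Suc k / fact (Suc k))"
      by (simp add: field_simps)
  qed
  finally show ?thesis
    using sums_Suc[of "\<lambda>k. (real k)\<^sup>2 * (exp (- m) * m ^ k / fact k)" "m + m\<^sup>2"] by simp
qed

lemma (in prob_space) indep_vars_imp_indep_var:
  assumes "indep_vars M' X I" "i \<in> I" "j \<in> I" "i \<noteq> j"
  shows "indep_var (M' i) (X i) (M' j) (X j)"
proof -
  have "indep_var (M' i) ((\<lambda>f. f i) \<circ> (\<lambda>\<omega>. restrict (\<lambda>i. X i \<omega>) {i}))
    (M' j) ((\<lambda>f. f j) \<circ> (\<lambda>\<omega>. restrict (\<lambda>i. X i \<omega>) {j}))"
    by (rule indep_var_compose[OF indep_var_restrict[OF assms(1)]]) (use assms in \<open>auto intro: measurable_component_singleton\<close>)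
  then show ?thesis by (simp add: comp_def)
qed

lemma measure_Int_add_Diff:
  assumes "A \<in> sets N" "B \<in> sets N" "emeasure N A < \<infinity>"
  shows "measure N A = measure N (A \<inter> B) + measure N (A - B)"
proof -
  have "emeasure N (A \<inter> B) \<le> emeasure N A" "emeasure N (A - B) \<le> emeasure N A"
    using assms by (auto intro!: emeasure_mono)
  then have "measure N ((A \<inter> B) \<union> (A - B)) = measure N (A \<inter> B) + measure N (A - B)"
    using assms by (intro measure_Union) (auto simp: top_unique)
  moreover have "(A \<inter> B) \<union> (A - B) = A" by blast
  ultimately show ?thesis by simp
qed

section \<open>Counts of a Poisson random measure: integrability, variances, covariances\<close>

context prob_space
begin

context
  fixes \<mu> :: "'a \<Rightarrow> 'b measure" and \<nu> :: "'b measure"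
  assumes poisson: "poisson_random_measure M \<mu> \<nu>"
begin

lemma prm_measurable[measurable]: "A \<in> sets \<nu> \<Longrightarrow> (\<lambda>\<omega>. emeasure (\<mu> \<omega>) A) \<in> borel_measurable M"
  using poisson by (simp add: poisson_random_measure_def)

lemma prm_measure_measurable[measurable]:
  "A \<in> sets \<nu> \<Longrightarrow> (\<lambda>\<omega>. measure (\<mu> \<omega>) A) \<in> borel_measurable M"
  unfolding measure_def by measurable

lemma prm_prob:
  assumes "A \<in> sets \<nu>" "emeasure \<nu> A < \<infinity>"
  shows "prob {\<omega>\<in>space M. emeasure (\<mu> \<omega>) A = of_nat k} = exp (- measure \<nu> A) * measure \<nu> A ^ k / fact k"
  using poisson assms by (simp add: poisson_random_measure_def)

text \<open>The Poisson weights of the natural numbers already sum to 1, which leaves no mass for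
  other values of \<open>emeasure\<close>, in particular none for infinity.\<close>

lemma prm_AE_nat:
  assumes A: "A \<in> sets \<nu>" "emeasure \<nu> A < \<infinity>"
  shows "AE \<omega> in M. \<exists>k::nat. emeasure (\<mu> \<omega>) A = of_nat k"
proof -
  let ?E = "\<lambda>k::nat. {\<omega>\<in>space M. emeasure (\<mu> \<omega>) A = of_nat k}"
  have E[measurable]: "?E k \<in> events" for k using A(1) by measurable
  have disj: "disjoint_family ?E" by (auto simp: disjoint_family_on_def)
  have "(\<lambda>k. prob (?E k)) sums prob (\<Union>k. ?E k)"
    using E disj by (intro finite_measure_UNION) auto
  moreover have "(\<lambda>k. exp (- measure \<nu> A) * (measure \<nu> A ^ k /\<^sub>R fact k)) sums (exp (- measure \<nu> A) * exp (measure \<nu> A))"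
    by (intro sums_mult exp_converges)
  then have "(\<lambda>k. prob (?E k)) sums 1"
    unfolding prm_prob[OF A] by (simp add: exp_minus field_simps)
  ultimately have "prob (\<Union>k. ?E k) = 1" by (rule sums_unique2)
  then have "AE \<omega> in M. \<omega> \<in> (\<Union>k. ?E k)"
    by (subst (asm) prob_eq_1) (use E in auto)
  then show ?thesis by eventually_elim auto
qed

lemma prm_AE_finite:
  assumes "A \<in> sets \<nu>" "emeasure \<nu> A < \<infinity>"
  shows "AE \<omega> in M. emeasure (\<mu> \<omega>) A < \<infinity>"
  using prm_AE_nat[OF assms] by eventually_elim (auto simp: of_nat_less_top)

text \<open>Integration over the level sets of the count, which exhaust the space up to a null set.
  Moments of counts thereby become Poisson series.\<close>

lemma prm_nn_integral:
  fixes f :: "real \<Rightarrow> real"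
  assumes A: "A \<in> sets \<nu>" "emeasure \<nu> A < \<infinity>"
    and f: "\<And>x. 0 \<le> x \<Longrightarrow> 0 \<le> f x" and [measurable]: "f \<in> borel_measurable borel"
    and S: "(\<lambda>k. f (real k) * (exp (- measure \<nu> A) * measure \<nu> A ^ k / fact k)) sums S"
  shows "(\<integral>\<^sup>+\<omega>. ennreal (f (measure (\<mu> \<omega>) A)) \<partial>M) = ennreal S"
proof -
  let ?E = "\<lambda>k::nat. {\<omega>\<in>space M. emeasure (\<mu> \<omega>) A = of_nat k}"
  have E[measurable]: "?E k \<in> events" for k using A(1) by measurable
  have "(\<integral>\<^sup>+\<omega>. ennreal (f (measure (\<mu> \<omega>) A)) \<partial>M) = (\<integral>\<^sup>+\<omega>. (\<Sum>k. ennreal (f (real k)) * indicator (?E k) \<omega>) \<partial>M)"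
  proof (rule nn_integral_cong_AE)
    show "AE \<omega> in M. ennreal (f (measure (\<mu> \<omega>) A)) = (\<Sum>k. ennreal (f (real k)) * indicator (?E k) \<omega>)"
      using prm_AE_nat[OF A] AE_space
    proof eventually_elim
      fix \<omega> assume "\<exists>k::nat. emeasure (\<mu> \<omega>) A = of_nat k" and \<omega>: "\<omega> \<in> space M"
      then obtain k :: nat where k: "emeasure (\<mu> \<omega>) A = of_nat k" by blast
      have "(\<Sum>j. ennreal (f (real j)) * indicator (?E j) \<omega>) =
          (\<Sum>j\<in>{k}. ennreal (f (real j)) * indicator (?E j) \<omega>)"
        by (rule suminf_finite) (auto simp: k)
      also have "\<dots> = ennreal (f (real k))" by (simp add: k \<omega>)
      also have "real k = measure (\<mu> \<omega>) A"
        using k by (simp add: measure_def)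
      finally show "ennreal (f (measure (\<mu> \<omega>) A)) = (\<Sum>k. ennreal (f (real k)) * indicator (?E k) \<omega>)"
        by simp
    qed
  qed
  also have "\<dots> = (\<Sum>k. \<integral>\<^sup>+\<omega>. ennreal (f (real k)) * indicator (?E k) \<omega> \<partial>M)"
    using A(1) by (intro nn_integral_suminf) measurable
  also have "\<dots> = (\<Sum>k. ennreal (f (real k) * (exp (- measure \<nu> A) * measure \<nu> A ^ k / fact k)))"
  proof (rule arg_cong[where f = suminf], rule ext)
    fix k
    have "(\<integral>\<^sup>+\<omega>. ennreal (f (real k)) * indicator (?E k) \<omega> \<partial>M) = ennreal (f (real k)) * ennreal (prob (?E k))"
      by (subst nn_integral_cmult_indicator) (auto simp: emeasure_eq_measure)
    also have "\<dots> = ennreal (f (real k) * (exp (- measure \<nu> A) * measure \<nu> A ^ k / fact k))"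
      unfolding prm_prob[OF A] by (rule ennreal_mult[symmetric]) (auto intro: f)
    finally show "(\<integral>\<^sup>+\<omega>. ennreal (f (real k)) * indicator (?E k) \<omega> \<partial>M) =
      ennreal (f (real k) * (exp (- measure \<nu> A) * measure \<nu> A ^ k / fact k))" .
  qed
  also have "\<dots> = ennreal S"
  proof (subst suminf_ennreal2)
    show "0 \<le> f (real k) * (exp (- measure \<nu> A) * measure \<nu> A ^ k / fact k)" for k
      by (intro mult_nonneg_nonneg f divide_nonneg_nonneg) auto
  qed (use S in \<open>auto simp: sums_iff\<close>)
  finally show ?thesis .
qed

abbreviation cnt :: "'b set \<Rightarrow> 'a \<Rightarrow> real" where
  "cnt A \<omega> \<equiv> measure (\<mu> \<omega>) A - measure \<nu> A"

lemma sqint_prm: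
  assumes A: "A \<in> sets \<nu>" "emeasure \<nu> A < \<infinity>"
  shows "sqint M (\<lambda>\<omega>. measure (\<mu> \<omega>) A)" "sqint M (cnt A)"
proof -
  have "(\<integral>\<^sup>+\<omega>. ennreal ((measure (\<mu> \<omega>) A)\<^sup>2) \<partial>M) = ennreal (measure \<nu> A + (measure \<nu> A)\<^sup>2)"
    by (rule prm_nn_integral[OF A]) (use poisson_sums_square in auto)
  then show *: "sqint M (\<lambda>\<omega>. measure (\<mu> \<omega>) A)"
    using A(1) by (intro sqint_nn_integral) auto
  show "sqint M (cnt A)"
    by (intro sqint_diff * sqint_const finite_measure_axioms)
qed

lemma integral_prm:
  assumes A: "A \<in> sets \<nu>" "emeasure \<nu> A < \<infinity>"
  shows "(\<integral>\<omega>. cnt A \<omega> \<partial>M) = 0" "(\<integral>\<omega>. (cnt A \<omega>)\<^sup>2 \<partial>M) = measure \<nu> A"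
proof -
  have i: "integrable M (\<lambda>\<omega>. measure (\<mu> \<omega>) A)"
    by (rule sqint_integrable[OF finite_measure_axioms sqint_prm(1)[OF A]])
  have "(\<integral>\<^sup>+\<omega>. ennreal (measure (\<mu> \<omega>) A) \<partial>M) = ennreal (measure \<nu> A)"
    using prm_nn_integral[OF A, of "\<lambda>x. x"] poisson_sums_mean by auto
  then have 1: "(\<integral>\<omega>. measure (\<mu> \<omega>) A \<partial>M) = measure \<nu> A"
    using A(1) by (subst integral_eq_nn_integral) auto
  then show "(\<integral>\<omega>. cnt A \<omega> \<partial>M) = 0"
    using i by (simp add: prob_space)
  have "(\<integral>\<^sup>+\<omega>. ennreal ((measure (\<mu> \<omega>) A)\<^sup>2) \<partial>M) = ennreal (measure \<nu> A + (measure \<nu> A)\<^sup>2)"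
    by (rule prm_nn_integral[OF A]) (use poisson_sums_square in auto)
  then have 2: "(\<integral>\<omega>. (measure (\<mu> \<omega>) A)\<^sup>2 \<partial>M) = measure \<nu> A + (measure \<nu> A)\<^sup>2"
    using A(1) by (subst integral_eq_nn_integral) (auto simp del: ennreal_plus)
  have "(\<integral>\<omega>. (cnt A \<omega>)\<^sup>2 \<partial>M) =
      (\<integral>\<omega>. (measure (\<mu> \<omega>) A)\<^sup>2 + (measure \<nu> A)\<^sup>2 - 2 * measure \<nu> A * measure (\<mu> \<omega>) A \<partial>M)"
    by (intro Bochner_Integration.integral_cong) (auto simp: power2_diff algebra_simps)
  also have "\<dots> = measure \<nu> A"
    using i sqint_square[OF sqint_prm(1)[OF A]] 1 2 by (simp add: prob_space power2_eq_square algebra_simps)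
  finally show "(\<integral>\<omega>. (cnt A \<omega>)\<^sup>2 \<partial>M) = measure \<nu> A" .
qed

lemma integral_prm_disjoint:
  assumes A: "A \<in> sets \<nu>" "emeasure \<nu> A < \<infinity>" and B: "B \<in> sets \<nu>" "emeasure \<nu> B < \<infinity>"
    and disj: "A \<inter> B = {}"
  shows "(\<integral>\<omega>. cnt A \<omega> * cnt B \<omega> \<partial>M) = 0"
proof -
  \<comment> \<open>Independence is given for finite families indexed by natural numbers, so the two
    sets are coded as such a family.\<close>
  let ?F = "\<lambda>i::nat. if i = 0 then A else B"
  have "(\<forall>i<2. ?F i \<in> sets \<nu>) \<and> disjoint_family_on ?F {..<2::nat}"
    using A B disj by (auto simp: disjoint_family_on_def)
  then have "indep_vars (\<lambda>_. borel) (\<lambda>i \<omega>. emeasure (\<mu> \<omega>) (?F i)) {..<2::nat}"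
    using poisson[unfolded poisson_random_measure_def, THEN conjunct2, THEN conjunct2, THEN conjunct2, THEN conjunct2]
    by (elim allE[where x = ?F] allE[where x = 2] mp)
  from indep_vars_imp_indep_var[OF this, of 0 1]
  have "indep_var borel (\<lambda>\<omega>. emeasure (\<mu> \<omega>) A) borel (\<lambda>\<omega>. emeasure (\<mu> \<omega>) B)" by simp
  then have "indep_var borel ((\<lambda>x. enn2real x - measure \<nu> A) \<circ> (\<lambda>\<omega>. emeasure (\<mu> \<omega>) A))
      borel ((\<lambda>x. enn2real x - measure \<nu> B) \<circ> (\<lambda>\<omega>. emeasure (\<mu> \<omega>) B))"
    by (rule indep_var_compose) auto
  then have "indep_var borel (cnt A) borel (cnt B)"
    by (simp add: comp_def measure_def)
  moreover have "integrable M (cnt A)" "integrable M (cnt B)"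
    using sqint_integrable[OF finite_measure_axioms sqint_prm(2)] A B by auto
  ultimately have "(\<integral>\<omega>. cnt A \<omega> * cnt B \<omega> \<partial>M) = (\<integral>\<omega>. cnt A \<omega> \<partial>M) * (\<integral>\<omega>. cnt B \<omega> \<partial>M)"
    by (rule indep_var_lebesgue_integral)
  then show ?thesis by (simp add: integral_prm[OF A])
qed

text \<open>Holds only almost everywhere: an infinite count has \<open>measure\<close> 0, and
  additivity may fail there.\<close>

lemma prm_split:
  assumes A: "A \<in> sets \<nu>" "emeasure \<nu> A < \<infinity>" and B: "B \<in> sets \<nu>"
  shows "AE \<omega> in M. cnt A \<omega> = cnt (A \<inter> B) \<omega> + cnt (A - B) \<omega>"
proof -
  show ?thesis
    using prm_AE_finite[OF A] AE_space
  proof eventually_elim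
    fix \<omega> assume fin: "emeasure (\<mu> \<omega>) A < \<infinity>" and \<omega>: "\<omega> \<in> space M"
    have "sets (\<mu> \<omega>) = sets \<nu>" using poisson \<omega> by (simp add: poisson_random_measure_def)
    then show "cnt A \<omega> = cnt (A \<inter> B) \<omega> + cnt (A - B) \<omega>"
      using measure_Int_add_Diff[OF A(1) B A(2)] measure_Int_add_Diff[of A "\<mu> \<omega>" B] A(1) B fin by simp
  qed
qed

text \<open>Both sets are cut along \<open>A \<inter> B\<close>. Counts on disjoint pieces are
  independent and centred, so only the variance of the common piece survives.\<close>

lemma integral_prm_mult:
  assumes A: "A \<in> sets \<nu>" "emeasure \<nu> A < \<infinity>" and B: "B \<in> sets \<nu>" "emeasure \<nu> B < \<infinity>"
  shows "(\<integral>\<omega>. cnt A \<omega> * cnt B \<omega> \<partial>M) = measure \<nu> (A \<inter> B)"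
proof -
  have fin: "emeasure \<nu> (A \<inter> B) < \<infinity>" "emeasure \<nu> (A - B) < \<infinity>" "emeasure \<nu> (B - A) < \<infinity>"
    using A B by (auto intro: le_less_trans[OF emeasure_mono, of _ A] le_less_trans[OF emeasure_mono, of _ B])
  have m: "A \<inter> B \<in> sets \<nu>" "A - B \<in> sets \<nu>" "B - A \<in> sets \<nu>" using A B by auto
  note s = sqint_prm(2)[OF m(1) fin(1)] sqint_prm(2)[OF m(2) fin(2)] sqint_prm(2)[OF m(3) fin(3)]
  have mc[measurable]: "cnt A \<in> borel_measurable M" "cnt B \<in> borel_measurable M"
    "cnt (A \<inter> B) \<in> borel_measurable M" "cnt (A - B) \<in> borel_measurable M" "cnt (B - A) \<in> borel_measurable M"
    using A B m by auto
  have "(\<integral>\<omega>. cnt A \<omega> * cnt B \<omega> \<partial>M) = (\<integral>\<omega>. cnt (A \<inter> B) \<omega> * cnt (A \<inter> B) \<omega> + cnt (A \<inter> B) \<omega> * cnt (B - A) \<omega>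
      + cnt (A - B) \<omega> * cnt (A \<inter> B) \<omega> + cnt (A - B) \<omega> * cnt (B - A) \<omega> \<partial>M)"
  proof (rule integral_cong_AE)
    show "AE \<omega> in M. cnt A \<omega> * cnt B \<omega> = cnt (A \<inter> B) \<omega> * cnt (A \<inter> B) \<omega> + cnt (A \<inter> B) \<omega> * cnt (B - A) \<omega>
      + cnt (A - B) \<omega> * cnt (A \<inter> B) \<omega> + cnt (A - B) \<omega> * cnt (B - A) \<omega>"
      using prm_split[OF A B(1)] prm_split[OF B A(1)]
      by eventually_elim (simp only: Int_commute[of B A], simp only: ring_distribs add_ac)
  qed measurable
  also have "\<dots> = (\<integral>\<omega>. cnt (A \<inter> B) \<omega> * cnt (A \<inter> B) \<omega> \<partial>M) + (\<integral>\<omega>. cnt (A \<inter> B) \<omega> * cnt (B - A) \<omega> \<partial>M)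
      + (\<integral>\<omega>. cnt (A - B) \<omega> * cnt (A \<inter> B) \<omega> \<partial>M) + (\<integral>\<omega>. cnt (A - B) \<omega> * cnt (B - A) \<omega> \<partial>M)"
    by (simp only: Bochner_Integration.integral_add Bochner_Integration.integrable_add
        sqint_mult[OF s(1) s(1)] sqint_mult[OF s(1) s(3)] sqint_mult[OF s(2) s(1)] sqint_mult[OF s(2) s(3)])
  also have "\<dots> = measure \<nu> (A \<inter> B)"
  proof -
    have "(\<integral>\<omega>. cnt (A \<inter> B) \<omega> * cnt (B - A) \<omega> \<partial>M) = 0" "(\<integral>\<omega>. cnt (A - B) \<omega> * cnt (A \<inter> B) \<omega> \<partial>M) = 0"
      "(\<integral>\<omega>. cnt (A - B) \<omega> * cnt (B - A) \<omega> \<partial>M) = 0"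
      by (rule integral_prm_disjoint; use m fin in auto)+
    moreover have "(\<integral>\<omega>. cnt (A \<inter> B) \<omega> * cnt (A \<inter> B) \<omega> \<partial>M) = measure \<nu> (A \<inter> B)"
      using integral_prm(2)[OF m(1) fin(1)] by (simp add: power2_eq_square)
    ultimately show ?thesis by (simp only:)
  qed
  finally show ?thesis .
qed

section \<open>Compensated integrals of simple functions and their mean square limits\<close>

definition finite_simple :: "(real \<times> 'b set) list \<Rightarrow> bool" where
  "finite_simple p \<longleftrightarrow> (\<forall>(a, A)\<in>set p. A \<in> sets \<nu> \<and> emeasure \<nu> A < \<infinity>)"

lemma sqint_simple_fun: "finite_simple p \<Longrightarrow> sqint \<nu> (simple_fun p)"
  unfolding simple_fun_def[abs_def]
  by (rule sqint_sum_list) (auto simp: finite_simple_def intro!: sqint_cmult sqint_indicator)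

lemma sqint_simple_integral: "finite_simple p \<Longrightarrow> sqint M (simple_compensated_integral \<mu> \<nu> p)"
  unfolding simple_compensated_integral_def[abs_def]
  by (rule sqint_sum_list) (auto simp: finite_simple_def intro!: sqint_cmult sqint_prm)

lemma integral_simple_integral:
  assumes "finite_simple p" shows "(\<integral>\<omega>. simple_compensated_integral \<mu> \<nu> p \<omega> \<partial>M) = 0"
proof -
  have "(\<integral>\<omega>. (\<Sum>x\<leftarrow>p. (case x of (a, A) \<Rightarrow> a * cnt A \<omega>)) * 1 \<partial>M) =
     (\<Sum>x\<leftarrow>p. \<integral>\<omega>. (case x of (a, A) \<Rightarrow> a * cnt A \<omega>) * 1 \<partial>M)"
    using assms by (intro integral_sum_list_mult sqint_const finite_measure_axioms)
      (auto simp: finite_simple_def intro!: sqint_cmult sqint_prm)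
  also have "\<dots> = (\<Sum>x\<leftarrow>p. 0)"
    by (rule arg_cong[where f = sum_list], rule map_cong[OF refl])
       (use assms in \<open>auto simp: finite_simple_def integral_prm\<close>)
  finally show ?thesis by (simp add: simple_compensated_integral_def[abs_def])
qed

lemma simple_integral_isometry:
  assumes p: "finite_simple p" and q: "finite_simple q"
  shows "(\<integral>\<omega>. simple_compensated_integral \<mu> \<nu> p \<omega> * simple_compensated_integral \<mu> \<nu> q \<omega> \<partial>M) =
     (\<integral>u. simple_fun p u * simple_fun q u \<partial>\<nu>)"
proof -
  have "(\<integral>\<omega>. (\<Sum>x\<leftarrow>p. (case x of (a, A) \<Rightarrow> a * cnt A \<omega>)) * (\<Sum>x\<leftarrow>q. (case x of (a, A) \<Rightarrow> a * cnt A \<omega>)) \<partial>M) =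
     1 * (\<integral>u. (\<Sum>x\<leftarrow>p. (case x of (a, A) \<Rightarrow> a * indicator A u)) * (\<Sum>x\<leftarrow>q. (case x of (a, A) \<Rightarrow> a * indicator A u)) \<partial>\<nu>)"
  proof (rule integral_sum_list_isometry)
    fix x assume "x \<in> set p \<union> set q"
    then show "sqint M (\<lambda>\<omega>. case x of (a, A) \<Rightarrow> a * cnt A \<omega>)" "sqint \<nu> (\<lambda>u. case x of (a, A) \<Rightarrow> a * indicator A u)"
      using p q by (auto simp: finite_simple_def intro!: sqint_cmult sqint_prm sqint_indicator)
  next
    fix x y assume xy: "x \<in> set p" "y \<in> set q"
    obtain a A b B where x: "x = (a, A)" and y: "y = (b, B)" by (cases x, cases y)
    have AB: "A \<in> sets \<nu>" "emeasure \<nu> A < \<infinity>" "B \<in> sets \<nu>" "emeasure \<nu> B < \<infinity>"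
      using p q xy by (auto simp: finite_simple_def x y)
    have "(\<integral>u. indicator A u * indicator B u \<partial>\<nu>) = measure \<nu> (A \<inter> B)"
    proof -
      have "A \<inter> B \<inter> space \<nu> = A \<inter> B" using AB sets.sets_into_space by blast
      then show ?thesis by (simp add: indicator_inter_arith[symmetric])
    qed
    with integral_prm_mult[OF AB]
    have "(\<integral>\<omega>. a * b * (cnt A \<omega> * cnt B \<omega>) \<partial>M) = (\<integral>u. a * b * (indicator A u * indicator B u) \<partial>\<nu>)"
      by simp
    then show "(\<integral>\<omega>. (case x of (a, A) \<Rightarrow> a * cnt A \<omega>) * (case y of (a, A) \<Rightarrow> a * cnt A \<omega>) \<partial>M) =
       1 * (\<integral>u. (case x of (a, A) \<Rightarrow> a * indicator A u) * (case y of (a, A) \<Rightarrow> a * indicator A u) \<partial>\<nu>)"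
      unfolding x y prod.case by (simp only: mult_ac mult_1)
  qed
  then show ?thesis by (simp add: simple_compensated_integral_def[abs_def] simple_fun_def[abs_def])
qed

lemma has_compensated_integralE:
  assumes "has_compensated_integral M \<mu> \<nu> h X"
  obtains p where "\<And>k. finite_simple (p k)" "l2lim \<nu> (\<lambda>k. simple_fun (p k)) h"
    "l2lim M (\<lambda>k. simple_compensated_integral \<mu> \<nu> (p k)) X"
proof -
  obtain p where p: "(\<forall>k. \<forall>(a, A)\<in>set (p k). A \<in> sets \<nu> \<and> emeasure \<nu> A < \<infinity>) \<and>
      L2_tendsto \<nu> (\<lambda>k. simple_fun (p k)) h \<and> L2_tendsto M (\<lambda>k. simple_compensated_integral \<mu> \<nu> (p k)) X"
    using assms unfolding has_compensated_integral_def by (rule exE)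
  then have f: "finite_simple (p k)" for k by (simp add: finite_simple_def)
  show thesis
    by (rule that[of p]) (simp_all add: p f l2lim_iff_L2_tendsto sqint_simple_integral sqint_simple_fun)
qed

text \<open>The approximating sequences of \<open>X\<close> and \<open>Y\<close> are unrelated, so
  the isometry of simple integrals is used in its bilinear form; both sides then pass to the
  limit.\<close>

lemma compensated_integral_isometry:
  assumes X: "has_compensated_integral M \<mu> \<nu> h X" and Y: "has_compensated_integral M \<mu> \<nu> h' Y"
  shows "(\<integral>\<omega>. X \<omega> * Y \<omega> \<partial>M) = (\<integral>u. h u * h' u \<partial>\<nu>)"
proof -
  obtain p where p: "\<And>k. finite_simple (p k)" "l2lim \<nu> (\<lambda>k. simple_fun (p k)) h"
    "l2lim M (\<lambda>k. simple_compensated_integral \<mu> \<nu> (p k)) X"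
    by (rule has_compensated_integralE[OF X]) (rule that)
  obtain q where q: "\<And>k. finite_simple (q k)" "l2lim \<nu> (\<lambda>k. simple_fun (q k)) h'"
    "l2lim M (\<lambda>k. simple_compensated_integral \<mu> \<nu> (q k)) Y"
    by (rule has_compensated_integralE[OF Y]) (rule that)
  have "(\<lambda>k. \<integral>u. simple_fun (p k) u * simple_fun (q k) u \<partial>\<nu>) \<longlonglongrightarrow> (\<integral>u. h u * h' u \<partial>\<nu>)"
    by (rule l2lim_mult[OF p(2) q(2)])
  moreover have "(\<lambda>k. \<integral>u. simple_fun (p k) u * simple_fun (q k) u \<partial>\<nu>) \<longlonglongrightarrow> (\<integral>\<omega>. X \<omega> * Y \<omega> \<partial>M)"
    using l2lim_mult[OF p(3) q(3)] by (simp add: simple_integral_isometry p q)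
  ultimately show ?thesis by (rule LIMSEQ_unique[symmetric])
qed

end

end

text \<open>Infinite mass can accumulate only at 0, which is removed. By Markov's inequality for the
  second moment, the set where \<open>n * x ^ 2\<close> is at least 1 has mass at most
  \<open>n\<close>, and these sets exhaust the space. Sigma-finiteness gives Tonelli for the
  compensator.\<close>

lemma levy_sigma_finite:
  assumes "levy_measure_space levy" shows "sigma_finite_measure levy"
proof -
  have s: "sets levy = sets (restrict_space borel (UNIV - {0}))" and one: "(\<integral>\<^sup>+x. ennreal (x ^ 2) \<partial>levy) = 1"
    using assms by (auto simp: levy_measure_space_def)
  have sp: "space levy = UNIV - {0}" using sets_eq_imp_space_eq[OF s] by (simp add: space_restrict_space)
  have id[measurable]: "(\<lambda>x. x) \<in> borel_measurable levy"
    by (subst measurable_cong_sets[OF s refl]) (auto intro: measurable_restrict_space1)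
  define B where "B n = {x\<in>space levy. 1 \<le> ennreal (real n * x ^ 2)}" for n :: nat
  have Bm: "B n \<in> sets levy" for n unfolding B_def by measurable
  have "emeasure levy (B n) \<noteq> \<infinity>" for n
  proof -
    have "emeasure levy (B n) = (\<integral>\<^sup>+x. indicator (B n) x \<partial>levy)" using Bm by simp
    also have "\<dots> \<le> (\<integral>\<^sup>+x. ennreal (real n * x ^ 2) \<partial>levy)"
      by (intro nn_integral_mono) (auto simp: B_def indicator_def)
    also have "\<dots> = ennreal (real n)"
      using one by (simp add: ennreal_mult nn_integral_cmult)
    finally show ?thesis by (auto simp: top_unique)
  qed
  moreover have "(\<Union>n. B n) = space levy"
  proof (intro equalityI subsetI)
    fix x assume x: "x \<in> space levy"
    then have "x \<noteq> 0" by (simp add: sp)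
    then obtain n :: nat where "1 / x ^ 2 < real n" using reals_Archimedean2 by blast
    with \<open>x \<noteq> 0\<close> have "1 \<le> real n * x ^ 2" by (simp add: field_simps)
    then show "x \<in> (\<Union>n. B n)" using x by (auto simp: B_def intro!: exI[of _ n])
  qed (auto simp: B_def)
  ultimately show ?thesis
    by (intro sigma_finite_measure.intro exI[of _ "range B"]) (use Bm in auto)
qed

text \<open>Tonelli separates time and jump size. The normalisation of the second moment to 1 gives
  \<open>z\<close> the covariance of a Brownian motion.\<close>

lemma jump_compensator_inner:
  assumes levy: "levy_measure_space levy" and st: "0 \<le> s" "0 \<le> t"
  shows "(\<integral>u. (case u of (r, x) \<Rightarrow> indicator {0<..s} r * x) * (case u of (r, x) \<Rightarrow> indicator {0<..t} r * x)
     \<partial>jump_compensator levy) = min s t"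
proof -
  interpret L: sigma_finite_measure levy by (rule levy_sigma_finite[OF levy])
  have s: "sets levy = sets (restrict_space borel (UNIV - {0}))" and one: "(\<integral>\<^sup>+x. ennreal (x ^ 2) \<partial>levy) = 1"
    using levy by (auto simp: levy_measure_space_def)
  have id[measurable]: "(\<lambda>x. x) \<in> borel_measurable levy"
    by (subst measurable_cong_sets[OF s refl]) (auto intro: measurable_restrict_space1)
  let ?R = "restrict_space lborel {0::real..}"
  have idR[measurable]: "(\<lambda>x. x) \<in> borel_measurable ?R"
    by (auto intro: measurable_restrict_space1)
  let ?f = "\<lambda>(r, x). indicator {0<..min s t} r * x ^ 2 :: real"
  have "(\<integral>u. (case u of (r, x) \<Rightarrow> indicator {0<..s} r * x) * (case u of (r, x) \<Rightarrow> indicator {0<..t} r * x)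
     \<partial>jump_compensator levy) = (\<integral>u. ?f u \<partial>jump_compensator levy)"
    by (intro Bochner_Integration.integral_cong) (auto simp: indicator_def power2_eq_square)
  also have "\<dots> = enn2real (\<integral>\<^sup>+u. ennreal (?f u) \<partial>jump_compensator levy)"
    unfolding jump_compensator_def by (intro integral_eq_nn_integral AE_I2) (auto, measurable)
  also have "(\<integral>\<^sup>+u. ennreal (?f u) \<partial>jump_compensator levy) =
      (\<integral>\<^sup>+r. \<integral>\<^sup>+x. ennreal (?f (r, x)) \<partial>levy \<partial>?R)"
    unfolding jump_compensator_def by (rule L.nn_integral_fst[symmetric]) measurable
  also have "\<dots> = (\<integral>\<^sup>+r. indicator {0<..min s t} r \<partial>?R)"
    using one by (intro nn_integral_cong) (auto simp: indicator_def)
  also have "\<dots> = emeasure ?R {0<..min s t}"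
    by (intro nn_integral_indicator) (auto simp: sets_restrict_space_iff)
  also have "\<dots> = ennreal (min s t)"
    using st by (subst emeasure_restrict_space) auto
  finally show ?thesis using st by simp
qed

section \<open>The smoothed norm\<close>

definition smooth_norm :: "real \<Rightarrow> 'i set \<Rightarrow> ('i \<Rightarrow> real) \<Rightarrow> real" where
  "smooth_norm \<epsilon> J x = sqrt (\<epsilon>\<^sup>2 + (\<Sum>l\<in>J. (x l)\<^sup>2))"

context
  fixes \<epsilon> :: real and J :: "'i set"
  assumes eps: "\<epsilon> > 0" and J: "finite J"
begin

lemma smooth_norm_sq: "(smooth_norm \<epsilon> J x)\<^sup>2 = \<epsilon>\<^sup>2 + (\<Sum>l\<in>J. (x l)\<^sup>2)"
  by (simp add: smooth_norm_def sum_nonneg)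

lemma smooth_norm_ge: "\<epsilon> \<le> smooth_norm \<epsilon> J x"
  unfolding smooth_norm_def by (rule real_le_rsqrt) (simp add: sum_nonneg)

lemma smooth_norm_pos: "0 < smooth_norm \<epsilon> J x"
  using smooth_norm_ge[of x] eps by linarith

text \<open>Cauchy-Schwarz for \<open>x\<close> and \<open>y\<close> extended by one further
  coordinate \<epsilon>; the smoothed norms are the Euclidean norms of the extended vectors.
  Monotonicity and the Lipschitz bound both follow from it.\<close>

lemma smooth_norm_inner: "\<epsilon>\<^sup>2 + (\<Sum>l\<in>J. x l * y l) \<le> smooth_norm \<epsilon> J x * smooth_norm \<epsilon> J y"
proof -
  define a b where "a = L2_set x J" "b = L2_set y J"
  have sq: "a\<^sup>2 = (\<Sum>l\<in>J. (x l)\<^sup>2)" "b\<^sup>2 = (\<Sum>l\<in>J. (y l)\<^sup>2)"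
    by (simp_all add: a_b_def L2_set_def sum_nonneg)
  have "(\<Sum>l\<in>J. x l * y l) \<le> (\<Sum>l\<in>J. \<bar>x l\<bar> * \<bar>y l\<bar>)"
    by (intro sum_mono) (metis abs_ge_self abs_mult)
  also have "\<dots> \<le> a * b" unfolding a_b_def by (rule L2_set_mult_ineq)
  finally have "\<epsilon>\<^sup>2 + (\<Sum>l\<in>J. x l * y l) \<le> \<epsilon>\<^sup>2 + a * b" by simp
  also have "\<dots> \<le> sqrt ((\<epsilon>\<^sup>2 + a\<^sup>2) * (\<epsilon>\<^sup>2 + b\<^sup>2))"
  proof (rule real_le_rsqrt)
    have "0 \<le> \<epsilon>\<^sup>2 * (a - b)\<^sup>2" by simp
    then show "(\<epsilon>\<^sup>2 + a * b)\<^sup>2 \<le> (\<epsilon>\<^sup>2 + a\<^sup>2) * (\<epsilon>\<^sup>2 + b\<^sup>2)"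
      by (simp add: power2_eq_square algebra_simps)
  qed
  finally show ?thesis by (simp add: smooth_norm_def sq real_sqrt_mult)
qed

lemma smooth_norm_component: "j \<in> J \<Longrightarrow> \<bar>x j\<bar> \<le> smooth_norm \<epsilon> J x"
  unfolding smooth_norm_def using member_le_sum[of j J "\<lambda>l. (x l)\<^sup>2"] J
  by (intro real_le_rsqrt) (simp add: add_increasing)

lemma smooth_quotient_bounded: "j \<in> J \<Longrightarrow> \<bar>x j / smooth_norm \<epsilon> J x\<bar> \<le> 1"
  using smooth_norm_component[of j x] smooth_norm_pos[of x] by (simp add: divide_le_eq)

lemma smooth_quotient_monotone:
  "0 \<le> (\<Sum>j\<in>J. (x j / smooth_norm \<epsilon> J x - y j / smooth_norm \<epsilon> J y) * (x j - y j))"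
proof -
  define p q where "p = smooth_norm \<epsilon> J x" "q = smooth_norm \<epsilon> J y"
  define c where "c = (\<Sum>l\<in>J. x l * y l)"
  have pos: "p > 0" "q > 0" using smooth_norm_pos by (auto simp: p_q_def)
  have "(\<Sum>j\<in>J. (x j / p - y j / q) * (x j - y j)) =
     (\<Sum>j\<in>J. (x j)\<^sup>2 / p + (y j)\<^sup>2 / q - (x j * y j) * (1 / p + 1 / q))"
    by (intro sum.cong refl) (simp add: power2_eq_square algebra_simps)
  also have "\<dots> = (p\<^sup>2 - \<epsilon>\<^sup>2) / p + (q\<^sup>2 - \<epsilon>\<^sup>2) / q - c * (1 / p + 1 / q)"
    by (simp add: sum.distrib sum_subtractf sum_divide_distrib[symmetric] sum_distrib_right[symmetric]
        p_q_def smooth_norm_sq c_def)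
  \<comment> \<open>Uses \<open>p + q = p * q * (1 / p + 1 / q)\<close>; the first factor is the
    slack in Cauchy-Schwarz.\<close>
  also have "\<dots> = (p * q - (\<epsilon>\<^sup>2 + c)) * (1 / p + 1 / q)"
    using pos by (simp add: field_simps power2_eq_square)
  also have "\<dots> \<ge> 0"
    using smooth_norm_inner[of x y] pos by (intro mult_nonneg_nonneg) (auto simp: p_q_def c_def)
  finally show ?thesis by (simp add: p_q_def)
qed

lemma smooth_norm_diff_sq: "(smooth_norm \<epsilon> J x - smooth_norm \<epsilon> J y)\<^sup>2 \<le> (\<Sum>l\<in>J. (x l - y l)\<^sup>2)"
  using smooth_norm_inner[of x y]
  by (simp add: power2_diff smooth_norm_sq sum.distrib sum_subtractf sum_distrib_left[symmetric] mult.assoc)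

text \<open>Changing the numerator and changing the norm each cost at most
  \<open>D / \<epsilon>\<close>, with \<open>D\<close> the distance of \<open>x\<close> and
  \<open>y\<close> on \<open>J\<close>; squaring the sum gives the factor 4. The bound transfers
  mean square convergence from the coordinates to the quotient.\<close>

lemma smooth_quotient_lipschitz:
  assumes "j \<in> J"
  shows "(x j / smooth_norm \<epsilon> J x - y j / smooth_norm \<epsilon> J y)\<^sup>2 \<le> 4 / \<epsilon>\<^sup>2 * (\<Sum>l\<in>J. (x l - y l)\<^sup>2)"
proof -
  define p q where "p = smooth_norm \<epsilon> J x" "q = smooth_norm \<epsilon> J y"
  define D where "D = sqrt (\<Sum>l\<in>J. (x l - y l)\<^sup>2)"
  have D2: "D\<^sup>2 = (\<Sum>l\<in>J. (x l - y l)\<^sup>2)" and D0: "0 \<le> D" by (simp_all add: D_def sum_nonneg)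
  have pos: "p > 0" "q > 0" "\<epsilon> \<le> p" using smooth_norm_pos smooth_norm_ge by (auto simp: p_q_def)
  have "(p - q)\<^sup>2 \<le> D\<^sup>2" using smooth_norm_diff_sq[of x y] by (simp add: D2 p_q_def)
  then have pq: "\<bar>p - q\<bar> \<le> D" using D0 by (simp add: power2_le_iff_abs_le)
  have "(x j - y j)\<^sup>2 \<le> D\<^sup>2" unfolding D2 using member_le_sum[of j J "\<lambda>l. (x l - y l)\<^sup>2"] assms J by simp
  then have xy: "\<bar>x j - y j\<bar> \<le> D" using D0 by (simp add: power2_le_iff_abs_le)
  have yq: "\<bar>y j / q\<bar> \<le> 1" using smooth_quotient_bounded[OF assms, of y] by (simp add: p_q_def)
  have "x j / p - y j / q = ((x j - y j) + y j / q * (q - p)) / p"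
    using pos by (simp add: field_simps)
  then have "\<bar>x j / p - y j / q\<bar> = \<bar>(x j - y j) + y j / q * (q - p)\<bar> / p"
    using pos by simp
  also have "\<bar>(x j - y j) + y j / q * (q - p)\<bar> \<le> D + 1 * D"
  proof -
    have "\<bar>y j / q * (q - p)\<bar> \<le> 1 * D"
      unfolding abs_mult using yq pq by (intro mult_mono) (auto simp: abs_minus_commute)
    with xy show ?thesis by linarith
  qed
  then have "\<bar>(x j - y j) + y j / q * (q - p)\<bar> / p \<le> 2 * D / \<epsilon>"
    using pos eps D0 by (intro frac_le) auto
  finally have "\<bar>x j / p - y j / q\<bar> \<le> \<bar>2 * D / \<epsilon>\<bar>" using eps D0 by simp
  then have "(x j / p - y j / q)\<^sup>2 \<le> (2 * D / \<epsilon>)\<^sup>2" by (simp only: abs_le_square_iff)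
  then show ?thesis by (simp add: p_q_def power_divide power_mult_distrib D2)
qed

text \<open>The derivative is taken along a line because Stein's identity is applied to one Gaussian
  increment at a time, and this moves the whole vector in one direction \<open>a\<close>.\<close>

lemma smooth_quotient_deriv:
  fixes a b :: "'i \<Rightarrow> real"
  defines "x \<equiv> \<lambda>t l. b l + a l * t"
  shows "((\<lambda>t. x t j / smooth_norm \<epsilon> J (x t)) has_real_derivative
     (a j / smooth_norm \<epsilon> J (x t) - x t j * (\<Sum>l\<in>J. x t l * a l) / (smooth_norm \<epsilon> J (x t))^3)) (at t)"
proof -
  let ?q = "\<lambda>t. \<epsilon>\<^sup>2 + (\<Sum>l\<in>J. (x t l)\<^sup>2)"
  have pos: "0 < ?q t" for t using eps by (intro add_pos_nonneg sum_nonneg) auto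
  have dq: "(?q has_real_derivative 2 * (\<Sum>l\<in>J. x t l * a l)) (at t)"
    unfolding x_def by (auto intro!: derivative_eq_intros simp: sum_distrib_left mult_ac)
  have "((\<lambda>t. sqrt (?q t)) has_real_derivative inverse (sqrt (?q t)) / 2 * (2 * (\<Sum>l\<in>J. x t l * a l))) (at t)"
    by (rule DERIV_chain2[OF DERIV_real_sqrt[OF pos] dq])
  then have dn: "((\<lambda>t. smooth_norm \<epsilon> J (x t)) has_real_derivative (\<Sum>l\<in>J. x t l * a l) / smooth_norm \<epsilon> J (x t)) (at t)"
    unfolding smooth_norm_def by (rule DERIV_cong) (simp add: field_simps)
  have dx: "((\<lambda>t. x t j) has_real_derivative a j) (at t)"
    unfolding x_def by (auto intro!: derivative_eq_intros)
  show ?thesis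
    by (rule DERIV_cong[OF DERIV_divide[OF dx dn]])
       (use smooth_norm_pos[of "x t"] in \<open>auto simp: field_simps power2_eq_square power3_eq_cube\<close>)
qed

text \<open>Each of the two terms has one denominator that is at least \<epsilon>, and its other
  quotients are at most 1 in modulus. The bound makes the derivative integrable and admissible in
  Stein's identity.\<close>

lemma smooth_quotient_deriv_bounded:
  fixes a :: "'i \<Rightarrow> real"
  assumes "j \<in> J"
  shows "\<bar>a j / smooth_norm \<epsilon> J x - x j * (\<Sum>l\<in>J. x l * a l) / (smooth_norm \<epsilon> J x)^3\<bar> \<le>
     2 / \<epsilon> * (\<Sum>l\<in>J. \<bar>a l\<bar>)"
proof -
  let ?r = "smooth_norm \<epsilon> J x"
  have r: "0 < ?r" "\<epsilon> \<le> ?r" by (rule smooth_norm_pos smooth_norm_ge)+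
  have aj: "\<bar>a j\<bar> \<le> (\<Sum>l\<in>J. \<bar>a l\<bar>)" using member_le_sum[of j J "\<lambda>l. \<bar>a l\<bar>"] assms J by simp
  then have 1: "\<bar>a j / ?r\<bar> \<le> (\<Sum>l\<in>J. \<bar>a l\<bar>) / \<epsilon>"
    using r eps by (simp add: frac_le)
  have "\<bar>\<Sum>l\<in>J. x l / ?r * a l\<bar> \<le> (\<Sum>l\<in>J. 1 * \<bar>a l\<bar>)"
  proof (intro order_trans[OF sum_abs] sum_mono)
    fix l assume "l \<in> J"
    then show "\<bar>x l / ?r * a l\<bar> \<le> 1 * \<bar>a l\<bar>"
      unfolding abs_mult by (intro mult_right_mono smooth_quotient_bounded) auto
  qed
  then have "\<bar>x j / ?r * (\<Sum>l\<in>J. x l / ?r * a l) / ?r\<bar> \<le> 1 * (\<Sum>l\<in>J. \<bar>a l\<bar>) / \<epsilon>"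
    unfolding abs_divide[of _ ?r] abs_mult using r eps smooth_quotient_bounded[OF assms, of x]
    by (intro frac_le mult_mono) (auto simp: sum_nonneg)
  moreover have "x j * (\<Sum>l\<in>J. x l * a l) / ?r^3 = x j / ?r * (\<Sum>l\<in>J. x l / ?r * a l) / ?r"
    by (simp add: sum_divide_distrib[symmetric] power3_eq_cube)
  ultimately have 2: "\<bar>x j * (\<Sum>l\<in>J. x l * a l) / ?r^3\<bar> \<le> (\<Sum>l\<in>J. \<bar>a l\<bar>) / \<epsilon>"
    by (simp only: mult_1)
  have "2 / \<epsilon> * (\<Sum>l\<in>J. \<bar>a l\<bar>) = (\<Sum>l\<in>J. \<bar>a l\<bar>) / \<epsilon> + (\<Sum>l\<in>J. \<bar>a l\<bar>) / \<epsilon>"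
    by simp
  with abs_triangle_ineq4[of "a j / ?r" "x j * (\<Sum>l\<in>J. x l * a l) / ?r^3"] 1 2
  show ?thesis by linarith
qed

end

lemma borel_measurable_smooth_norm[measurable]:
  "(\<And>l. l \<in> J \<Longrightarrow> (\<lambda>\<omega>. X l \<omega>) \<in> borel_measurable M) \<Longrightarrow>
   (\<lambda>\<omega>. smooth_norm \<epsilon> J (\<lambda>l. X l \<omega>)) \<in> borel_measurable M"
  unfolding smooth_norm_def by measurable

lemma sqint_smooth_quotient:
  assumes "\<epsilon> > 0" "finite J" "j \<in> J" "finite_measure M" "\<And>l. l \<in> J \<Longrightarrow> (\<lambda>\<omega>. X l \<omega>) \<in> borel_measurable M"
  shows "sqint M (\<lambda>\<omega>. X j \<omega> / smooth_norm \<epsilon> J (\<lambda>l. X l \<omega>))"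
proof (rule sqint_bounded[OF assms(4), where B = 1])
  show "(\<lambda>\<omega>. X j \<omega> / smooth_norm \<epsilon> J (\<lambda>l. X l \<omega>)) \<in> borel_measurable M"
    by (intro borel_measurable_divide borel_measurable_smooth_norm assms(3,5))
qed (rule smooth_quotient_bounded[OF assms(1-3)])

lemma integrable_inverse_smooth_norm:
  assumes "\<epsilon> > 0" "finite J" "finite_measure M" "\<And>l. l \<in> J \<Longrightarrow> (\<lambda>\<omega>. X l \<omega>) \<in> borel_measurable M"
  shows "integrable M (\<lambda>\<omega>. 1 / smooth_norm \<epsilon> J (\<lambda>l. X l \<omega>))"
proof (rule finite_measure.integrable_const_bound[OF assms(3), of _ "1 / \<epsilon>"])
  show "AE \<omega> in M. norm (1 / smooth_norm \<epsilon> J (\<lambda>l. X l \<omega>)) \<le> 1 / \<epsilon>"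
    using smooth_norm_ge[OF assms(1,2)] smooth_norm_pos[OF assms(1,2)] assms(1)
    by (intro AE_I2) (simp add: frac_le less_imp_le)
  show "(\<lambda>\<omega>. 1 / smooth_norm \<epsilon> J (\<lambda>l. X l \<omega>)) \<in> borel_measurable M"
    by (intro borel_measurable_divide borel_measurable_const borel_measurable_smooth_norm assms(4))
qed

text \<open>The pointwise Lipschitz bound is integrated; its constant depends on \<epsilon>, which
  stays fixed here.\<close>

lemma l2lim_smooth_quotient:
  assumes eps: "\<epsilon> > 0" and J: "finite J" and j: "j \<in> J" and fin: "finite_measure M"
    and l: "\<And>l. l \<in> J \<Longrightarrow> l2lim M (X l) (Y l)"
  shows "l2lim M (\<lambda>k \<omega>. X j k \<omega> / smooth_norm \<epsilon> J (\<lambda>l. X l k \<omega>)) (\<lambda>\<omega>. Y j \<omega> / smooth_norm \<epsilon> J (\<lambda>l. Y l \<omega>))"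
proof -
  have m: "X l k \<in> borel_measurable M" "Y l \<in> borel_measurable M" if "l \<in> J" for l k
    using l[OF that] by (auto simp: l2lim_def sqint_def)
  have sX: "sqint M (\<lambda>\<omega>. X j k \<omega> / smooth_norm \<epsilon> J (\<lambda>l. X l k \<omega>))" for k
    by (rule sqint_smooth_quotient[OF eps J j fin]) (rule m)
  have sY: "sqint M (\<lambda>\<omega>. Y j \<omega> / smooth_norm \<epsilon> J (\<lambda>l. Y l \<omega>))"
    by (rule sqint_smooth_quotient[OF eps J j fin]) (rule m)
  have i: "integrable M (\<lambda>\<omega>. (X l k \<omega> - Y l \<omega>)\<^sup>2)" if "l \<in> J" for l k
    using l[OF that] by (intro sqint_square sqint_diff) (auto simp: l2lim_def)
  have "(\<lambda>k. \<integral>\<omega>. (X j k \<omega> / smooth_norm \<epsilon> J (\<lambda>l. X l k \<omega>) - Y j \<omega> / smooth_norm \<epsilon> J (\<lambda>l. Y l \<omega>))\<^sup>2 \<partial>M) \<longlonglongrightarrow> 0"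
  proof (rule tendsto_sandwich[OF _ _ tendsto_const])
    have "(\<lambda>k. 4 / \<epsilon>\<^sup>2 * (\<Sum>l\<in>J. \<integral>\<omega>. (X l k \<omega> - Y l \<omega>)\<^sup>2 \<partial>M)) \<longlonglongrightarrow> 4 / \<epsilon>\<^sup>2 * (\<Sum>l\<in>J. 0)"
      using l by (intro tendsto_intros) (auto simp: l2lim_def)
    then show "(\<lambda>k. 4 / \<epsilon>\<^sup>2 * (\<Sum>l\<in>J. \<integral>\<omega>. (X l k \<omega> - Y l \<omega>)\<^sup>2 \<partial>M)) \<longlonglongrightarrow> 0" by simp
    show "\<forall>\<^sub>F k in sequentially. (\<integral>\<omega>. (X j k \<omega> / smooth_norm \<epsilon> J (\<lambda>l. X l k \<omega>) - Y j \<omega> / smooth_norm \<epsilon> J (\<lambda>l. Y l \<omega>))\<^sup>2 \<partial>M)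
       \<le> 4 / \<epsilon>\<^sup>2 * (\<Sum>l\<in>J. \<integral>\<omega>. (X l k \<omega> - Y l \<omega>)\<^sup>2 \<partial>M)"
    proof (intro always_eventually allI)
      fix k
      have "(\<integral>\<omega>. (X j k \<omega> / smooth_norm \<epsilon> J (\<lambda>l. X l k \<omega>) - Y j \<omega> / smooth_norm \<epsilon> J (\<lambda>l. Y l \<omega>))\<^sup>2 \<partial>M)
         \<le> (\<integral>\<omega>. 4 / \<epsilon>\<^sup>2 * (\<Sum>l\<in>J. (X l k \<omega> - Y l \<omega>)\<^sup>2) \<partial>M)"
        using smooth_quotient_lipschitz[OF eps J j, of "\<lambda>l. X l k _" "\<lambda>l. Y l _"] i
        by (intro integral_mono sqint_square[OF sqint_diff[OF sX sY]]) auto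
      also have "\<dots> = 4 / \<epsilon>\<^sup>2 * (\<Sum>l\<in>J. \<integral>\<omega>. (X l k \<omega> - Y l \<omega>)\<^sup>2 \<partial>M)"
        using i by simp
      finally show "(\<integral>\<omega>. (X j k \<omega> / smooth_norm \<epsilon> J (\<lambda>l. X l k \<omega>) - Y j \<omega> / smooth_norm \<epsilon> J (\<lambda>l. Y l \<omega>))\<^sup>2 \<partial>M)
         \<le> 4 / \<epsilon>\<^sup>2 * (\<Sum>l\<in>J. \<integral>\<omega>. (X l k \<omega> - Y l \<omega>)\<^sup>2 \<partial>M)" .
    qed
  qed auto
  with sX sY show ?thesis by (simp add: l2lim_def)
qed

section \<open>Gaussian integration by parts and Brownian motion\<close>

lemma normal_density_tendsto_0:
  assumes "\<sigma> > 0"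
  shows "(normal_density 0 \<sigma> \<longlongrightarrow> 0) at_top" "(normal_density 0 \<sigma> \<longlongrightarrow> 0) at_bot"
proof -
  have "filterlim (\<lambda>x. 1 / (2 * \<sigma>\<^sup>2) * x\<^sup>2) at_top at_top"
    using assms by (intro filterlim_tendsto_pos_mult_at_top[OF tendsto_const] filterlim_pow_at_top filterlim_ident) auto
  then have "((\<lambda>x. exp (- (1 / (2 * \<sigma>\<^sup>2) * x\<^sup>2))) \<longlongrightarrow> 0) at_top"
    by (intro filterlim_compose[OF exp_at_bot]) (simp add: filterlim_uminus_at_bot)
  then have "((\<lambda>x. 1 / sqrt (2 * pi * \<sigma>\<^sup>2) * exp (- (1 / (2 * \<sigma>\<^sup>2) * x\<^sup>2))) \<longlongrightarrow> 1 / sqrt (2 * pi * \<sigma>\<^sup>2) * 0) at_top"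
    by (intro tendsto_intros)
  then show *: "(normal_density 0 \<sigma> \<longlongrightarrow> 0) at_top"
    by (simp add: normal_density_def[abs_def])
  have "(\<lambda>x. normal_density 0 \<sigma> (- x)) = normal_density 0 \<sigma>" by (simp add: normal_density_def fun_eq_iff)
  with * show "(normal_density 0 \<sigma> \<longlongrightarrow> 0) at_bot"
    by (simp add: filterlim_at_bot_mirror)
qed

lemma normal_density_deriv:
  assumes "\<sigma> > 0"
  shows "(normal_density 0 \<sigma> has_real_derivative - (x / \<sigma>\<^sup>2) * normal_density 0 \<sigma> x) (at x)"
proof -
  have "((\<lambda>x. 1 / sqrt (2 * pi * \<sigma>\<^sup>2) * exp (- (x - 0)\<^sup>2 / (2 * \<sigma>\<^sup>2))) has_real_derivative
     1 / sqrt (2 * pi * \<sigma>\<^sup>2) * (exp (- (x - 0)\<^sup>2 / (2 * \<sigma>\<^sup>2)) * (- (x / \<sigma>\<^sup>2)))) (at x)"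
    using assms by (auto intro!: derivative_eq_intros simp: field_simps)
  then show ?thesis by (simp add: normal_density_def[abs_def] mult_ac)
qed

text \<open>Integration by parts: the boundary terms of
  \<open>normal_density 0 \<sigma> x * g x\<close> vanish because \<open>g\<close> is bounded, and
  differentiating the density produces the factor \<open>- (x / \<sigma>\<^sup>2)\<close>.\<close>

lemma stein_normal_density:
  assumes \<sigma>: "\<sigma> > 0" and g: "\<And>x. (g has_real_derivative g' x) (at x)"
    and g': "continuous_on UNIV g'" and B: "\<And>x. \<bar>g x\<bar> \<le> B" "\<And>x. \<bar>g' x\<bar> \<le> B'"
  shows "(\<integral>x. normal_density 0 \<sigma> x * (x * g x) \<partial>lborel) = \<sigma>\<^sup>2 * (\<integral>x. normal_density 0 \<sigma> x * g' x \<partial>lborel)"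
proof -
  let ?n = "normal_density 0 \<sigma>"
  have cg: "continuous_on UNIV g"
    by (rule DERIV_continuous_on) (use g in \<open>auto intro: has_field_derivative_at_within\<close>)
  have mg[measurable]: "g \<in> borel_measurable borel" "g' \<in> borel_measurable borel"
    using cg g' by (auto intro: borel_measurable_continuous_onI)
  have i1: "integrable lborel (\<lambda>x. ?n x * (x * g x))"
  proof (rule Bochner_Integration.integrable_bound)
    show "integrable lborel (\<lambda>x. B * (?n x * \<bar>x - 0\<bar>^1))"
      by (intro integrable_mult_right integrable_normal_moment_abs) (use \<sigma> in auto)
    show "AE x in lborel. norm (?n x * (x * g x)) \<le> norm (B * (?n x * \<bar>x - 0\<bar> ^ 1))"
    proof (rule AE_I2)
      fix x
      have "norm (?n x * (x * g x)) = \<bar>g x\<bar> * (?n x * \<bar>x\<bar>)" by (simp add: abs_mult)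
      also have "\<dots> \<le> B * (?n x * \<bar>x\<bar>)" using B(1) by (intro mult_right_mono) auto
      also have "\<dots> \<le> norm (B * (?n x * \<bar>x - 0\<bar> ^ 1))" by simp
      finally show "norm (?n x * (x * g x)) \<le> norm (B * (?n x * \<bar>x - 0\<bar> ^ 1))" .
    qed
  qed measurable
  have i2: "integrable lborel (\<lambda>x. ?n x * g' x)"
  proof (rule Bochner_Integration.integrable_bound)
    show "integrable lborel (\<lambda>x. B' * ?n x)"
      using \<sigma> by (intro integrable_mult_right integrable_normal_density) auto
    show "AE x in lborel. norm (?n x * g' x) \<le> norm (B' * ?n x)"
    proof (rule AE_I2)
      fix x
      have "norm (?n x * g' x) = \<bar>g' x\<bar> * ?n x" by (simp add: abs_mult)
      also have "\<dots> \<le> B' * ?n x" using B(2) by (intro mult_right_mono) auto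
      also have "\<dots> \<le> norm (B' * ?n x)" by simp
      finally show "norm (?n x * g' x) \<le> norm (B' * ?n x)" .
    qed
  qed measurable
  \<comment> \<open>The derivative of the density times \<open>g\<close>; its integral over the line
    is the difference of two limits, both 0.\<close>
  let ?f = "\<lambda>x. ?n x * g' x - (1 / \<sigma>\<^sup>2) * (?n x * (x * g x))"
  have int: "integrable lborel ?f" using i1 i2 by (intro Bochner_Integration.integrable_diff integrable_mult_right)
  have bound: "\<bar>?n x * g x\<bar> \<le> ?n x * B" for x
    unfolding abs_mult using B(1)[of x] by (intro mult_mono) auto
  have lim: "((\<lambda>x. ?n x * g x) \<longlongrightarrow> 0) F" if "(?n \<longlongrightarrow> 0) F" for F
  proof (rule Lim_null_comparison)
    show "((\<lambda>x. ?n x * B) \<longlongrightarrow> 0) F" using tendsto_mult[OF that tendsto_const, of B] by simp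
    show "\<forall>\<^sub>F x in F. norm (?n x * g x) \<le> ?n x * B" using bound by (intro always_eventually) simp
  qed
  have "(LBINT x=-\<infinity>..\<infinity>. ?f x) = 0 - 0"
  proof (rule interval_integral_FTC_integrable)
    fix x
    have "((\<lambda>x. ?n x * g x) has_real_derivative ?f x) (at x)"
      by (rule DERIV_cong[OF DERIV_mult[OF normal_density_deriv[OF \<sigma>] g]]) (simp add: field_simps)
    then show "((\<lambda>x. ?n x * g x) has_vector_derivative ?f x) (at x)"
      by (simp add: has_real_derivative_iff_has_vector_derivative)
    have "isCont ?n x" using normal_density_deriv[OF \<sigma>] by (rule DERIV_isCont)
    moreover have "isCont g x" using g by (rule DERIV_isCont)
    moreover have "isCont g' x" using g' by (simp add: continuous_on_eq_continuous_at)
    ultimately show "isCont ?f x" by (intro continuous_intros)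
  next
    show "set_integrable lborel (einterval (- \<infinity>) \<infinity>) ?f"
      using int by (simp add: set_integrable_def)
    show "(((\<lambda>x. ?n x * g x) \<circ> real_of_ereal) \<longlongrightarrow> 0) (at_right (- \<infinity>))"
      unfolding ereal_tendsto_simps by (rule lim[OF normal_density_tendsto_0(2)[OF \<sigma>]])
    show "(((\<lambda>x. ?n x * g x) \<circ> real_of_ereal) \<longlongrightarrow> 0) (at_left \<infinity>)"
      unfolding ereal_tendsto_simps by (rule lim[OF normal_density_tendsto_0(1)[OF \<sigma>]])
  qed simp
  then have "(\<integral>x. ?f x \<partial>lborel) = 0"
    by (simp add: interval_lebesgue_integral_def set_lebesgue_integral_def)
  then have "(\<integral>x. ?n x * g' x \<partial>lborel) = (1 / \<sigma>\<^sup>2) * (\<integral>x. ?n x * (x * g x) \<partial>lborel)"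
    using i1 i2 by simp
  then show ?thesis using \<sigma> by simp
qed

lemma (in prob_space) stein_normal:
  assumes Z: "distributed M lborel Z (normal_density 0 \<sigma>)" and \<sigma>: "\<sigma> > 0"
    and g: "\<And>x. (g has_real_derivative g' x) (at x)"
    and g': "continuous_on UNIV g'" and B: "\<And>x. \<bar>g x\<bar> \<le> B" "\<And>x. \<bar>g' x\<bar> \<le> B'"
  shows "(\<integral>\<omega>. Z \<omega> * g (Z \<omega>) \<partial>M) = \<sigma>\<^sup>2 * (\<integral>\<omega>. g' (Z \<omega>) \<partial>M)"
proof -
  have cg: "continuous_on UNIV g"
    by (rule DERIV_continuous_on) (use g in \<open>auto intro: has_field_derivative_at_within\<close>)
  have mg[measurable]: "g \<in> borel_measurable borel" "g' \<in> borel_measurable borel"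
    using cg g' by (auto intro: borel_measurable_continuous_onI)
  have "(\<integral>\<omega>. Z \<omega> * g (Z \<omega>) \<partial>M) = (\<integral>x. normal_density 0 \<sigma> x * (x * g x) \<partial>lborel)"
    by (rule distributed_integral[OF Z, symmetric]) auto
  also have "\<dots> = \<sigma>\<^sup>2 * (\<integral>x. normal_density 0 \<sigma> x * g' x \<partial>lborel)"
    by (rule stein_normal_density[OF \<sigma> g g' B])
  also have "(\<integral>x. normal_density 0 \<sigma> x * g' x \<partial>lborel) = (\<integral>\<omega>. g' (Z \<omega>) \<partial>M)"
    by (rule distributed_integral[OF Z]) auto
  finally show ?thesis .
qed

text \<open>Replaces conditioning on \<open>Y\<close>: the joint law is a product, so by Fubini the
  sign may be checked with \<open>Y\<close> held at a constant \<open>y\<close>.\<close>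

lemma (in prob_space) indep_var_integral_nonneg:
  fixes h :: "'b \<times> 'b \<Rightarrow> real"
  assumes ind: "indep_var S X T Y" and h[measurable]: "h \<in> borel_measurable (S \<Otimes>\<^sub>M T)"
    and int: "integrable M (\<lambda>\<omega>. h (X \<omega>, Y \<omega>))"
    and nn: "\<And>y. y \<in> space T \<Longrightarrow> 0 \<le> (\<integral>\<omega>. h (X \<omega>, y) \<partial>M)"
  shows "0 \<le> (\<integral>\<omega>. h (X \<omega>, Y \<omega>) \<partial>M)"
proof -
  have rv[measurable]: "X \<in> measurable M S" "Y \<in> measurable M T"
    using ind by (auto dest: indep_var_rv1 indep_var_rv2)
  interpret X: prob_space "distr M S X" by (rule prob_space_distr) fact
  interpret Y: prob_space "distr M T Y" by (rule prob_space_distr) fact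
  interpret XY: pair_sigma_finite "distr M S X" "distr M T Y" ..
  have eq: "distr M S X \<Otimes>\<^sub>M distr M T Y = distr M (S \<Otimes>\<^sub>M T) (\<lambda>\<omega>. (X \<omega>, Y \<omega>))"
    using ind by (simp add: indep_var_distribution_eq)
  have i: "integrable (distr M S X \<Otimes>\<^sub>M distr M T Y) (case_prod (\<lambda>x y. h (x, y)))"
    unfolding eq using int by (subst integrable_distr_eq) auto
  have "(\<integral>\<omega>. h (X \<omega>, Y \<omega>) \<partial>M) = integral\<^sup>L (distr M S X \<Otimes>\<^sub>M distr M T Y) (case_prod (\<lambda>x y. h (x, y)))"
    unfolding eq by (subst integral_distr) auto
  also have "\<dots> = (\<integral>y. (\<integral>x. h (x, y) \<partial>distr M S X) \<partial>distr M T Y)"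
    by (rule XY.integral_snd[OF i, symmetric])
  also have "\<dots> \<ge> 0"
  proof (rule integral_nonneg_AE, rule AE_I2)
    fix y assume "y \<in> space (distr M T Y)"
    then have y: "y \<in> space T" by simp
    then have "(\<lambda>x. h (x, y)) \<in> borel_measurable S" by measurable
    then have "(\<integral>x. h (x, y) \<partial>distr M S X) = (\<integral>\<omega>. h (X \<omega>, y) \<partial>M)"
      by (subst integral_distr) auto
    with nn[OF y] show "0 \<le> (\<integral>x. h (x, y) \<partial>distr M S X)" by simp
  qed
  finally show ?thesis .
qed

lemma (in prob_space) indep_var_integral_eq_0:
  fixes h :: "'b \<times> 'b \<Rightarrow> real"
  assumes ind: "indep_var S X T Y" and h: "h \<in> borel_measurable (S \<Otimes>\<^sub>M T)"
    and int: "integrable M (\<lambda>\<omega>. h (X \<omega>, Y \<omega>))"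
    and nn: "\<And>y. y \<in> space T \<Longrightarrow> (\<integral>\<omega>. h (X \<omega>, y) \<partial>M) = 0"
  shows "(\<integral>\<omega>. h (X \<omega>, Y \<omega>) \<partial>M) = 0"
proof (rule antisym)
  show "0 \<le> (\<integral>\<omega>. h (X \<omega>, Y \<omega>) \<partial>M)"
    by (rule indep_var_integral_nonneg[OF ind h int]) (simp add: nn)
  have "0 \<le> (\<integral>\<omega>. - h (X \<omega>, Y \<omega>) \<partial>M)"
    by (rule indep_var_integral_nonneg[OF ind, of "\<lambda>z. - h z"]) (use h int nn in auto)
  then show "(\<integral>\<omega>. h (X \<omega>, Y \<omega>) \<partial>M) \<le> 0" by simp
qed

lemma (in prob_space) sqint_normal:
  assumes D: "distributed M lborel Z (normal_density 0 \<sigma>)" and \<sigma>: "\<sigma> > 0"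
  shows "sqint M Z"
proof -
  have "integrable lborel (\<lambda>x. normal_density 0 \<sigma> x * (x - 0)\<^sup>2)"
    by (rule integrable_normal_moment[OF \<sigma>])
  then have "integrable M (\<lambda>\<omega>. (Z \<omega>)\<^sup>2)"
    using distributed_integrable[OF D, of "\<lambda>x. x\<^sup>2"] by simp
  with distributed_measurable[OF D] show ?thesis by (simp add: sqint_def)
qed

section \<open>Moments and covariance of Brownian motion\<close>

context prob_space
begin

context
  fixes w :: "real \<Rightarrow> 'a \<Rightarrow> real"
  assumes bm: "standard_brownian_motion M w"
begin

lemma bm_measurable: "0 \<le> t \<Longrightarrow> w t \<in> borel_measurable M"
  using bm by (simp add: standard_brownian_motion_def)

lemma bm_zero: "\<omega> \<in> space M \<Longrightarrow> w 0 \<omega> = 0"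
  using bm by (simp add: standard_brownian_motion_def)

lemma bm_increment:
  "0 \<le> s \<Longrightarrow> s < t \<Longrightarrow> distributed M lborel (\<lambda>\<omega>. w t \<omega> - w s \<omega>) (normal_density 0 (sqrt (t - s)))"
  using bm by (simp add: standard_brownian_motion_def)

lemma bm_indep: "0 \<le> \<tau> 0 \<Longrightarrow> incseq \<tau> \<Longrightarrow>
    indep_vars (\<lambda>_. borel) (\<lambda>i \<omega>. w (\<tau> (Suc i)) \<omega> - w (\<tau> i) \<omega>) {..<m::nat}"
  using bm unfolding standard_brownian_motion_def by (elim conjE allE[where x = \<tau>] allE[where x = m] mp) simp

lemma bm_increment_moments:
  assumes "0 \<le> s" "s \<le> t"
  shows "sqint M (\<lambda>\<omega>. w t \<omega> - w s \<omega>)" "(\<integral>\<omega>. w t \<omega> - w s \<omega> \<partial>M) = 0"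
    "(\<integral>\<omega>. (w t \<omega> - w s \<omega>)\<^sup>2 \<partial>M) = t - s"
proof -
  have "sqint M (\<lambda>\<omega>. w t \<omega> - w s \<omega>) \<and> (\<integral>\<omega>. w t \<omega> - w s \<omega> \<partial>M) = 0 \<and> (\<integral>\<omega>. (w t \<omega> - w s \<omega>)\<^sup>2 \<partial>M) = t - s"
  proof (cases "s = t")
    case True
    then show ?thesis by (simp add: sqint_zero)
  next
    case False
    with assms have st: "s < t" by simp
    note D = bm_increment[OF assms(1) st]
    have pos: "0 < sqrt (t - s)" using st by simp
    have "sqint M (\<lambda>\<omega>. w t \<omega> - w s \<omega>)" by (rule sqint_normal[OF D pos])
    moreover have "(\<integral>\<omega>. w t \<omega> - w s \<omega> \<partial>M) = 0"
      by (rule normal_distributed_expectation[OF pos D])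
    moreover have "(\<integral>\<omega>. (w t \<omega> - w s \<omega>)\<^sup>2 \<partial>M) = t - s"
      using normal_distributed_variance[OF pos D] normal_distributed_expectation[OF pos D] st by simp
    ultimately show ?thesis by simp
  qed
  then show "sqint M (\<lambda>\<omega>. w t \<omega> - w s \<omega>)" "(\<integral>\<omega>. w t \<omega> - w s \<omega> \<partial>M) = 0"
    "(\<integral>\<omega>. (w t \<omega> - w s \<omega>)\<^sup>2 \<partial>M) = t - s" by blast+
qed

lemma bm_moments:
  assumes "0 \<le> t" shows "sqint M (w t)" "(\<integral>\<omega>. w t \<omega> \<partial>M) = 0" "(\<integral>\<omega>. (w t \<omega>)\<^sup>2 \<partial>M) = t"
proof -
  note m = bm_increment_moments[of 0 t]
  have "integrable M (\<lambda>\<omega>. (w t \<omega>)\<^sup>2) \<longleftrightarrow> integrable M (\<lambda>\<omega>. (w t \<omega> - w 0 \<omega>)\<^sup>2)"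
    by (rule Bochner_Integration.integrable_cong) (auto simp: bm_zero)
  with m(1) assms bm_measurable show "sqint M (w t)" by (simp add: sqint_def)
  have "(\<integral>\<omega>. w t \<omega> \<partial>M) = (\<integral>\<omega>. w t \<omega> - w 0 \<omega> \<partial>M)" "(\<integral>\<omega>. (w t \<omega>)\<^sup>2 \<partial>M) = (\<integral>\<omega>. (w t \<omega> - w 0 \<omega>)\<^sup>2 \<partial>M)"
    by (auto intro!: Bochner_Integration.integral_cong simp: bm_zero)
  with m assms show "(\<integral>\<omega>. w t \<omega> \<partial>M) = 0" "(\<integral>\<omega>. (w t \<omega>)\<^sup>2 \<partial>M) = t" by auto
qed

lemma bm_cov_le:
  assumes "0 \<le> s" "s \<le> t" shows "(\<integral>\<omega>. w s \<omega> * w t \<omega> \<partial>M) = s"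
proof -
  \<comment> \<open>Independence of increments is stated for an infinite increasing sequence of
    times. This one stays at \<open>t\<close> from index 2 on; its first two increments are those
    from 0 to \<open>s\<close> and from \<open>s\<close> to \<open>t\<close>.\<close>
  define \<tau> where "\<tau> i = (if i = 0 then 0 else if i = 1 then s else t)" for i :: nat
  have "incseq \<tau>" by (rule incseq_SucI) (use assms in \<open>auto simp: \<tau>_def\<close>)
  then have "indep_vars (\<lambda>_. borel) (\<lambda>i \<omega>. w (\<tau> (Suc i)) \<omega> - w (\<tau> i) \<omega>) {..<2::nat}"
    by (intro bm_indep) (simp add: \<tau>_def, assumption)
  from indep_vars_imp_indep_var[OF this, of 0 1]
  have ind: "indep_var borel (\<lambda>\<omega>. w s \<omega> - w 0 \<omega>) borel (\<lambda>\<omega>. w t \<omega> - w s \<omega>)"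
    by (simp add: \<tau>_def)
  have "integrable M (\<lambda>\<omega>. w s \<omega> - w 0 \<omega>)" "integrable M (\<lambda>\<omega>. w t \<omega> - w s \<omega>)"
    using assms by (auto intro!: sqint_integrable finite_measure_axioms bm_increment_moments)
  from indep_var_lebesgue_integral[OF ind this]
  have "(\<integral>\<omega>. (w s \<omega> - w 0 \<omega>) * (w t \<omega> - w s \<omega>) \<partial>M) = 0"
    using assms by (simp add: bm_increment_moments)
  moreover have "(\<integral>\<omega>. w s \<omega> * w t \<omega> \<partial>M) = (\<integral>\<omega>. (w s \<omega> - w 0 \<omega>) * (w t \<omega> - w s \<omega>) + (w s \<omega>)\<^sup>2 \<partial>M)"
    by (intro Bochner_Integration.integral_cong) (auto simp: bm_zero power2_eq_square algebra_simps)
  moreover have "\<dots> = (\<integral>\<omega>. (w s \<omega> - w 0 \<omega>) * (w t \<omega> - w s \<omega>) \<partial>M) + (\<integral>\<omega>. (w s \<omega>)\<^sup>2 \<partial>M)"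
    using assms by (intro Bochner_Integration.integral_add sqint_mult bm_increment_moments sqint_square bm_moments) auto
  ultimately show ?thesis using bm_moments(3)[OF assms(1)] by simp
qed

lemma bm_cov:
  assumes "0 \<le> s" "0 \<le> t" shows "(\<integral>\<omega>. w s \<omega> * w t \<omega> \<partial>M) = min s t"
  using bm_cov_le[of s t] bm_cov_le[of t s] assms by (cases "s \<le> t") (auto simp: mult.commute)

end

end

section \<open>Stein's identity for Gaussian vectors\<close>

text \<open>The derivative at \<open>x\<close>, in direction \<open>a\<close>, of the
  \<open>j\<close>-th coordinate of \<open>x\<close> divided by its smoothed norm.\<close>

definition quotient_deriv :: "real \<Rightarrow> 'i set \<Rightarrow> ('i \<Rightarrow> real) \<Rightarrow> 'i \<Rightarrow> ('i \<Rightarrow> real) \<Rightarrow> real" where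
  "quotient_deriv \<epsilon> J x j a =
     a j / smooth_norm \<epsilon> J x - x j * (\<Sum>l\<in>J. x l * a l) / (smooth_norm \<epsilon> J x)^3"

lemma borel_measurable_quotient_deriv:
  assumes "\<And>l. l \<in> J \<Longrightarrow> (\<lambda>\<omega>. X l \<omega>) \<in> borel_measurable N" "j \<in> J"
  shows "(\<lambda>\<omega>. quotient_deriv \<epsilon> J (\<lambda>l. X l \<omega>) j a) \<in> borel_measurable N"
  unfolding quotient_deriv_def
  by (intro borel_measurable_diff borel_measurable_divide borel_measurable_times borel_measurable_sum
      borel_measurable_power borel_measurable_const borel_measurable_smooth_norm assms)

lemma integrable_quotient_deriv:
  assumes "\<epsilon> > 0" "finite J" "j \<in> J" "finite_measure M" "\<And>l. l \<in> J \<Longrightarrow> (\<lambda>\<omega>. X l \<omega>) \<in> borel_measurable M"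
  shows "integrable M (\<lambda>\<omega>. quotient_deriv \<epsilon> J (\<lambda>l. X l \<omega>) j a)"
proof (rule finite_measure.integrable_const_bound[OF assms(4), of _ "2 / \<epsilon> * (\<Sum>l\<in>J. \<bar>a l\<bar>)"])
  show "AE \<omega> in M. norm (quotient_deriv \<epsilon> J (\<lambda>l. X l \<omega>) j a) \<le> 2 / \<epsilon> * (\<Sum>l\<in>J. \<bar>a l\<bar>)"
    unfolding quotient_deriv_def real_norm_def by (intro AE_I2 smooth_quotient_deriv_bounded[OF assms(1-3)])
qed (rule borel_measurable_quotient_deriv[OF assms(5,3)])

text \<open>The right hand side is the trace of \<open>C\<close> times the Jacobian of the smoothed
  quotient, where \<open>C\<close> is \<open>v\<close> times the Gram matrix of the rows of
  \<open>a\<close>. With \<open>v\<close> the variance of the increments, \<open>C\<close> is the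
  covariance matrix of the Gaussian vector.\<close>

lemma quotient_deriv_sum:
  assumes "finite J"
  shows "(\<Sum>j\<in>J. \<Sum>i\<in>I. a j i * (v * quotient_deriv \<epsilon> J x j (\<lambda>l. a l i))) =
    (\<Sum>j\<in>J. v * (\<Sum>i\<in>I. a j i * a j i)) / smooth_norm \<epsilon> J x -
    (\<Sum>j\<in>J. \<Sum>l\<in>J. v * (\<Sum>i\<in>I. a j i * a l i) * (x j * x l)) / (smooth_norm \<epsilon> J x)^3"
proof -
  let ?r = "smooth_norm \<epsilon> J x"
  have "(\<Sum>i\<in>I. a j i * (v * quotient_deriv \<epsilon> J x j (\<lambda>l. a l i))) =
     v * (\<Sum>i\<in>I. a j i * a j i) / ?r - (\<Sum>l\<in>J. v * (\<Sum>i\<in>I. a j i * a l i) * (x j * x l)) / ?r^3" for j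
  proof -
    have "(\<Sum>i\<in>I. a j i * (v * quotient_deriv \<epsilon> J x j (\<lambda>l. a l i))) =
       (\<Sum>i\<in>I. v * (a j i * a j i) / ?r - (\<Sum>l\<in>J. v * (a j i * a l i) * (x j * x l)) / ?r^3)"
      by (intro sum.cong refl)
         (simp add: quotient_deriv_def right_diff_distrib sum_distrib_left sum_divide_distrib mult_ac)
    also have "\<dots> = v * (\<Sum>i\<in>I. a j i * a j i) / ?r - (\<Sum>i\<in>I. \<Sum>l\<in>J. v * (a j i * a l i) * (x j * x l)) / ?r^3"
      by (simp add: sum_subtractf sum_distrib_left sum_divide_distrib)
    also have "(\<Sum>i\<in>I. \<Sum>l\<in>J. v * (a j i * a l i) * (x j * x l)) = (\<Sum>l\<in>J. v * (\<Sum>i\<in>I. a j i * a l i) * (x j * x l))"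
      by (subst sum.swap) (simp add: sum_distrib_left sum_distrib_right)
    finally show ?thesis .
  qed
  then show ?thesis by (simp add: sum_subtractf sum_divide_distrib)
qed

text \<open>If \<open>C\<close> is \<kappa> times the identity, the right hand side is \<kappa>
  times the divergence of the smoothed quotient, which is at least \<open>(card J - 1) / r\<close>.
  The deviation of \<open>C\<close> from this matrix enters each of the two terms with at most
  \<open>S / \<epsilon>\<close>. Such a deviation must be allowed, since \<open>C\<close> will come
  from step functions, which are orthogonal only in the limit.\<close>

lemma quotient_deriv_sum_lower:
  fixes C :: "'i \<Rightarrow> 'i \<Rightarrow> real"
  assumes eps: "\<epsilon> > 0" and J: "finite J" and \<kappa>: "0 \<le> \<kappa>"
  shows "\<kappa> * (real (card J) - 1) / smooth_norm \<epsilon> J x -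
      2 / \<epsilon> * (\<Sum>j\<in>J. \<Sum>l\<in>J. \<bar>C j l - (if j = l then \<kappa> else 0)\<bar>) \<le>
    (\<Sum>j\<in>J. C j j) / smooth_norm \<epsilon> J x - (\<Sum>j\<in>J. \<Sum>l\<in>J. C j l * (x j * x l)) / (smooth_norm \<epsilon> J x)^3"
proof -
  define r where "r = smooth_norm \<epsilon> J x"
  define e where "e j l = C j l - (if j = l then \<kappa> else 0)" for j l
  define S where "S = (\<Sum>j\<in>J. \<Sum>l\<in>J. \<bar>e j l\<bar>)"
  have r: "0 < r" "\<epsilon> \<le> r" using smooth_norm_pos[OF eps J] smooth_norm_ge[OF eps J] by (auto simp: r_def)
  have C: "C j l = (if j = l then \<kappa> else 0) + e j l" for j l by (simp add: e_def)
  have S0: "0 \<le> S" by (simp add: S_def sum_nonneg)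
  have 1: "- (S / \<epsilon>) \<le> (\<Sum>j\<in>J. e j j) / r"
  proof -
    have "\<bar>\<Sum>j\<in>J. e j j\<bar> \<le> (\<Sum>j\<in>J. \<bar>e j j\<bar>)" by (rule sum_abs)
    also have "\<dots> \<le> S" unfolding S_def
      by (intro sum_mono) (use J in \<open>auto intro!: member_le_sum[where f = "\<lambda>l. \<bar>e _ l\<bar>"]\<close>)
    finally have "\<bar>(\<Sum>j\<in>J. e j j) / r\<bar> \<le> S / \<epsilon>"
      using r eps S0 by (simp add: frac_le)
    then show ?thesis by linarith
  qed
  have 2: "(\<Sum>j\<in>J. \<Sum>l\<in>J. e j l * (x j * x l)) / r^3 \<le> S / \<epsilon>"
  proof -
    have "(\<Sum>j\<in>J. \<Sum>l\<in>J. e j l * (x j * x l)) / r^3 = (\<Sum>j\<in>J. \<Sum>l\<in>J. e j l * ((x j / r) * (x l / r))) / r"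
      by (simp add: sum_divide_distrib power3_eq_cube)
    also have "(\<Sum>j\<in>J. \<Sum>l\<in>J. e j l * ((x j / r) * (x l / r))) \<le> S"
      unfolding S_def
    proof (intro sum_mono)
      fix j l assume "j \<in> J" "l \<in> J"
      then have "\<bar>(x j / r) * (x l / r)\<bar> \<le> 1 * 1"
        unfolding abs_mult r_def by (intro mult_mono smooth_quotient_bounded[OF eps J]) auto
      then have "\<bar>e j l\<bar> * \<bar>(x j / r) * (x l / r)\<bar> \<le> \<bar>e j l\<bar> * 1" by (intro mult_left_mono) auto
      then show "e j l * ((x j / r) * (x l / r)) \<le> \<bar>e j l\<bar>" unfolding abs_mult[symmetric] by linarith
    qed
    then have "(\<Sum>j\<in>J. \<Sum>l\<in>J. e j l * ((x j / r) * (x l / r))) / r \<le> S / r" using r by (simp add: divide_right_mono)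
    also have "S / r \<le> S / \<epsilon>" using r eps S0 by (simp add: frac_le)
    finally show ?thesis .
  qed
  have 3: "(\<Sum>j\<in>J. C j j) = \<kappa> * real (card J) + (\<Sum>j\<in>J. e j j)"
    by (simp add: C sum.distrib)
  have "(\<Sum>l\<in>J. C j l * (x j * x l)) = \<kappa> * (x j)\<^sup>2 + (\<Sum>l\<in>J. e j l * (x j * x l))" if "j \<in> J" for j
  proof -
    have "(\<Sum>l\<in>J. C j l * (x j * x l)) = (\<Sum>l\<in>J. (if j = l then \<kappa> * (x j)\<^sup>2 else 0) + e j l * (x j * x l))"
      by (intro sum.cong) (auto simp: C power2_eq_square distrib_right)
    then show ?thesis using that J by (simp add: sum.distrib)
  qed
  then have 4: "(\<Sum>j\<in>J. \<Sum>l\<in>J. C j l * (x j * x l)) = \<kappa> * (r\<^sup>2 - \<epsilon>\<^sup>2) + (\<Sum>j\<in>J. \<Sum>l\<in>J. e j l * (x j * x l))"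
    by (simp add: sum.distrib sum_distrib_left[symmetric] r_def smooth_norm_sq[OF eps J])
  have 5: "\<kappa> * (r\<^sup>2 - \<epsilon>\<^sup>2) / r^3 \<le> \<kappa> / r"
  proof -
    have "\<kappa> * (r\<^sup>2 - \<epsilon>\<^sup>2) / r^3 \<le> \<kappa> * r\<^sup>2 / r^3"
      using r \<kappa> by (intro divide_right_mono mult_left_mono) auto
    also have "\<dots> = \<kappa> / r" using r by (simp add: power2_eq_square power3_eq_cube)
    finally show ?thesis .
  qed
  have "\<kappa> * (real (card J) - 1) / r - 2 / \<epsilon> * S = \<kappa> * real (card J) / r - \<kappa> / r - S / \<epsilon> - S / \<epsilon>"
    by (simp add: right_diff_distrib diff_divide_distrib)
  also have "\<dots> \<le> (\<Sum>j\<in>J. C j j) / r - (\<Sum>j\<in>J. \<Sum>l\<in>J. C j l * (x j * x l)) / r^3"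
    unfolding 3 4 using 1 2 5 by (simp add: add_divide_distrib)
  finally show ?thesis by (simp add: r_def S_def e_def)
qed

lemma integral_double_sum:
  fixes c :: "'i \<Rightarrow> 'k \<Rightarrow> real"
  assumes "\<And>j i. j \<in> J \<Longrightarrow> i \<in> I \<Longrightarrow> integrable M (f j i)"
  shows "(\<integral>\<omega>. (\<Sum>j\<in>J. \<Sum>i\<in>I. c j i * f j i \<omega>) \<partial>M) = (\<Sum>j\<in>J. \<Sum>i\<in>I. c j i * (\<integral>\<omega>. f j i \<omega> \<partial>M))"
proof -
  have "(\<integral>\<omega>. (\<Sum>i\<in>I. c j i * f j i \<omega>) \<partial>M) = (\<Sum>i\<in>I. c j i * (\<integral>\<omega>. f j i \<omega> \<partial>M))" if "j \<in> J" for j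
    using assms that by (subst Bochner_Integration.integral_sum) (auto intro!: integrable_mult_right)
  then show ?thesis
    using assms by (subst Bochner_Integration.integral_sum)
      (auto intro!: Bochner_Integration.integrable_sum integrable_mult_right sum.cong)
qed

context prob_space
begin

text \<open>With all increments but \<open>\<zeta> i\<close> held fixed, the vector moves along a
  line, and the one-dimensional identity applies. The identity is stated as one vanishing integral,
  so that it can be integrated over the variables held fixed.\<close>

lemma stein_gaussian_const:
  fixes \<zeta> :: "nat \<Rightarrow> 'a \<Rightarrow> real" and a :: "nat \<Rightarrow> nat \<Rightarrow> real" and u :: "nat \<Rightarrow> real"
  assumes eps: "\<epsilon> > 0" and J: "finite J" and j: "j \<in> J" and \<sigma>: "\<sigma> > 0"
    and ind: "indep_vars (\<lambda>_. borel) \<zeta> {..<m}"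
    and D: "\<And>i. i < m \<Longrightarrow> distributed M lborel (\<zeta> i) (normal_density 0 \<sigma>)"
    and i: "i < m"
  defines "X \<equiv> \<lambda>\<omega> l. (\<Sum>i<m. a l i * \<zeta> i \<omega>) + u l"
  shows "(\<integral>\<omega>. \<zeta> i \<omega> * (X \<omega> j / smooth_norm \<epsilon> J (X \<omega>)) - \<sigma>\<^sup>2 * quotient_deriv \<epsilon> J (X \<omega>) j (\<lambda>l. a l i) \<partial>M) = 0"
proof -
  let ?I = "{..<m} - {i}"
  have m\<zeta>[measurable]: "\<zeta> k \<in> borel_measurable M" if "k < m" for k
    using ind that by (auto simp: indep_vars_def)
  define b where "b y l = (\<Sum>k\<in>?I. a l k * y k) + u l" for y l
  define x where "x y t = (\<lambda>l. b y l + a l i * t)" for y t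
  define h where "h = (\<lambda>(z, y). z i * (x y (z i) j / smooth_norm \<epsilon> J (x y (z i)))
     - \<sigma>\<^sup>2 * quotient_deriv \<epsilon> J (x y (z i)) j (\<lambda>l. a l i))"
  have bb: "\<bar>x y t j / smooth_norm \<epsilon> J (x y t)\<bar> \<le> 1" for y t
    by (rule smooth_quotient_bounded[OF eps J j])
  have bd: "\<bar>quotient_deriv \<epsilon> J x' j (\<lambda>l. a l i)\<bar> \<le> 2 / \<epsilon> * (\<Sum>l\<in>J. \<bar>a l i\<bar>)" for x'
    unfolding quotient_deriv_def by (rule smooth_quotient_deriv_bounded[OF eps J j])
  have dx: "((\<lambda>t. x y t j / smooth_norm \<epsilon> J (x y t)) has_real_derivative quotient_deriv \<epsilon> J (x y t) j (\<lambda>l. a l i)) (at t)" for y t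
    unfolding x_def quotient_deriv_def by (rule smooth_quotient_deriv[OF eps J])
  have cont: "continuous_on UNIV (\<lambda>t. quotient_deriv \<epsilon> J (x y t) j (\<lambda>l. a l i))" for y
  proof -
    have "smooth_norm \<epsilon> J (x y t) \<noteq> 0" for t using smooth_norm_pos[OF eps J, of "x y t"] by simp
    moreover have "continuous_on UNIV (\<lambda>t. smooth_norm \<epsilon> J (x y t))"
      unfolding smooth_norm_def x_def by (intro continuous_intros)
    moreover have "continuous_on UNIV (\<lambda>t. x y t l)" for l unfolding x_def by (intro continuous_intros)
    ultimately show ?thesis unfolding quotient_deriv_def by (intro continuous_intros) auto
  qed
  \<comment> \<open>Separates \<open>\<zeta> i\<close> from the other increments, which enter
    through \<open>b\<close> only.\<close>
  have X: "X \<omega> = x (restrict (\<lambda>k. \<zeta> k \<omega>) ?I) (\<zeta> i \<omega>)" for \<omega>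
    using i by (auto simp: X_def x_def b_def fun_eq_iff sum.remove[of "{..<m}" i])
  let ?S = "Pi\<^sub>M {i} (\<lambda>_. borel :: real measure)" and ?T = "Pi\<^sub>M ?I (\<lambda>_. borel :: real measure)"
  \<comment> \<open>\<open>indep_var\<close> wants both variables to have the same type, hence the product space with one factor.\<close>
  have ind2: "indep_var ?S (\<lambda>\<omega>. restrict (\<lambda>k. \<zeta> k \<omega>) {i}) ?T (\<lambda>\<omega>. restrict (\<lambda>k. \<zeta> k \<omega>) ?I)"
    by (rule indep_var_restrict[OF ind]) (use i in auto)
  have mz: "(\<lambda>p. fst p i) \<in> borel_measurable (?S \<Otimes>\<^sub>M ?T)" and my: "k \<in> ?I \<Longrightarrow> (\<lambda>p. snd p k) \<in> borel_measurable (?S \<Otimes>\<^sub>M ?T)" for k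
    by (rule measurable_compose[OF measurable_fst measurable_component_singleton], simp)
       (rule measurable_compose[OF measurable_snd measurable_component_singleton], simp)
  have mx: "(\<lambda>p. x (snd p) (fst p i) l) \<in> borel_measurable (?S \<Otimes>\<^sub>M ?T)" for l
    unfolding x_def b_def
    by (intro borel_measurable_add borel_measurable_times borel_measurable_sum borel_measurable_const mz my)
  have mh: "h \<in> borel_measurable (?S \<Otimes>\<^sub>M ?T)"
    unfolding h_def case_prod_beta
    by (intro borel_measurable_diff borel_measurable_times borel_measurable_divide borel_measurable_const
        borel_measurable_smooth_norm borel_measurable_quotient_deriv mx mz j)
  have h: "\<zeta> i \<omega> * (X \<omega> j / smooth_norm \<epsilon> J (X \<omega>)) - \<sigma>\<^sup>2 * quotient_deriv \<epsilon> J (X \<omega>) j (\<lambda>l. a l i)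
     = h (restrict (\<lambda>k. \<zeta> k \<omega>) {i}, restrict (\<lambda>k. \<zeta> k \<omega>) ?I)" for \<omega>
    by (simp add: h_def X)
  note s\<zeta> = sqint_normal[OF D[OF i] \<sigma>]
  have my: "(\<lambda>\<omega>. x y (\<zeta> i \<omega>) l) \<in> borel_measurable M" for y l
    unfolding x_def by (intro borel_measurable_add borel_measurable_times borel_measurable_const m\<zeta>[OF i])
  have mX: "(\<lambda>\<omega>. X \<omega> l) \<in> borel_measurable M" for l
    unfolding X_def by (intro borel_measurable_add borel_measurable_sum borel_measurable_times borel_measurable_const m\<zeta>) simp
  have int1: "integrable M (\<lambda>\<omega>. \<zeta> i \<omega> * (x y (\<zeta> i \<omega>) j / smooth_norm \<epsilon> J (x y (\<zeta> i \<omega>))))"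
    and int2: "integrable M (\<lambda>\<omega>. quotient_deriv \<epsilon> J (x y (\<zeta> i \<omega>)) j b)" for y b
    by (rule sqint_mult[OF s\<zeta> sqint_smooth_quotient[OF eps J j finite_measure_axioms my]]
        integrable_quotient_deriv[OF eps J j finite_measure_axioms my])+
  note int3 = sqint_mult[OF s\<zeta> sqint_smooth_quotient[OF eps J j finite_measure_axioms mX]]
  note int4 = integrable_quotient_deriv[OF eps J j finite_measure_axioms mX]
  show ?thesis
    unfolding h
  proof (rule indep_var_integral_eq_0[OF ind2 mh])
    show "integrable M (\<lambda>\<omega>. h (\<lambda>k\<in>{i}. \<zeta> k \<omega>, \<lambda>k\<in>?I. \<zeta> k \<omega>))"
      unfolding h[symmetric] by (intro Bochner_Integration.integrable_diff integrable_mult_right int3 int4)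
    fix y assume "y \<in> space ?T"
    have "(\<integral>\<omega>. h (\<lambda>k\<in>{i}. \<zeta> k \<omega>, y) \<partial>M) =
       (\<integral>\<omega>. \<zeta> i \<omega> * (x y (\<zeta> i \<omega>) j / smooth_norm \<epsilon> J (x y (\<zeta> i \<omega>))) \<partial>M)
       - \<sigma>\<^sup>2 * (\<integral>\<omega>. quotient_deriv \<epsilon> J (x y (\<zeta> i \<omega>)) j (\<lambda>l. a l i) \<partial>M)"
      using int1[of y] int2[of y "\<lambda>l. a l i"] by (simp add: h_def)
    also have "\<dots> = 0"
      using stein_normal[OF D[OF i] \<sigma> dx cont bb bd, of y] by simp
    finally show "(\<integral>\<omega>. h (\<lambda>k\<in>{i}. \<zeta> k \<omega>, y) \<partial>M) = 0" .
  qed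
qed

text \<open>An independent \<open>U\<close> may be held fixed, which leaves the case of a constant
  shift. In the application \<open>U\<close> carries the signal and the jumps.\<close>

lemma stein_gaussian:
  fixes \<zeta> :: "nat \<Rightarrow> 'a \<Rightarrow> real" and a :: "nat \<Rightarrow> nat \<Rightarrow> real" and U :: "nat \<Rightarrow> 'a \<Rightarrow> real"
  assumes eps: "\<epsilon> > 0" and J: "finite J" and j: "j \<in> J" and \<sigma>: "\<sigma> > 0"
    and ind: "indep_vars (\<lambda>_. borel) \<zeta> {..<m}"
    and D: "\<And>i. i < m \<Longrightarrow> distributed M lborel (\<zeta> i) (normal_density 0 \<sigma>)"
    and U: "indep_var (Pi\<^sub>M {..<m} (\<lambda>_. borel)) (\<lambda>\<omega>. \<lambda>i\<in>{..<m}. \<zeta> i \<omega>) (Pi\<^sub>M J (\<lambda>_. borel)) (\<lambda>\<omega>. \<lambda>l\<in>J. U l \<omega>)"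
    and i: "i < m"
  defines "X \<equiv> \<lambda>\<omega> l. (\<Sum>i<m. a l i * \<zeta> i \<omega>) + U l \<omega>"
  shows "integrable M (\<lambda>\<omega>. \<zeta> i \<omega> * (X \<omega> j / smooth_norm \<epsilon> J (X \<omega>)))" (is ?A)
    and "integrable M (\<lambda>\<omega>. quotient_deriv \<epsilon> J (X \<omega>) j (\<lambda>l. a l i))" (is ?B)
    and "(\<integral>\<omega>. \<zeta> i \<omega> * (X \<omega> j / smooth_norm \<epsilon> J (X \<omega>)) \<partial>M) =
      \<sigma>\<^sup>2 * (\<integral>\<omega>. quotient_deriv \<epsilon> J (X \<omega>) j (\<lambda>l. a l i) \<partial>M)" (is ?C)
proof -
  let ?S = "Pi\<^sub>M {..<m} (\<lambda>_. borel :: real measure)" and ?T = "Pi\<^sub>M J (\<lambda>_. borel :: real measure)"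
  have m\<zeta>: "\<zeta> k \<in> borel_measurable M" if "k < m" for k
    using ind that by (auto simp: indep_vars_def)
  have mU: "U l \<in> borel_measurable M" if "l \<in> J" for l
    using measurable_compose[OF indep_var_rv2[OF U] measurable_component_singleton[OF that]] that by simp
  define x where "x z y = (\<lambda>l. (\<Sum>k<m. a l k * z k) + y l)" for z y
  define h where "h = (\<lambda>(z, y). z i * (x z y j / smooth_norm \<epsilon> J (x z y))
     - \<sigma>\<^sup>2 * quotient_deriv \<epsilon> J (x z y) j (\<lambda>l. a l i))"
  \<comment> \<open>\<open>restrict\<close> alters vectors outside \<open>J\<close>; neither
    expression reads those coordinates.\<close>
  have cong: "smooth_norm \<epsilon> J f = smooth_norm \<epsilon> J f'" "quotient_deriv \<epsilon> J f j b = quotient_deriv \<epsilon> J f' j b"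
    if "\<And>l. l \<in> J \<Longrightarrow> f l = f' l" for f f' b
    using that j by (auto simp: smooth_norm_def quotient_deriv_def cong: sum.cong)
  have mX: "l \<in> J \<Longrightarrow> (\<lambda>\<omega>. X \<omega> l) \<in> borel_measurable M" for l
    unfolding X_def by (intro borel_measurable_add borel_measurable_sum borel_measurable_times borel_measurable_const m\<zeta> mU) simp_all
  show int3: ?A
    by (rule sqint_mult[OF sqint_normal[OF D[OF i] \<sigma>] sqint_smooth_quotient[OF eps J j finite_measure_axioms mX]])
  show int4: ?B
    by (rule integrable_quotient_deriv[OF eps J j finite_measure_axioms mX])
  have h: "\<zeta> i \<omega> * (X \<omega> j / smooth_norm \<epsilon> J (X \<omega>)) - \<sigma>\<^sup>2 * quotient_deriv \<epsilon> J (X \<omega>) j (\<lambda>l. a l i)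
     = h (\<lambda>i\<in>{..<m}. \<zeta> i \<omega>, \<lambda>l\<in>J. U l \<omega>)" for \<omega>
  proof -
    have "X \<omega> l = x (\<lambda>i\<in>{..<m}. \<zeta> i \<omega>) (\<lambda>l\<in>J. U l \<omega>) l" if "l \<in> J" for l
      using that by (simp add: X_def x_def)
    with j i cong[of "X \<omega>" "x (\<lambda>i\<in>{..<m}. \<zeta> i \<omega>) (\<lambda>l\<in>J. U l \<omega>)"]
    show ?thesis by (simp add: h_def)
  qed
  have mz: "k < m \<Longrightarrow> (\<lambda>p. fst p k) \<in> borel_measurable (?S \<Otimes>\<^sub>M ?T)"
    and my: "l \<in> J \<Longrightarrow> (\<lambda>p. snd p l) \<in> borel_measurable (?S \<Otimes>\<^sub>M ?T)" for k l
    by (rule measurable_compose[OF measurable_fst measurable_component_singleton], simp)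
       (rule measurable_compose[OF measurable_snd measurable_component_singleton], simp)
  have mx: "l \<in> J \<Longrightarrow> (\<lambda>p. x (fst p) (snd p) l) \<in> borel_measurable (?S \<Otimes>\<^sub>M ?T)" for l
    unfolding x_def
    by (intro borel_measurable_add borel_measurable_times borel_measurable_sum borel_measurable_const mz my) simp_all
  have mh: "h \<in> borel_measurable (?S \<Otimes>\<^sub>M ?T)"
    unfolding h_def case_prod_beta
    by (intro borel_measurable_diff borel_measurable_times borel_measurable_divide borel_measurable_const
        borel_measurable_smooth_norm borel_measurable_quotient_deriv mx mz j i)
  have "(\<integral>\<omega>. h (\<lambda>i\<in>{..<m}. \<zeta> i \<omega>, \<lambda>l\<in>J. U l \<omega>) \<partial>M) = 0"
  proof (rule indep_var_integral_eq_0[OF U mh])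
    show "integrable M (\<lambda>\<omega>. h (\<lambda>i\<in>{..<m}. \<zeta> i \<omega>, \<lambda>l\<in>J. U l \<omega>))"
      unfolding h[symmetric] by (intro Bochner_Integration.integrable_diff integrable_mult_right int3 int4)
    fix y
    have "h (\<lambda>i\<in>{..<m}. \<zeta> i \<omega>, y) = \<zeta> i \<omega> * (((\<Sum>i<m. a j i * \<zeta> i \<omega>) + y j) / smooth_norm \<epsilon> J (\<lambda>l. (\<Sum>i<m. a l i * \<zeta> i \<omega>) + y l))
      - \<sigma>\<^sup>2 * quotient_deriv \<epsilon> J (\<lambda>l. (\<Sum>i<m. a l i * \<zeta> i \<omega>) + y l) j (\<lambda>l. a l i)" for \<omega>
      using i by (simp add: h_def x_def)
    then show "(\<integral>\<omega>. h (\<lambda>i\<in>{..<m}. \<zeta> i \<omega>, y) \<partial>M) = 0"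
      using stein_gaussian_const[OF eps J j \<sigma> ind D i, of a y] by simp
  qed
  then have "(\<integral>\<omega>. \<zeta> i \<omega> * (X \<omega> j / smooth_norm \<epsilon> J (X \<omega>)) - \<sigma>\<^sup>2 * quotient_deriv \<epsilon> J (X \<omega>) j (\<lambda>l. a l i) \<partial>M) = 0"
    unfolding h .
  then show ?C
    using int3 int4 by simp
qed

text \<open>Stein's identities are summed with the weights \<open>a j i\<close>, and the resulting
  trace is bounded pointwise. The parameter \<kappa> is free here; its mismatch with the covariance
  of \<open>G\<close> is the error term.\<close>

lemma stein_gaussian_lower:
  fixes \<zeta> :: "nat \<Rightarrow> 'a \<Rightarrow> real" and a :: "nat \<Rightarrow> nat \<Rightarrow> real" and U :: "nat \<Rightarrow> 'a \<Rightarrow> real"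
  assumes eps: "\<epsilon> > 0" and J: "finite J" and \<sigma>: "\<sigma> > 0" and \<kappa>: "0 \<le> \<kappa>"
    and ind: "indep_vars (\<lambda>_. borel) \<zeta> {..<m}"
    and D: "\<And>i. i < m \<Longrightarrow> distributed M lborel (\<zeta> i) (normal_density 0 \<sigma>)"
    and U: "indep_var (Pi\<^sub>M {..<m} (\<lambda>_. borel)) (\<lambda>\<omega>. \<lambda>i\<in>{..<m}. \<zeta> i \<omega>) (Pi\<^sub>M J (\<lambda>_. borel)) (\<lambda>\<omega>. \<lambda>l\<in>J. U l \<omega>)"
  defines "G \<equiv> \<lambda>\<omega> l. \<Sum>i<m. a l i * \<zeta> i \<omega>"
  defines "X \<equiv> \<lambda>\<omega> l. G \<omega> l + U l \<omega>"
  shows "\<kappa> * (real (card J) - 1) * (\<integral>\<omega>. 1 / smooth_norm \<epsilon> J (X \<omega>) \<partial>M) -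
      2 / \<epsilon> * (\<Sum>j\<in>J. \<Sum>l\<in>J. \<bar>\<sigma>\<^sup>2 * (\<Sum>i<m. a j i * a l i) - (if j = l then \<kappa> else 0)\<bar>)
    \<le> (\<integral>\<omega>. (\<Sum>j\<in>J. G \<omega> j * (X \<omega> j / smooth_norm \<epsilon> J (X \<omega>))) \<partial>M)"
proof -
  have X: "X = (\<lambda>\<omega> l. (\<Sum>i<m. a l i * \<zeta> i \<omega>) + U l \<omega>)" by (simp add: X_def G_def)
  have st: "integrable M (\<lambda>\<omega>. \<zeta> i \<omega> * (X \<omega> j / smooth_norm \<epsilon> J (X \<omega>)))"
    "integrable M (\<lambda>\<omega>. quotient_deriv \<epsilon> J (X \<omega>) j (\<lambda>l. a l i))"
    "(\<integral>\<omega>. \<zeta> i \<omega> * (X \<omega> j / smooth_norm \<epsilon> J (X \<omega>)) \<partial>M) =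
      \<sigma>\<^sup>2 * (\<integral>\<omega>. quotient_deriv \<epsilon> J (X \<omega>) j (\<lambda>l. a l i) \<partial>M)"
    if "j \<in> J" "i < m" for j i
    unfolding X by (rule stein_gaussian[OF eps J that(1) \<sigma> ind D U that(2)], assumption)+
  let ?q = "\<lambda>j i \<omega>. quotient_deriv \<epsilon> J (X \<omega>) j (\<lambda>l. a l i)"
  let ?E = "2 / \<epsilon> * (\<Sum>j\<in>J. \<Sum>l\<in>J. \<bar>\<sigma>\<^sup>2 * (\<Sum>i<m. a j i * a l i) - (if j = l then \<kappa> else 0)\<bar>)"
  have m\<zeta>: "\<zeta> k \<in> borel_measurable M" if "k < m" for k
    using ind that by (auto simp: indep_vars_def)
  have mU: "U l \<in> borel_measurable M" if "l \<in> J" for l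
    using measurable_compose[OF indep_var_rv2[OF U] measurable_component_singleton[OF that]] that by simp
  have mX: "l \<in> J \<Longrightarrow> (\<lambda>\<omega>. X \<omega> l) \<in> borel_measurable M" for l
    unfolding X by (intro borel_measurable_add borel_measurable_sum borel_measurable_times borel_measurable_const m\<zeta> mU) simp_all
  note i1 = integrable_inverse_smooth_norm[OF eps J finite_measure_axioms mX]
  have iS: "integrable M (\<lambda>\<omega>. \<Sum>j\<in>J. \<Sum>i<m. a j i * (\<sigma>\<^sup>2 * ?q j i \<omega>))"
    using st(2) by (intro Bochner_Integration.integrable_sum integrable_mult_right) auto
  have "\<kappa> * (real (card J) - 1) * (\<integral>\<omega>. 1 / smooth_norm \<epsilon> J (X \<omega>) \<partial>M) - ?E =
      (\<integral>\<omega>. \<kappa> * (real (card J) - 1) * (1 / smooth_norm \<epsilon> J (X \<omega>)) - ?E \<partial>M)"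
  proof -
    define c where "c = ?E"
    have "(\<integral>\<omega>. \<kappa> * (real (card J) - 1) * (1 / smooth_norm \<epsilon> J (X \<omega>)) - c \<partial>M) =
      (\<integral>\<omega>. \<kappa> * (real (card J) - 1) * (1 / smooth_norm \<epsilon> J (X \<omega>)) \<partial>M) - (\<integral>\<omega>. c \<partial>M)"
      using i1 by (intro Bochner_Integration.integral_diff integrable_mult_right) auto
    also have "\<dots> = \<kappa> * (real (card J) - 1) * (\<integral>\<omega>. 1 / smooth_norm \<epsilon> J (X \<omega>) \<partial>M) - c"
      by (simp only: integral_mult_right_zero) (simp add: prob_space)
    finally show ?thesis by (simp only: c_def)
  qed
  also have "\<dots> \<le> (\<integral>\<omega>. (\<Sum>j\<in>J. \<Sum>i<m. a j i * (\<sigma>\<^sup>2 * ?q j i \<omega>)) \<partial>M)"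
  proof (rule integral_mono[OF _ iS])
    show "integrable M (\<lambda>\<omega>. \<kappa> * (real (card J) - 1) * (1 / smooth_norm \<epsilon> J (X \<omega>)) - ?E)"
      using i1 by (intro Bochner_Integration.integrable_diff integrable_mult_right) auto
    fix \<omega>
    show "\<kappa> * (real (card J) - 1) * (1 / smooth_norm \<epsilon> J (X \<omega>)) - ?E \<le> (\<Sum>j\<in>J. \<Sum>i<m. a j i * (\<sigma>\<^sup>2 * ?q j i \<omega>))"
      unfolding quotient_deriv_sum[OF J]
      using quotient_deriv_sum_lower[OF eps J \<kappa>, of "X \<omega>" "\<lambda>j l. \<sigma>\<^sup>2 * (\<Sum>i<m. a j i * a l i)"] by simp
  qed
  also have "\<dots> = (\<Sum>j\<in>J. \<Sum>i<m. a j i * (\<sigma>\<^sup>2 * (\<integral>\<omega>. ?q j i \<omega> \<partial>M)))"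
    using integral_double_sum[of J "{..<m}" M "\<lambda>j i \<omega>. \<sigma>\<^sup>2 * ?q j i \<omega>" a] st(2) by simp
  also have "\<dots> = (\<Sum>j\<in>J. \<Sum>i<m. a j i * (\<integral>\<omega>. \<zeta> i \<omega> * (X \<omega> j / smooth_norm \<epsilon> J (X \<omega>)) \<partial>M))"
    using st(3) by (intro sum.cong refl) (simp only: lessThan_iff)
  also have "\<dots> = (\<integral>\<omega>. (\<Sum>j\<in>J. \<Sum>i<m. a j i * (\<zeta> i \<omega> * (X \<omega> j / smooth_norm \<epsilon> J (X \<omega>)))) \<partial>M)"
    by (rule integral_double_sum[symmetric]) (simp only: st(1) lessThan_iff)
  also have "\<dots> = (\<integral>\<omega>. (\<Sum>j\<in>J. G \<omega> j * (X \<omega> j / smooth_norm \<epsilon> J (X \<omega>))) \<partial>M)"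
    by (simp only: G_def sum_distrib_right mult.assoc)
  finally show ?thesis .
qed

end

section \<open>The noise process\<close>

lemma l2lim_perturb:
  assumes l: "l2lim M X Y" and V: "\<And>k. sqint M (V k)"
    and d: "(\<lambda>k. \<integral>x. (X k x - V k x)\<^sup>2 \<partial>M) \<longlonglongrightarrow> 0"
  shows "l2lim M V Y"
proof -
  have s: "sqint M (X k)" for k using l by (simp add: l2lim_def)
  have "l2lim M (\<lambda>k x. X k x - V k x) (\<lambda>x. 0)"
    unfolding l2lim_def using d by (auto intro!: sqint_diff s V sqint_zero)
  from l2lim_add[OF l l2lim_cmult[OF this, of "-1"]] show ?thesis by simp
qed

text \<open>Identifies the covariances of Brownian step integrals over the grid with inner products
  of their integrands, whose limits are known.\<close>

lemma integral_grid_list_mult: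
  assumes T: "T > 0" and m: "m > 0"
  shows "(\<integral>t. step_fun (grid_list T m g) t * step_fun (grid_list T m h) t \<partial>lebesgue_on {0..T}) =
     T / real m * (\<Sum>i<m. g (grid T m i) * h (grid T m i))"
proof -
  let ?K = "lebesgue_on {0..T}"
  let ?I = "\<lambda>i. indicator {grid T m i<..grid T m (Suc i)} :: real \<Rightarrow> real"
  have sI: "sqint ?K (?I i)" for i
    using sqint_step_fun[of 0 T "[(1, grid T m i, grid T m (Suc i))]"] by (simp add: step_fun_def[abs_def])
  have mono: "grid T m i \<le> grid T m k" if "i \<le> k" for i k
    using that T by (auto simp: grid_def intro!: divide_right_mono mult_left_mono)
  have II: "(\<integral>t. ?I i t * ?I k t \<partial>?K) = (if i = k then T / real m else 0)" if "i < m" "k < m" for i k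
  proof -
    have "(\<integral>t. ?I i t * ?I k t \<partial>?K) = min (grid T m (Suc i)) (grid T m (Suc k)) - min (grid T m (Suc i)) (grid T m k)
        - min (grid T m i) (grid T m (Suc k)) + min (grid T m i) (grid T m k)"
      using that grid_bounds[OF T, of _ m] by (intro integral_indicator_mult_lebesgue_on) auto
    also have "\<dots> = (if i = k then T / real m else 0)"
    proof (cases i k rule: linorder_cases)
      case less
      then show ?thesis using mono[of "Suc i" k] mono[of i k] mono[of "Suc i" "Suc k"] mono[of i "Suc k"] by simp
    next
      case equal
      have "grid T m (Suc k) - grid T m k = T / real m" by (simp add: grid_def distrib_left add_divide_distrib)
      then show ?thesis using equal mono[of k "Suc k"] by simp
    next
      case greater
      then show ?thesis using mono[of "Suc k" i] mono[of k i] mono[of "Suc k" "Suc i"] mono[of k "Suc i"] by simp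
    qed
    finally show ?thesis .
  qed
  have "(\<integral>t. step_fun (grid_list T m g) t * step_fun (grid_list T m h) t \<partial>?K) =
     (\<integral>t. (\<Sum>i<m. \<Sum>k<m. (g (grid T m i) * h (grid T m k)) * (?I i t * ?I k t)) \<partial>?K)"
    unfolding step_fun_grid_list sum_product
    by (intro Bochner_Integration.integral_cong sum.cong refl) (simp only: mult_ac)
  also have "\<dots> = (\<Sum>i<m. \<Sum>k<m. (g (grid T m i) * h (grid T m k)) * (\<integral>t. ?I i t * ?I k t \<partial>?K))"
    by (rule integral_double_sum) (rule sqint_mult[OF sI sI])
  also have "\<dots> = (\<Sum>i<m. \<Sum>k<m. if i = k then (g (grid T m i) * h (grid T m k)) * (T / real m) else 0)"
    by (intro sum.cong refl) (simp add: II)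
  also have "\<dots> = T / real m * (\<Sum>i<m. g (grid T m i) * h (grid T m i))"
    by (simp add: sum_distrib_left mult_ac)
  finally show ?thesis .
qed

text \<open>The right hand side as a function of \<open>r\<^sup>2\<close> is convex; the left hand side is its tangent at \<open>R\<^sup>2\<close>.\<close>

lemma inverse_ge_tangent:
  fixes r R :: real
  assumes "r > 0" "R > 0"
  shows "3 / (2 * R) - r\<^sup>2 / (2 * R^3) \<le> 1 / r"
proof -
  have "0 \<le> (r - R)\<^sup>2 * (r + 2 * R)" using assms by (intro mult_nonneg_nonneg) auto
  also have "\<dots> = 2 * R^3 - 3 * R\<^sup>2 * r + r^3" by (simp add: power2_eq_square power3_eq_cube algebra_simps)
  finally have "0 \<le> (2 * R^3 - 3 * R\<^sup>2 * r + r^3) / (2 * R^3 * r)" using assms by simp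
  also have "\<dots> = 1 / r - (3 / (2 * R) - r\<^sup>2 / (2 * R^3))"
    using assms by (simp add: field_simps power2_eq_square power3_eq_cube)
  finally show ?thesis by simp
qed

text \<open>The data whose existence \<open>noise_laws\<close> asserts, on a fixed probability
  space; the bounds on the two volatilities enter only in the final estimate.\<close>

locale levy_noise = prob_space M for M :: "'a measure" +
  fixes levy :: "real measure" and w :: "real \<Rightarrow> 'a \<Rightarrow> real"
    and \<mu> :: "'a \<Rightarrow> (real \<times> real) measure" and z :: "real \<Rightarrow> 'a \<Rightarrow> real"
    and \<sigma>\<^sub>1 \<sigma>\<^sub>2 :: real
  assumes levy: "levy_measure_space levy"
    and bm: "standard_brownian_motion M w"
    and poisson: "poisson_random_measure M \<mu> (jump_compensator levy)"
    and bm_jump_indep: "brownian_jump_independent M w \<mu> (jump_compensator levy)"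
    and jump_process: "compensated_jump_process M \<mu> (jump_compensator levy) z"
begin

abbreviation "\<nu> \<equiv> jump_compensator levy"

definition \<xi> :: "real \<Rightarrow> 'a \<Rightarrow> real" where
  "\<xi> t \<omega> = \<sigma>\<^sub>1 * w t \<omega> + \<sigma>\<^sub>2 * z t \<omega>"

section \<open>The sigma-algebras of the Brownian motion and of the jumps\<close>

definition bm_gen :: "'a set set" where
  "bm_gen = {w t -` B \<inter> space M | t B. 0 \<le> t \<and> B \<in> sets borel}"

definition jump_gen :: "'a set set" where
  "jump_gen = {(\<lambda>\<omega>. emeasure (\<mu> \<omega>) A) -` B \<inter> space M | A B. A \<in> sets \<nu> \<and> B \<in> sets borel}"

abbreviation "bm_sigma \<equiv> sigma (space M) bm_gen"
abbreviation "jump_sigma \<equiv> sigma (space M) jump_gen"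

lemma sets_bm_sigma: "sets bm_sigma = sigma_sets (space M) bm_gen"
  by (rule sets_measure_of) (auto simp: bm_gen_def)

lemma sets_jump_sigma: "sets jump_sigma = sigma_sets (space M) jump_gen"
  by (rule sets_measure_of) (auto simp: jump_gen_def)

lemma space_bm_sigma [simp]: "space bm_sigma = space M"
  by (simp add: space_measure_of_conv)

lemma space_jump_sigma [simp]: "space jump_sigma = space M"
  by (simp add: space_measure_of_conv)

lemma indep_sigma: "indep_set (sigma_sets (space M) bm_gen) (sigma_sets (space M) jump_gen)"
  using bm_jump_indep by (simp add: brownian_jump_independent_def bm_gen_def jump_gen_def)

text \<open>Both orders are stated because it is the second variable that gets held fixed: the jumps
  in Stein's identity, the Brownian part in the monotonicity argument.\<close>

lemma indep_var_bm_jump: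
  assumes X: "X \<in> measurable bm_sigma S" and Y: "Y \<in> measurable jump_sigma T"
  shows "indep_var S X T Y" "indep_var T Y S X"
proof -
  have ev: "sigma_sets (space M) bm_gen \<subseteq> events" "sigma_sets (space M) jump_gen \<subseteq> events"
    and pr: "\<And>a b. a \<in> sigma_sets (space M) bm_gen \<Longrightarrow> b \<in> sigma_sets (space M) jump_gen \<Longrightarrow> prob (a \<inter> b) = prob a * prob b"
    using indep_sigma by (auto simp: indep_sets2_eq)
  have sX: "sigma_sets (space M) {X -` A \<inter> space M |A. A \<in> sets S} \<subseteq> sigma_sets (space M) bm_gen"
    using measurable_sets[OF X] by (intro sigma_sets_mono) (auto simp: sets_bm_sigma)
  have sY: "sigma_sets (space M) {Y -` A \<inter> space M |A. A \<in> sets T} \<subseteq> sigma_sets (space M) jump_gen"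
    using measurable_sets[OF Y] by (intro sigma_sets_mono) (auto simp: sets_jump_sigma)
  have rv: "random_variable S X" "random_variable T Y"
    using X Y ev by (auto simp: measurable_def sets_bm_sigma sets_jump_sigma)
  show "indep_var S X T Y"
    unfolding indep_var_eq indep_sets2_eq
    using rv subset_trans[OF sX ev(1)] subset_trans[OF sY ev(2)] pr[OF subsetD[OF sX] subsetD[OF sY]] by simp
  have pr': "prob (b \<inter> a) = prob b * prob a"
    if "b \<in> sigma_sets (space M) jump_gen" "a \<in> sigma_sets (space M) bm_gen" for a b
    using pr[OF that(2,1)] by (simp add: Int_commute mult.commute)
  show "indep_var T Y S X"
    unfolding indep_var_eq indep_sets2_eq
    using rv subset_trans[OF sX ev(1)] subset_trans[OF sY ev(2)] pr'[OF subsetD[OF sY] subsetD[OF sX]] by simp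
qed

lemma bm_sigma_measurable: "0 \<le> t \<Longrightarrow> w t \<in> borel_measurable bm_sigma"
  by (rule measurableI, simp, unfold sets_bm_sigma, rule sigma_sets.Basic)
     (auto simp: bm_gen_def space_measure_of_conv)

lemma jump_sigma_measurable: "A \<in> sets \<nu> \<Longrightarrow> (\<lambda>\<omega>. emeasure (\<mu> \<omega>) A) \<in> borel_measurable jump_sigma"
  by (rule measurableI, simp, unfold sets_jump_sigma, rule sigma_sets.Basic)
     (auto simp: jump_gen_def space_measure_of_conv)

lemma simple_integral_jump_sigma:
  assumes "finite_simple \<nu> p"
  shows "simple_compensated_integral \<mu> \<nu> p \<in> borel_measurable jump_sigma"
  using assms unfolding simple_compensated_integral_def[abs_def]
proof (induction p)
  case (Cons x p)
  obtain a A where x: "x = (a, A)" by (cases x)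
  have A: "A \<in> sets \<nu>" "finite_simple \<nu> p"
    using Cons.prems by (auto simp: finite_simple_def[OF poisson] x)
  have "(\<lambda>\<omega>. a * (measure (\<mu> \<omega>) A - measure \<nu> A)) \<in> borel_measurable jump_sigma"
    unfolding measure_def using jump_sigma_measurable[OF A(1)] by measurable
  with Cons.IH[OF A(2)] show ?case by (simp add: x)
qed simp

text \<open>What the jump part has to satisfy: measurability for the jump sigma-algebra gives
  independence of \<open>w\<close>, and mean zero removes the linear term in the monotonicity
  argument.\<close>

definition jump_fun :: "('a \<Rightarrow> real) \<Rightarrow> bool" where
  "jump_fun V \<longleftrightarrow> V \<in> borel_measurable jump_sigma \<and> sqint M V \<and> (\<integral>\<omega>. V \<omega> \<partial>M) = 0"

text \<open>The compensated jump process is a version, defined up to null sets, so it need not be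
  measurable for the \<open>\<sigma>\<close>-algebra of the jump measure: it is only a mean square limit of such variables.\<close>

definition jump_approx :: "('a \<Rightarrow> real) \<Rightarrow> bool" where
  "jump_approx X \<longleftrightarrow> (\<exists>V. (\<forall>k. jump_fun (V k)) \<and> l2lim M V X)"

lemma jump_fun_cmult: "jump_fun V \<Longrightarrow> jump_fun (\<lambda>\<omega>. c * V \<omega>)"
  by (auto simp: jump_fun_def intro: sqint_cmult)

lemma jump_fun_add: "jump_fun V \<Longrightarrow> jump_fun V' \<Longrightarrow> jump_fun (\<lambda>\<omega>. V \<omega> + V' \<omega>)"
  by (auto simp: jump_fun_def sqint_integrable[OF finite_measure_axioms] intro: sqint_add)

lemma jump_approx_sqint: "jump_approx X \<Longrightarrow> sqint M X"
  by (auto simp: jump_approx_def l2lim_def)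

lemma jump_approx_zero: "jump_approx (\<lambda>_. 0)"
  unfolding jump_approx_def
  by (intro exI[of _ "\<lambda>_ _. 0"]) (simp add: jump_fun_def sqint_zero l2lim_const)

lemma jump_approx_cmult:
  assumes "jump_approx X" shows "jump_approx (\<lambda>\<omega>. c * X \<omega>)"
proof -
  obtain V where "\<And>k. jump_fun (V k)" "l2lim M V X" using assms by (auto simp: jump_approx_def)
  then show ?thesis
    unfolding jump_approx_def by (intro exI[of _ "\<lambda>k \<omega>. c * V k \<omega>"] conjI allI jump_fun_cmult l2lim_cmult)
qed

lemma jump_approx_add:
  assumes "jump_approx X" "jump_approx Y" shows "jump_approx (\<lambda>\<omega>. X \<omega> + Y \<omega>)"
proof -
  obtain V W where "\<And>k. jump_fun (V k)" "l2lim M V X" "\<And>k. jump_fun (W k)" "l2lim M W Y"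
    using assms by (auto simp: jump_approx_def)
  then show ?thesis
    unfolding jump_approx_def by (intro exI[of _ "\<lambda>k \<omega>. V k \<omega> + W k \<omega>"] conjI allI jump_fun_add l2lim_add)
qed

lemma jump_approx_diff: "jump_approx X \<Longrightarrow> jump_approx Y \<Longrightarrow> jump_approx (\<lambda>\<omega>. X \<omega> - Y \<omega>)"
  using jump_approx_add[of X "\<lambda>\<omega>. (-1) * Y \<omega>"] jump_approx_cmult[of Y "-1"] by simp

section \<open>The jump process and the covariance of the noise\<close>

lemma z_compensated_integral:
  "0 \<le> t \<Longrightarrow> has_compensated_integral M \<mu> \<nu> (\<lambda>(s, x). indicator {0<..t} s * x) (z t)"
  using jump_process by (simp add: compensated_jump_process_def)

lemma z_jump_approx: "0 \<le> t \<Longrightarrow> jump_approx (z t)"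
proof -
  assume "0 \<le> t"
  from z_compensated_integral[OF this]
  obtain p where p: "\<And>k. finite_simple \<nu> (p k)" "l2lim M (\<lambda>k. simple_compensated_integral \<mu> \<nu> (p k)) (z t)"
    by (rule has_compensated_integralE[OF poisson]) (rule that)
  have "jump_fun (simple_compensated_integral \<mu> \<nu> (p k))" for k
    using p(1)[of k] simple_integral_jump_sigma sqint_simple_integral[OF poisson] integral_simple_integral[OF poisson]
    by (simp add: jump_fun_def)
  with p(2) show ?thesis
    unfolding jump_approx_def by (intro exI[of _ "\<lambda>k. simple_compensated_integral \<mu> \<nu> (p k)"]) simp
qed

lemma z_cov:
  assumes "0 \<le> s" "0 \<le> t" shows "(\<integral>\<omega>. z s \<omega> * z t \<omega> \<partial>M) = min s t"
  using compensated_integral_isometry[OF poisson z_compensated_integral[OF assms(1)] z_compensated_integral[OF assms(2)]]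
    jump_compensator_inner[OF levy assms] by simp

lemma step_integral_jump_approx:
  "valid_steps T p \<Longrightarrow> jump_approx (\<lambda>\<omega>. step_integral p (\<lambda>t. z t \<omega>))"
proof (induction p)
  case Nil
  then show ?case by (simp add: step_integral_def jump_approx_zero)
next
  case (Cons x p)
  obtain a s u where x: "x = (a, s, u)" by (cases x)
  have "valid_steps T p" "0 \<le> s" "0 \<le> u" using Cons.prems by (auto simp: valid_steps_def x)
  with Cons.IH show ?case
    by (simp add: step_integral_def x jump_approx_add jump_approx_cmult jump_approx_diff z_jump_approx)
qed

lemma jump_approx_mean:
  assumes "jump_approx X" shows "(\<integral>\<omega>. X \<omega> \<partial>M) = 0"
proof -
  obtain V where V: "\<And>k. jump_fun (V k)" "l2lim M V X" using assms by (auto simp: jump_approx_def)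
  have "(\<lambda>k. 0) \<longlonglongrightarrow> (\<integral>\<omega>. X \<omega> \<partial>M)"
    using l2lim_integral[OF finite_measure_axioms V(2)] V(1) by (simp add: jump_fun_def)
  then show ?thesis by (simp add: LIMSEQ_const_iff)
qed

text \<open>Independence of \<open>w t\<close> is available for the approximants only, but a
  vanishing covariance survives the mean square limit.\<close>

lemma w_jump_approx:
  assumes "0 \<le> t" "jump_approx X" shows "(\<integral>\<omega>. w t \<omega> * X \<omega> \<partial>M) = 0"
proof -
  obtain V where V: "\<And>k. jump_fun (V k)" "l2lim M V X" using assms by (auto simp: jump_approx_def)
  have "(\<integral>\<omega>. w t \<omega> * V k \<omega> \<partial>M) = 0" for k
  proof -
    have "indep_var borel (w t) borel (V k)"
      using V(1)[of k] by (intro indep_var_bm_jump bm_sigma_measurable assms) (simp add: jump_fun_def)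
    then have "(\<integral>\<omega>. w t \<omega> * V k \<omega> \<partial>M) = (\<integral>\<omega>. w t \<omega> \<partial>M) * (\<integral>\<omega>. V k \<omega> \<partial>M)"
      using V(1)[of k] bm_moments(1)[OF bm assms(1)]
      by (intro indep_var_lebesgue_integral) (auto simp: jump_fun_def intro: sqint_integrable[OF finite_measure_axioms])
    then show ?thesis using V(1)[of k] by (simp add: jump_fun_def)
  qed
  then have "(\<lambda>k. 0) \<longlonglongrightarrow> (\<integral>\<omega>. w t \<omega> * X \<omega> \<partial>M)"
    using l2lim_mult[OF l2lim_const[OF bm_moments(1)[OF bm assms(1)]] V(2)] by simp
  then show ?thesis by (simp add: LIMSEQ_const_iff)
qed

lemma \<xi>_sqint: "0 \<le> t \<Longrightarrow> sqint M (\<xi> t)"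
  unfolding \<xi>_def[abs_def] by (intro sqint_add sqint_cmult bm_moments[OF bm] jump_approx_sqint z_jump_approx)

lemma \<xi>_mean: "0 \<le> t \<Longrightarrow> (\<integral>\<omega>. \<xi> t \<omega> \<partial>M) = 0"
  using bm_moments[OF bm, of t] jump_approx_mean[OF z_jump_approx] jump_approx_sqint[OF z_jump_approx]
  by (simp add: \<xi>_def sqint_integrable[OF finite_measure_axioms])

text \<open>The Brownian and the jump part are uncorrelated and have the same covariance function,
  so their squared volatilities add.\<close>

lemma \<xi>_cov:
  assumes "0 \<le> s" "0 \<le> t"
  shows "(\<integral>\<omega>. \<xi> s \<omega> * \<xi> t \<omega> \<partial>M) = (\<sigma>\<^sub>1\<^sup>2 + \<sigma>\<^sub>2\<^sup>2) * min s t"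
proof -
  note sw = bm_moments(1)[OF bm assms(1)] bm_moments(1)[OF bm assms(2)]
  note sz = jump_approx_sqint[OF z_jump_approx[OF assms(1)]] jump_approx_sqint[OF z_jump_approx[OF assms(2)]]
  have "(\<integral>\<omega>. \<xi> s \<omega> * \<xi> t \<omega> \<partial>M) = (\<integral>\<omega>. \<sigma>\<^sub>1\<^sup>2 * (w s \<omega> * w t \<omega>) + (\<sigma>\<^sub>1 * \<sigma>\<^sub>2) * (w s \<omega> * z t \<omega>)
     + (\<sigma>\<^sub>1 * \<sigma>\<^sub>2) * (w t \<omega> * z s \<omega>) + \<sigma>\<^sub>2\<^sup>2 * (z s \<omega> * z t \<omega>) \<partial>M)"
    by (intro Bochner_Integration.integral_cong) (auto simp: \<xi>_def power2_eq_square algebra_simps)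
  also have "\<dots> = \<sigma>\<^sub>1\<^sup>2 * (\<integral>\<omega>. w s \<omega> * w t \<omega> \<partial>M) + (\<sigma>\<^sub>1 * \<sigma>\<^sub>2) * (\<integral>\<omega>. w s \<omega> * z t \<omega> \<partial>M)
     + (\<sigma>\<^sub>1 * \<sigma>\<^sub>2) * (\<integral>\<omega>. w t \<omega> * z s \<omega> \<partial>M) + \<sigma>\<^sub>2\<^sup>2 * (\<integral>\<omega>. z s \<omega> * z t \<omega> \<partial>M)"
    by (simp add: sqint_mult[OF sw(1) sw(2)] sqint_mult[OF sw(1) sz(2)] sqint_mult[OF sw(2) sz(1)] sqint_mult[OF sz(1) sz(2)])
  also have "\<dots> = (\<sigma>\<^sub>1\<^sup>2 + \<sigma>\<^sub>2\<^sup>2) * min s t"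
    using assms by (simp add: bm_cov[OF bm] z_cov w_jump_approx z_jump_approx distrib_right)
  finally show ?thesis .
qed

lemma step_integral_mean:
  assumes "valid_steps T p" shows "(\<integral>\<omega>. step_integral p (\<lambda>t. \<xi> t \<omega>) \<partial>M) = 0"
  using assms
proof (induction p)
  case Nil
  then show ?case by (simp add: step_integral_def)
next
  case (Cons x p)
  obtain a s u where x: "x = (a, s, u)" by (cases x)
  have v: "valid_steps T p" "0 \<le> s" "0 \<le> u" using Cons.prems by (auto simp: valid_steps_def x)
  have "sqint M (\<lambda>\<omega>. step_integral p (\<lambda>t. \<xi> t \<omega>))"
    by (rule sqint_step_integral[OF _ v(1)]) (auto intro: \<xi>_sqint)
  then have "integrable M (\<lambda>\<omega>. step_integral p (\<lambda>t. \<xi> t \<omega>))" by (rule sqint_integrable[OF finite_measure_axioms])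
  moreover have "integrable M (\<xi> s)" "integrable M (\<xi> u)"
    using v by (auto intro: sqint_integrable[OF finite_measure_axioms] \<xi>_sqint)
  ultimately show ?case
    using Cons.IH[OF v(1)] v \<xi>_mean by (simp add: step_integral_def x)
qed

lemma step_integral_\<xi>_inner:
  assumes "valid_steps T p" "valid_steps T q"
  shows "(\<integral>\<omega>. step_integral p (\<lambda>t. \<xi> t \<omega>) * step_integral q (\<lambda>t. \<xi> t \<omega>) \<partial>M) =
     (\<sigma>\<^sub>1\<^sup>2 + \<sigma>\<^sub>2\<^sup>2) * (\<integral>t. step_fun p t * step_fun q t \<partial>lebesgue_on {0..T})"
  by (rule step_integral_inner[OF _ _ assms]) (auto intro: \<xi>_sqint \<xi>_cov)

end

section \<open>Integrals of deterministic functions against the noise\<close>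

context levy_noise
begin

text \<open>The integral of \<open>f\<close> against \<open>\<xi>\<close>, on the probability space
  itself instead of path space and without drift. It is a relation because the limit is determined
  only up to null sets.\<close>

definition noise_integral :: "real \<Rightarrow> (real \<Rightarrow> real) \<Rightarrow> ('a \<Rightarrow> real) \<Rightarrow> bool" where
  "noise_integral T f N \<longleftrightarrow> (\<exists>p. (\<forall>k. valid_steps T (p k)) \<and>
     l2lim (lebesgue_on {0..T}) (\<lambda>k. step_fun (p k)) f \<and>
     l2lim M (\<lambda>k \<omega>. step_integral (p k) (\<lambda>t. \<xi> t \<omega>)) N)"

lemma sqint_step_integral_\<xi>: "valid_steps T p \<Longrightarrow> sqint M (\<lambda>\<omega>. step_integral p (\<lambda>t. \<xi> t \<omega>))"
  by (rule sqint_step_integral) (auto intro: \<xi>_sqint)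

lemma step_integral_diff_square:
  assumes "valid_steps T p" "valid_steps T q"
  shows "(\<integral>\<omega>. (step_integral p (\<lambda>t. \<xi> t \<omega>) - step_integral q (\<lambda>t. \<xi> t \<omega>))\<^sup>2 \<partial>M) =
     (\<sigma>\<^sub>1\<^sup>2 + \<sigma>\<^sub>2\<^sup>2) * (\<integral>t. (step_fun p t - step_fun q t)\<^sup>2 \<partial>lebesgue_on {0..T})"
proof -
  let ?I = "\<lambda>p \<omega>. step_integral p (\<lambda>t. \<xi> t \<omega>)" and ?K = "lebesgue_on {0..T}"
  have expand: "(\<integral>x. (X x - Y x)\<^sup>2 \<partial>N) = (\<integral>x. X x * X x \<partial>N) - 2 * (\<integral>x. X x * Y x \<partial>N) + (\<integral>x. Y x * Y x \<partial>N)"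
    if "sqint N X" "sqint N Y" for X Y :: "'x \<Rightarrow> real" and N
  proof -
    have "(\<integral>x. (X x - Y x)\<^sup>2 \<partial>N) = (\<integral>x. X x * X x - 2 * (X x * Y x) + Y x * Y x \<partial>N)"
      by (intro Bochner_Integration.integral_cong) (auto simp: power2_eq_square algebra_simps)
    then show ?thesis using sqint_mult[OF that(1,1)] sqint_mult[OF that(1,2)] sqint_mult[OF that(2,2)] by simp
  qed
  show ?thesis
    unfolding expand[OF sqint_step_integral_\<xi>[OF assms(1)] sqint_step_integral_\<xi>[OF assms(2)]]
      expand[OF sqint_step_fun sqint_step_fun]
    using step_integral_\<xi>_inner[OF assms(1,1)] step_integral_\<xi>_inner[OF assms(1,2)] step_integral_\<xi>_inner[OF assms(2,2)]
    by (simp add: algebra_simps)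
qed

lemma l2lim_diff_square_tendsto_0:
  assumes "l2lim K X f" "l2lim K Y f"
  shows "(\<lambda>k. \<integral>t. (X k t - Y k t)\<^sup>2 \<partial>K) \<longlonglongrightarrow> 0"
  using l2lim_square[OF l2lim_add[OF assms(1) l2lim_cmult[OF assms(2), of "-1"]]] by simp

text \<open>By the isometry the limit does not depend on the approximating steps. Grid steps can
  thus replace the unknown sequence behind the definition.\<close>

lemma noise_integral_l2lim:
  assumes N: "noise_integral T f N" and q: "\<And>k. valid_steps T (q k)"
    and l: "l2lim (lebesgue_on {0..T}) (\<lambda>k. step_fun (q k)) f"
  shows "l2lim M (\<lambda>k \<omega>. step_integral (q k) (\<lambda>t. \<xi> t \<omega>)) N"
proof -
  obtain p where p: "\<And>k. valid_steps T (p k)" "l2lim (lebesgue_on {0..T}) (\<lambda>k. step_fun (p k)) f"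
     "l2lim M (\<lambda>k \<omega>. step_integral (p k) (\<lambda>t. \<xi> t \<omega>)) N"
    using N by (auto simp: noise_integral_def)
  have "(\<lambda>k. (\<sigma>\<^sub>1\<^sup>2 + \<sigma>\<^sub>2\<^sup>2) * (\<integral>t. (step_fun (p k) t - step_fun (q k) t)\<^sup>2 \<partial>lebesgue_on {0..T})) \<longlonglongrightarrow> (\<sigma>\<^sub>1\<^sup>2 + \<sigma>\<^sub>2\<^sup>2) * 0"
    by (intro tendsto_intros l2lim_diff_square_tendsto_0[OF p(2) l])
  then show ?thesis
    by (intro l2lim_perturb[OF p(3)] sqint_step_integral_\<xi>[OF q]) (simp add: step_integral_diff_square[OF p(1) q])
qed

lemma noise_integral_inner:
  assumes "noise_integral T f N" "noise_integral T g N'"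
  shows "(\<integral>\<omega>. N \<omega> * N' \<omega> \<partial>M) = (\<sigma>\<^sub>1\<^sup>2 + \<sigma>\<^sub>2\<^sup>2) * (\<integral>t. f t * g t \<partial>lebesgue_on {0..T})"
proof -
  obtain p where p: "\<And>k. valid_steps T (p k)" "l2lim (lebesgue_on {0..T}) (\<lambda>k. step_fun (p k)) f"
     "l2lim M (\<lambda>k \<omega>. step_integral (p k) (\<lambda>t. \<xi> t \<omega>)) N"
    using assms(1) by (auto simp: noise_integral_def)
  obtain q where q: "\<And>k. valid_steps T (q k)" "l2lim (lebesgue_on {0..T}) (\<lambda>k. step_fun (q k)) g"
     "l2lim M (\<lambda>k \<omega>. step_integral (q k) (\<lambda>t. \<xi> t \<omega>)) N'"
    using assms(2) by (auto simp: noise_integral_def)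
  have "(\<lambda>k. (\<sigma>\<^sub>1\<^sup>2 + \<sigma>\<^sub>2\<^sup>2) * (\<integral>t. step_fun (p k) t * step_fun (q k) t \<partial>lebesgue_on {0..T}))
      \<longlonglongrightarrow> (\<integral>\<omega>. N \<omega> * N' \<omega> \<partial>M)"
    using l2lim_mult[OF p(3) q(3)] by (simp add: step_integral_\<xi>_inner[OF p(1) q(1)])
  moreover have "(\<lambda>k. (\<sigma>\<^sub>1\<^sup>2 + \<sigma>\<^sub>2\<^sup>2) * (\<integral>t. step_fun (p k) t * step_fun (q k) t \<partial>lebesgue_on {0..T}))
      \<longlonglongrightarrow> (\<sigma>\<^sub>1\<^sup>2 + \<sigma>\<^sub>2\<^sup>2) * (\<integral>t. f t * g t \<partial>lebesgue_on {0..T})"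
    by (intro tendsto_intros l2lim_mult[OF p(2) q(2)])
  ultimately show ?thesis by (rule LIMSEQ_unique)
qed

lemma noise_integral_mean:
  assumes "noise_integral T f N" shows "sqint M N" "(\<integral>\<omega>. N \<omega> \<partial>M) = 0"
proof -
  obtain p where p: "\<And>k. valid_steps T (p k)" "l2lim M (\<lambda>k \<omega>. step_integral (p k) (\<lambda>t. \<xi> t \<omega>)) N"
    using assms by (auto simp: noise_integral_def)
  show "sqint M N" using p(2) by (simp add: l2lim_def)
  have "(\<lambda>k. 0) \<longlonglongrightarrow> (\<integral>\<omega>. N \<omega> \<partial>M)"
    using l2lim_integral[OF finite_measure_axioms p(2)] by (simp add: step_integral_mean[OF p(1)])
  then show "(\<integral>\<omega>. N \<omega> \<partial>M) = 0" by (simp add: LIMSEQ_const_iff)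
qed

lemma step_integral_cauchy_limit:
  assumes p: "\<And>k. valid_steps T (p k)" and l: "l2lim (lebesgue_on {0..T}) (\<lambda>k. step_fun (p k)) f"
  shows "\<exists>N. l2lim M (\<lambda>k \<omega>. step_integral (p k) (\<lambda>t. \<xi> t \<omega>)) N"
proof (rule l2_complete)
  let ?s = "\<sigma>\<^sub>1\<^sup>2 + \<sigma>\<^sub>2\<^sup>2"
  show "sqint M (\<lambda>\<omega>. step_integral (p k) (\<lambda>t. \<xi> t \<omega>))" for k by (rule sqint_step_integral_\<xi>[OF p])
  fix e :: real assume e: "e > 0"
  \<comment> \<open>Dividing by \<open>?s + 1\<close> avoids a separate case for
    \<open>?s = 0\<close>.\<close>
  have s: "0 \<le> ?s" "0 < ?s + 1" using zero_le_power2[of \<sigma>\<^sub>1] zero_le_power2[of \<sigma>\<^sub>2] by linarith+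
  obtain N where N: "\<And>m n. m \<ge> N \<Longrightarrow> n \<ge> N \<Longrightarrow>
      (\<integral>t. (step_fun (p m) t - step_fun (p n) t)\<^sup>2 \<partial>lebesgue_on {0..T}) < e / (?s + 1)"
    using l2lim_cauchy[OF l divide_pos_pos[OF e s(2)]] by blast
  have "(\<integral>\<omega>. (step_integral (p m) (\<lambda>t. \<xi> t \<omega>) - step_integral (p n) (\<lambda>t. \<xi> t \<omega>))\<^sup>2 \<partial>M) < e"
    if "m \<ge> N" "n \<ge> N" for m n
  proof -
    have "?s * (\<integral>t. (step_fun (p m) t - step_fun (p n) t)\<^sup>2 \<partial>lebesgue_on {0..T}) \<le> ?s * (e / (?s + 1))"
      by (intro mult_left_mono less_imp_le[OF N[OF that]] s)
    also have "\<dots> < (?s + 1) * (e / (?s + 1))"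
      by (rule mult_strict_right_mono) (use divide_pos_pos[OF e s(2)] in auto)
    also have "\<dots> = e" using s(2) by simp
    finally show ?thesis by (simp add: step_integral_diff_square[OF p p])
  qed
  then show "\<exists>N. \<forall>m\<ge>N. \<forall>n\<ge>N. (\<integral>\<omega>. (step_integral (p m) (\<lambda>t. \<xi> t \<omega>) - step_integral (p n) (\<lambda>t. \<xi> t \<omega>))\<^sup>2 \<partial>M) < e"
    by blast
qed

text \<open>With \<open>W\<close> held at \<open>y\<close>, the quotient at \<open>y\<close> may be
  subtracted because every \<open>V j\<close> has mean zero; the integrand is then nonnegative
  pointwise. Holding \<open>W\<close> fixed requires genuine independence, hence
  \<open>jump_fun\<close> and not \<open>jump_approx\<close>.\<close>

lemma jump_fun_monotone:
  fixes U :: "nat \<Rightarrow> 'a \<Rightarrow> real" and W :: "nat \<Rightarrow> 'a \<Rightarrow> real"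
  assumes eps: "\<epsilon> > 0" and J: "finite J" and V: "\<And>j. j \<in> J \<Longrightarrow> jump_fun (V j)"
    and W: "\<And>j. j \<in> J \<Longrightarrow> W j \<in> borel_measurable bm_sigma"
  shows "0 \<le> (\<integral>\<omega>. (\<Sum>j\<in>J. V j \<omega> * ((W j \<omega> + V j \<omega>) / smooth_norm \<epsilon> J (\<lambda>l. W l \<omega> + V l \<omega>))) \<partial>M)"
proof -
  let ?T = "Pi\<^sub>M J (\<lambda>_. borel :: real measure)"
  have sV: "sqint M (V j)" "integrable M (V j)" "(\<integral>\<omega>. V j \<omega> \<partial>M) = 0" if "j \<in> J" for j
    using V[OF that] by (auto simp: jump_fun_def sqint_integrable[OF finite_measure_axioms])
  have ind: "indep_var ?T (\<lambda>\<omega>. \<lambda>j\<in>J. V j \<omega>) ?T (\<lambda>\<omega>. \<lambda>j\<in>J. W j \<omega>)"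
    using V W by (intro indep_var_bm_jump measurable_restrict) (auto simp: jump_fun_def)
  have mV: "V j \<in> borel_measurable M" and mW: "W j \<in> borel_measurable M" if "j \<in> J" for j
    using measurable_compose[OF indep_var_rv1[OF ind] measurable_component_singleton[OF that]]
      measurable_compose[OF indep_var_rv2[OF ind] measurable_component_singleton[OF that]] that by simp_all
  define h where "h = (\<lambda>(v, y). \<Sum>j\<in>J. v j * ((y j + v j) / smooth_norm \<epsilon> J (\<lambda>l. y l + v l)))"
  have cong: "smooth_norm \<epsilon> J f = smooth_norm \<epsilon> J f'" if "\<And>l. l \<in> J \<Longrightarrow> f l = f' l" for f f' :: "nat \<Rightarrow> real"
    using that by (auto simp: smooth_norm_def cong: sum.cong)
  have h: "h (\<lambda>j\<in>J. V j \<omega>, y) = (\<Sum>j\<in>J. V j \<omega> * ((y j + V j \<omega>) / smooth_norm \<epsilon> J (\<lambda>l. y l + V l \<omega>)))" for \<omega> y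
    using cong[of "\<lambda>l. y l + (if l \<in> J then V l \<omega> else undefined)" "\<lambda>l. y l + V l \<omega>"] by (simp add: h_def)
  have hW: "h (\<lambda>j\<in>J. V j \<omega>, \<lambda>j\<in>J. W j \<omega>) = (\<Sum>j\<in>J. V j \<omega> * ((W j \<omega> + V j \<omega>) / smooth_norm \<epsilon> J (\<lambda>l. W l \<omega> + V l \<omega>)))" for \<omega>
    unfolding h using cong[of "\<lambda>l. (if l \<in> J then W l \<omega> else undefined) + V l \<omega>" "\<lambda>l. W l \<omega> + V l \<omega>"] by simp
  have my: "l \<in> J \<Longrightarrow> (\<lambda>p. snd p l) \<in> borel_measurable (?T \<Otimes>\<^sub>M ?T)"
    and mz: "l \<in> J \<Longrightarrow> (\<lambda>p. fst p l) \<in> borel_measurable (?T \<Otimes>\<^sub>M ?T)" for l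
    by (rule measurable_compose[OF measurable_snd measurable_component_singleton], simp)
       (rule measurable_compose[OF measurable_fst measurable_component_singleton], simp)
  have mh: "h \<in> borel_measurable (?T \<Otimes>\<^sub>M ?T)"
    unfolding h_def case_prod_beta
    by (intro borel_measurable_sum borel_measurable_times borel_measurable_divide borel_measurable_add
        borel_measurable_smooth_norm my mz)
  have int: "integrable M (\<lambda>\<omega>. \<Sum>j\<in>J. V j \<omega> * (X \<omega> j / smooth_norm \<epsilon> J (X \<omega>)))"
    if "\<And>l. l \<in> J \<Longrightarrow> (\<lambda>\<omega>. X \<omega> l) \<in> borel_measurable M" for X
    by (intro Bochner_Integration.integrable_sum sqint_mult sV(1) sqint_smooth_quotient[OF eps J _ finite_measure_axioms] that)
  have "0 \<le> (\<integral>\<omega>. h (\<lambda>j\<in>J. V j \<omega>, \<lambda>j\<in>J. W j \<omega>) \<partial>M)"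
  proof (rule indep_var_integral_nonneg[OF ind mh])
    show "integrable M (\<lambda>\<omega>. h (\<lambda>j\<in>J. V j \<omega>, \<lambda>j\<in>J. W j \<omega>))"
      unfolding hW by (rule int) (intro borel_measurable_add mV mW)
    fix y
    have "0 = (\<Sum>j\<in>J. (\<integral>\<omega>. V j \<omega> \<partial>M) * (y j / smooth_norm \<epsilon> J y))" by (simp add: sV)
    also have "\<dots> = (\<integral>\<omega>. (\<Sum>j\<in>J. V j \<omega> * (y j / smooth_norm \<epsilon> J y)) \<partial>M)"
      using sV(2) by (subst Bochner_Integration.integral_sum) (auto intro!: integrable_mult_left sum.cong integrable_divide)
    also have "\<dots> \<le> (\<integral>\<omega>. (\<Sum>j\<in>J. V j \<omega> * ((y j + V j \<omega>) / smooth_norm \<epsilon> J (\<lambda>l. y l + V l \<omega>))) \<partial>M)"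
    proof (rule integral_mono)
      show "integrable M (\<lambda>\<omega>. \<Sum>j\<in>J. V j \<omega> * (y j / smooth_norm \<epsilon> J y))"
        by (rule int) simp
      show "integrable M (\<lambda>\<omega>. \<Sum>j\<in>J. V j \<omega> * ((y j + V j \<omega>) / smooth_norm \<epsilon> J (\<lambda>l. y l + V l \<omega>)))"
        by (rule int) (intro borel_measurable_add mV borel_measurable_const)
      fix \<omega>
      show "(\<Sum>j\<in>J. V j \<omega> * (y j / smooth_norm \<epsilon> J y)) \<le>
         (\<Sum>j\<in>J. V j \<omega> * ((y j + V j \<omega>) / smooth_norm \<epsilon> J (\<lambda>l. y l + V l \<omega>)))"
      proof -
        have "(\<Sum>j\<in>J. V j \<omega> * ((y j + V j \<omega>) / smooth_norm \<epsilon> J (\<lambda>l. y l + V l \<omega>))) -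
           (\<Sum>j\<in>J. V j \<omega> * (y j / smooth_norm \<epsilon> J y)) =
           (\<Sum>j\<in>J. ((y j + V j \<omega>) / smooth_norm \<epsilon> J (\<lambda>l. y l + V l \<omega>) - y j / smooth_norm \<epsilon> J y) * (y j + V j \<omega> - y j))"
          unfolding sum_subtractf[symmetric]
          by (intro sum.cong refl) (simp only: right_diff_distrib[symmetric] add_diff_cancel_left' mult.commute)
        with smooth_quotient_monotone[OF eps J, of "\<lambda>l. y l + V l \<omega>" y] show ?thesis by linarith
      qed
    qed
    finally show "0 \<le> (\<integral>\<omega>. h (\<lambda>j\<in>J. V j \<omega>, y) \<partial>M)" unfolding h .
  qed
  then show ?thesis unfolding hW .
qed

end

section \<open>Passage to the mean square limit\<close>

lemma step_integral_linear:
  "step_integral p (\<lambda>t. c * x t + d * y t) = c * step_integral p x + d * step_integral p y"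
  by (induction p) (auto simp: step_integral_def algebra_simps)

lemma step_integral_add:
  "step_integral p (\<lambda>t. x t + y t) = step_integral p x + step_integral p y"
  using step_integral_linear[of p 1 x 1 y] by simp

context levy_noise
begin

lemma jump_approx_close:
  assumes "jump_approx X" "e > 0"
  obtains V where "jump_fun V" "(\<integral>\<omega>. (X \<omega> - V \<omega>)\<^sup>2 \<partial>M) < e"
proof -
  obtain V where V: "\<And>k. jump_fun (V k)" "l2lim M V X" using assms(1) by (auto simp: jump_approx_def)
  have "\<forall>\<^sub>F k in sequentially. (\<integral>\<omega>. (V k \<omega> - X \<omega>)\<^sup>2 \<partial>M) < e"
    using V(2) assms(2) by (intro order_tendstoD(2)[of _ 0]) (auto simp: l2lim_def)
  then obtain k where "(\<integral>\<omega>. (V k \<omega> - X \<omega>)\<^sup>2 \<partial>M) < e" by (auto simp: eventually_sequentially)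
  with V(1)[of k] show thesis by (intro that[of "V k"]) (simp_all add: power2_commute)
qed

lemma bm_grid_increments:
  assumes T: "T > 0" and m: "m > 0"
  defines "\<zeta> \<equiv> \<lambda>i \<omega>. w (grid T m (Suc i)) \<omega> - w (grid T m i) \<omega>"
  shows "indep_vars (\<lambda>_. borel) \<zeta> {..<m}"
    and "i < m \<Longrightarrow> distributed M lborel (\<zeta> i) (normal_density 0 (sqrt (T / m)))"
    and "i < m \<Longrightarrow> \<zeta> i \<in> borel_measurable bm_sigma"
proof -
  show "indep_vars (\<lambda>_. borel) \<zeta> {..<m}"
    unfolding \<zeta>_def
  proof (rule bm_indep[OF bm])
    show "0 \<le> grid T m 0" by (simp add: grid_def)
    show "incseq (grid T m)"
      by (rule incseq_SucI) (use T in \<open>auto simp: grid_def intro!: divide_right_mono mult_left_mono\<close>)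
  qed
  assume i: "i < m"
  have g: "0 \<le> grid T m i" "0 \<le> grid T m (Suc i)" using grid_bounds(1)[OF T] i by auto
  have d: "grid T m (Suc i) - grid T m i = T / real m"
    by (simp add: grid_def distrib_left add_divide_distrib)
  moreover have "0 < T / real m" using T m by simp
  ultimately have "grid T m i < grid T m (Suc i)" by linarith
  from bm_increment[OF bm g(1) this]
  show "distributed M lborel (\<zeta> i) (normal_density 0 (sqrt (T / m)))"
    unfolding \<zeta>_def d .
  show "\<zeta> i \<in> borel_measurable bm_sigma"
    unfolding \<zeta>_def by (intro borel_measurable_diff bm_sigma_measurable g)
qed

text \<open>The bound for approximants. The tangent bound has replaced the expected inverse norm by
  second moments, and covariances appear as integrals of step functions, so both sides converge when
  the coordinates and the steps converge in mean square.\<close>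

lemma grid_noise_stein:
  fixes g :: "nat \<Rightarrow> real \<Rightarrow> real" and b :: "nat \<Rightarrow> real" and V :: "nat \<Rightarrow> 'a \<Rightarrow> real"
  assumes T: "T > 0" and m: "m > 0" and eps: "\<epsilon> > 0" and R: "R > 0" and J: "finite J" "J \<noteq> {}"
    and V: "\<And>j. j \<in> J \<Longrightarrow> jump_fun (V j)"
  defines "N \<equiv> \<lambda>j \<omega>. \<sigma>\<^sub>1 * step_integral (grid_list T m (g j)) (\<lambda>t. w t \<omega>) + V j \<omega>"
  defines "X \<equiv> \<lambda>j \<omega>. b j + N j \<omega>"
  shows "\<sigma>\<^sub>1\<^sup>2 * T * (real (card J) - 1) * (3 / (2 * R) - (\<epsilon>\<^sup>2 + (\<Sum>j\<in>J. \<integral>\<omega>. (X j \<omega>)\<^sup>2 \<partial>M)) / (2 * R^3)) -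
      2 / \<epsilon> * (\<Sum>j\<in>J. \<Sum>l\<in>J. \<bar>\<sigma>\<^sub>1\<^sup>2 * (\<integral>t. step_fun (grid_list T m (g j)) t * step_fun (grid_list T m (g l)) t \<partial>lebesgue_on {0..T})
         - (if j = l then \<sigma>\<^sub>1\<^sup>2 * T else 0)\<bar>)
    \<le> (\<Sum>j\<in>J. \<integral>\<omega>. N j \<omega> * (X j \<omega> / smooth_norm \<epsilon> J (\<lambda>l. X l \<omega>)) \<partial>M)"
proof -
  define \<zeta> where "\<zeta> i \<omega> = w (grid T m (Suc i)) \<omega> - w (grid T m i) \<omega>" for i \<omega>
  note \<zeta> = bm_grid_increments[OF T m, folded \<zeta>_def]
  define a where "a l i = \<sigma>\<^sub>1 * g l (grid T m i)" for l i
  define G where "G \<omega> l = (\<Sum>i<m. a l i * \<zeta> i \<omega>)" for \<omega> l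
  \<comment> \<open>Everything independent of the Brownian motion: the signal and the jumps.\<close>
  define U where "U l \<omega> = b l + V l \<omega>" for l \<omega>
  let ?\<kappa> = "\<sigma>\<^sub>1\<^sup>2 * T"
  have G: "\<sigma>\<^sub>1 * step_integral (grid_list T m (g l)) (\<lambda>t. w t \<omega>) = G \<omega> l" for l \<omega>
    by (simp add: step_integral_grid_list G_def a_def \<zeta>_def sum_distrib_left mult.assoc)
  have N: "N j \<omega> = G \<omega> j + V j \<omega>" for j \<omega> by (simp add: N_def G)
  have X: "X j \<omega> = G \<omega> j + U j \<omega>" for j \<omega> by (simp add: X_def N U_def)
  have ind: "indep_var (Pi\<^sub>M {..<m} (\<lambda>_. borel)) (\<lambda>\<omega>. \<lambda>i\<in>{..<m}. \<zeta> i \<omega>) (Pi\<^sub>M J (\<lambda>_. borel)) (\<lambda>\<omega>. \<lambda>l\<in>J. U l \<omega>)"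
  proof (intro indep_var_bm_jump(1) measurable_restrict)
    show "\<zeta> i \<in> borel_measurable bm_sigma" if "i \<in> {..<m}" for i using \<zeta>(3)[of i] that by (simp add: \<zeta>_def[abs_def])
    show "U l \<in> borel_measurable jump_sigma" if "l \<in> J" for l
      unfolding U_def[abs_def] using V[OF that] by (intro borel_measurable_add borel_measurable_const) (simp add: jump_fun_def)
  qed
  have indz: "indep_vars (\<lambda>_. borel) \<zeta> {..<m}" using \<zeta>(1) by (simp add: \<zeta>_def[abs_def])
  have dz: "distributed M lborel (\<zeta> i) (normal_density 0 (sqrt (T / m)))" if "i < m" for i
    using \<zeta>(2)[OF that] by (simp add: \<zeta>_def[abs_def])
  have mG: "(\<lambda>\<omega>. G \<omega> l) \<in> borel_measurable bm_sigma" for l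
    unfolding G_def using \<zeta>(3) by (intro borel_measurable_sum borel_measurable_times borel_measurable_const) (simp add: \<zeta>_def[abs_def])
  have sV: "sqint M (V j)" if "j \<in> J" for j using V[OF that] by (simp add: jump_fun_def)
  have sG: "sqint M (\<lambda>\<omega>. G \<omega> j)" for j
    unfolding G[symmetric]
    by (intro sqint_cmult sqint_step_integral[of T] valid_grid_list T) (use bm_moments(1)[OF bm] in auto)
  have sX: "sqint M (X j)" if "j \<in> J" for j
    unfolding X_def[abs_def] N by (intro sqint_add sqint_const finite_measure_axioms sG sV that)
  have mX: "X j \<in> borel_measurable M" if "j \<in> J" for j using sX[OF that] by (simp add: sqint_def)
  have sY: "sqint M (\<lambda>\<omega>. X j \<omega> / smooth_norm \<epsilon> J (\<lambda>l. X l \<omega>))" if "j \<in> J" for j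
    by (rule sqint_smooth_quotient[OF eps J(1) that finite_measure_axioms mX])
  have st: "?\<kappa> * (real (card J) - 1) * (\<integral>\<omega>. 1 / smooth_norm \<epsilon> J (\<lambda>l. X l \<omega>) \<partial>M) -
      2 / \<epsilon> * (\<Sum>j\<in>J. \<Sum>l\<in>J. \<bar>(sqrt (T / m))\<^sup>2 * (\<Sum>i<m. a j i * a l i) - (if j = l then ?\<kappa> else 0)\<bar>)
    \<le> (\<integral>\<omega>. (\<Sum>j\<in>J. G \<omega> j * (X j \<omega> / smooth_norm \<epsilon> J (\<lambda>l. X l \<omega>))) \<partial>M)"
    unfolding X G_def
    by (rule stein_gaussian_lower[OF eps J(1) _ _ indz dz ind]) (use T m in auto)
  have C: "(sqrt (T / m))\<^sup>2 * (\<Sum>i<m. a j i * a l i) =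
     \<sigma>\<^sub>1\<^sup>2 * (\<integral>t. step_fun (grid_list T m (g j)) t * step_fun (grid_list T m (g l)) t \<partial>lebesgue_on {0..T})" for j l
  proof -
    have "(\<Sum>i<m. a j i * a l i) = \<sigma>\<^sub>1\<^sup>2 * (\<Sum>i<m. g j (grid T m i) * g l (grid T m i))"
      unfolding a_def sum_distrib_left by (intro sum.cong refl) (simp add: power2_eq_square mult_ac)
    then show ?thesis using T m by (simp add: integral_grid_list_mult[OF T m])
  qed
  have i: "integrable M (\<lambda>\<omega>. \<Sum>j\<in>J. (X j \<omega>)\<^sup>2)"
    by (intro Bochner_Integration.integrable_sum sqint_square sX)
  have "3 / (2 * R) - (\<epsilon>\<^sup>2 + (\<Sum>j\<in>J. \<integral>\<omega>. (X j \<omega>)\<^sup>2 \<partial>M)) / (2 * R^3) =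
      (\<integral>\<omega>. 3 / (2 * R) - (1 / (2 * R^3)) * (\<epsilon>\<^sup>2 + (\<Sum>j\<in>J. (X j \<omega>)\<^sup>2)) \<partial>M)"
  proof -
    have "(\<integral>\<omega>. 3 / (2 * R) - (1 / (2 * R^3)) * (\<epsilon>\<^sup>2 + (\<Sum>j\<in>J. (X j \<omega>)\<^sup>2)) \<partial>M) =
      (\<integral>\<omega>. 3 / (2 * R) \<partial>M) - (\<integral>\<omega>. (1 / (2 * R^3)) * (\<epsilon>\<^sup>2 + (\<Sum>j\<in>J. (X j \<omega>)\<^sup>2)) \<partial>M)"
      using i by (intro Bochner_Integration.integral_diff integrable_mult_right Bochner_Integration.integrable_add) auto
    also have "(\<integral>\<omega>. (1 / (2 * R^3)) * (\<epsilon>\<^sup>2 + (\<Sum>j\<in>J. (X j \<omega>)\<^sup>2)) \<partial>M) =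
       (1 / (2 * R^3)) * ((\<integral>\<omega>. \<epsilon>\<^sup>2 \<partial>M) + (\<integral>\<omega>. (\<Sum>j\<in>J. (X j \<omega>)\<^sup>2) \<partial>M))"
      unfolding integral_mult_right_zero
      by (rule arg_cong[where f = "\<lambda>x. 1 / (2 * R^3) * x"], rule Bochner_Integration.integral_add) (use i in auto)
    also have "(\<integral>\<omega>. (\<Sum>j\<in>J. (X j \<omega>)\<^sup>2) \<partial>M) = (\<Sum>j\<in>J. \<integral>\<omega>. (X j \<omega>)\<^sup>2 \<partial>M)"
      by (rule Bochner_Integration.integral_sum) (intro sqint_square sX)
    finally show ?thesis by (simp add: prob_space)
  qed
  also have "\<dots> \<le> (\<integral>\<omega>. 1 / smooth_norm \<epsilon> J (\<lambda>l. X l \<omega>) \<partial>M)"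
  proof (rule integral_mono)
    show "integrable M (\<lambda>\<omega>. 3 / (2 * R) - (1 / (2 * R^3)) * (\<epsilon>\<^sup>2 + (\<Sum>j\<in>J. (X j \<omega>)\<^sup>2)))"
      using i by (intro Bochner_Integration.integrable_diff integrable_mult_right Bochner_Integration.integrable_add) auto
    show "integrable M (\<lambda>\<omega>. 1 / smooth_norm \<epsilon> J (\<lambda>l. X l \<omega>))"
      by (rule integrable_inverse_smooth_norm[OF eps J(1) finite_measure_axioms mX])
    fix \<omega>
    show "3 / (2 * R) - (1 / (2 * R^3)) * (\<epsilon>\<^sup>2 + (\<Sum>j\<in>J. (X j \<omega>)\<^sup>2)) \<le> 1 / smooth_norm \<epsilon> J (\<lambda>l. X l \<omega>)"
      using inverse_ge_tangent[OF smooth_norm_pos[OF eps J(1), of "\<lambda>l. X l \<omega>"] R]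
      by (simp add: smooth_norm_sq[OF eps J(1)])
  qed
  finally have E: "3 / (2 * R) - (\<epsilon>\<^sup>2 + (\<Sum>j\<in>J. \<integral>\<omega>. (X j \<omega>)\<^sup>2 \<partial>M)) / (2 * R^3) \<le> (\<integral>\<omega>. 1 / smooth_norm \<epsilon> J (\<lambda>l. X l \<omega>) \<partial>M)" .
  \<comment> \<open>Keeps the factor \<open>card J - 1\<close> nonnegative, so that the lower bound
    for the expected inverse norm may be multiplied by it.\<close>
  have "1 \<le> card J" using J by (simp add: Suc_leI card_gt_0_iff)
  then have "0 \<le> ?\<kappa> * (real (card J) - 1)" using T by simp
  from mult_left_mono[OF E this] st
  have 1: "?\<kappa> * (real (card J) - 1) * (3 / (2 * R) - (\<epsilon>\<^sup>2 + (\<Sum>j\<in>J. \<integral>\<omega>. (X j \<omega>)\<^sup>2 \<partial>M)) / (2 * R^3)) -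
      2 / \<epsilon> * (\<Sum>j\<in>J. \<Sum>l\<in>J. \<bar>(sqrt (T / m))\<^sup>2 * (\<Sum>i<m. a j i * a l i) - (if j = l then ?\<kappa> else 0)\<bar>)
    \<le> (\<integral>\<omega>. (\<Sum>j\<in>J. G \<omega> j * (X j \<omega> / smooth_norm \<epsilon> J (\<lambda>l. X l \<omega>))) \<partial>M)"
    by linarith
  \<comment> \<open>The Brownian part shifted by the signal is the variable held fixed.\<close>
  have 2: "0 \<le> (\<integral>\<omega>. (\<Sum>j\<in>J. V j \<omega> * (X j \<omega> / smooth_norm \<epsilon> J (\<lambda>l. X l \<omega>))) \<partial>M)"
  proof -
    have "X j \<omega> = (b j + G \<omega> j) + V j \<omega>" for j \<omega> by (simp add: X_def N)
    then show ?thesis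
      using jump_fun_monotone[OF eps J(1) V, where W = "\<lambda>j \<omega>. b j + G \<omega> j"] mG by simp
  qed
  have "(\<Sum>j\<in>J. \<integral>\<omega>. N j \<omega> * (X j \<omega> / smooth_norm \<epsilon> J (\<lambda>l. X l \<omega>)) \<partial>M) =
     (\<Sum>j\<in>J. (\<integral>\<omega>. G \<omega> j * (X j \<omega> / smooth_norm \<epsilon> J (\<lambda>l. X l \<omega>)) \<partial>M) + (\<integral>\<omega>. V j \<omega> * (X j \<omega> / smooth_norm \<epsilon> J (\<lambda>l. X l \<omega>)) \<partial>M))"
  proof (intro sum.cong refl)
    fix j assume j: "j \<in> J"
    show "(\<integral>\<omega>. N j \<omega> * (X j \<omega> / smooth_norm \<epsilon> J (\<lambda>l. X l \<omega>)) \<partial>M) =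
      (\<integral>\<omega>. G \<omega> j * (X j \<omega> / smooth_norm \<epsilon> J (\<lambda>l. X l \<omega>)) \<partial>M) + (\<integral>\<omega>. V j \<omega> * (X j \<omega> / smooth_norm \<epsilon> J (\<lambda>l. X l \<omega>)) \<partial>M)"
      unfolding N distrib_right
      by (rule Bochner_Integration.integral_add[OF sqint_mult[OF sG sY[OF j]] sqint_mult[OF sV[OF j] sY[OF j]]])
  qed
  also have "\<dots> = (\<integral>\<omega>. (\<Sum>j\<in>J. G \<omega> j * (X j \<omega> / smooth_norm \<epsilon> J (\<lambda>l. X l \<omega>))) \<partial>M) +
      (\<integral>\<omega>. (\<Sum>j\<in>J. V j \<omega> * (X j \<omega> / smooth_norm \<epsilon> J (\<lambda>l. X l \<omega>))) \<partial>M)"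
    unfolding sum.distrib
    by (intro arg_cong2[where f = "(+)"] Bochner_Integration.integral_sum[symmetric] sqint_mult sG sV sY)
  finally show ?thesis using 1 2 unfolding C by linarith
qed

text \<open>In the limit the Gram matrix is \<open>T\<close> times the identity, so the error term
  disappears, and the isometry evaluates the second moments.\<close>

lemma noise_stein:
  fixes f :: "nat \<Rightarrow> real \<Rightarrow> real" and b :: "nat \<Rightarrow> real" and N :: "nat \<Rightarrow> 'a \<Rightarrow> real"
  assumes T: "T > 0" and eps: "\<epsilon> > 0" and R: "R > 0" and J: "finite J" "J \<noteq> {}"
    and f: "\<And>j. j \<in> J \<Longrightarrow> f j \<in> borel_measurable (lebesgue_on {0..T})"
    and B: "\<And>j t. j \<in> J \<Longrightarrow> t \<in> {0..T} \<Longrightarrow> \<bar>f j t\<bar> \<le> B"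
    and gram: "\<And>j l. j \<in> J \<Longrightarrow> l \<in> J \<Longrightarrow> (\<integral>t. f j t * f l t \<partial>lebesgue_on {0..T}) = (if j = l then T else 0)"
    and N: "\<And>j. j \<in> J \<Longrightarrow> noise_integral T (f j) (N j)"
    and R2: "\<epsilon>\<^sup>2 + (\<Sum>j\<in>J. (b j)\<^sup>2) + real (card J) * ((\<sigma>\<^sub>1\<^sup>2 + \<sigma>\<^sub>2\<^sup>2) * T) \<le> R\<^sup>2"
  shows "\<sigma>\<^sub>1\<^sup>2 * T * (real (card J) - 1) / R \<le>
    (\<Sum>j\<in>J. \<integral>\<omega>. N j \<omega> * ((b j + N j \<omega>) / smooth_norm \<epsilon> J (\<lambda>l. b l + N l \<omega>)) \<partial>M)"
proof -
  let ?K = "lebesgue_on {0..T}" and ?\<kappa> = "\<sigma>\<^sub>1\<^sup>2 * T"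
  obtain m g where m: "\<And>k. m k > 0"
    and g: "\<And>j. j \<in> J \<Longrightarrow> l2lim ?K (\<lambda>k. step_fun (grid_list T (m k) (g j k))) (f j)"
    by (rule grid_l2_approx[OF T J(1) f B]) (assumption+, rule that)
  define q where "q j k = grid_list T (m k) (g j k)" for j k
  have q: "valid_steps T (q j k)" for j k unfolding q_def by (rule valid_grid_list[OF T])
  have I: "l2lim M (\<lambda>k \<omega>. step_integral (q j k) (\<lambda>t. \<xi> t \<omega>)) (N j)" if "j \<in> J" for j
    using g[OF that] by (intro noise_integral_l2lim[OF N[OF that] q]) (simp add: q_def)
  \<comment> \<open>Step integrals of \<open>z\<close> may lack measurability for the jump
    sigma-algebra, as \<open>z\<close> itself may. Nearby variables that have it take their place,
    at a distance that vanishes in the limit.\<close>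
  have "\<exists>V. jump_fun V \<and> (\<integral>\<omega>. (\<sigma>\<^sub>2 * step_integral (q j k) (\<lambda>t. z t \<omega>) - V \<omega>)\<^sup>2 \<partial>M) < 1 / real (Suc k)" for j k
    by (rule jump_approx_close[OF jump_approx_cmult[OF step_integral_jump_approx[OF q]], of "1 / real (Suc k)" \<sigma>\<^sub>2 j k]) auto
  then obtain V where V: "\<And>j k. jump_fun (V j k)"
    "\<And>j k. (\<integral>\<omega>. (\<sigma>\<^sub>2 * step_integral (q j k) (\<lambda>t. z t \<omega>) - V j k \<omega>)\<^sup>2 \<partial>M) < 1 / real (Suc k)"
    by metis
  define NN where "NN j k \<omega> = \<sigma>\<^sub>1 * step_integral (q j k) (\<lambda>t. w t \<omega>) + V j k \<omega>" for j k \<omega>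
  have sNN: "sqint M (NN j k)" for j k
    unfolding NN_def[abs_def] using V(1)[of j k] bm_moments(1)[OF bm]
    by (intro sqint_add sqint_cmult sqint_step_integral[OF _ q]) (auto simp: jump_fun_def)
  have NN: "l2lim M (NN j) (N j)" if "j \<in> J" for j
  proof (rule l2lim_perturb[OF I[OF that] sNN])
    show "(\<lambda>k. \<integral>\<omega>. (step_integral (q j k) (\<lambda>t. \<xi> t \<omega>) - NN j k \<omega>)\<^sup>2 \<partial>M) \<longlonglongrightarrow> 0"
    proof (rule tendsto_sandwich[OF _ _ tendsto_const LIMSEQ_Suc[OF lim_inverse_n']])
      show "\<forall>\<^sub>F k in sequentially. (\<integral>\<omega>. (step_integral (q j k) (\<lambda>t. \<xi> t \<omega>) - NN j k \<omega>)\<^sup>2 \<partial>M) \<le> 1 / real (Suc k)"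
        using V(2)[of j] by (intro always_eventually allI) (simp add: NN_def \<xi>_def step_integral_linear less_imp_le)
    qed auto
  qed
  define X where "X j k \<omega> = b j + NN j k \<omega>" for j k \<omega>
  have X: "l2lim M (X j) (\<lambda>\<omega>. b j + N j \<omega>)" if "j \<in> J" for j
    unfolding X_def[abs_def] by (intro l2lim_add NN[OF that] l2lim_const sqint_const finite_measure_axioms)
  define err where "err k = (\<Sum>j\<in>J. \<Sum>l\<in>J. \<bar>\<sigma>\<^sub>1\<^sup>2 * (\<integral>t. step_fun (q j k) t * step_fun (q l k) t \<partial>?K)
         - (if j = l then ?\<kappa> else 0)\<bar>)" for k
  have "err \<longlonglongrightarrow> (\<Sum>j\<in>J. \<Sum>l\<in>J. \<bar>\<sigma>\<^sub>1\<^sup>2 * (\<integral>t. f j t * f l t \<partial>?K) - (if j = l then ?\<kappa> else 0)\<bar>)"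
    unfolding err_def[abs_def] by (intro tendsto_intros l2lim_mult) (simp_all add: q_def g)
  also have "(\<Sum>j\<in>J. \<Sum>l\<in>J. \<bar>\<sigma>\<^sub>1\<^sup>2 * (\<integral>t. f j t * f l t \<partial>?K) - (if j = l then ?\<kappa> else 0)\<bar>) = 0"
    by (intro sum.neutral ballI) (simp add: gram)
  finally have err: "err \<longlonglongrightarrow> 0" .
  have sN: "sqint M (N j)" "(\<integral>\<omega>. N j \<omega> \<partial>M) = 0" if "j \<in> J" for j
    using noise_integral_mean[OF N[OF that]] by auto
  have EX: "(\<integral>\<omega>. (b j + N j \<omega>)\<^sup>2 \<partial>M) = (b j)\<^sup>2 + (\<sigma>\<^sub>1\<^sup>2 + \<sigma>\<^sub>2\<^sup>2) * T" if "j \<in> J" for j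
  proof -
    have i: "integrable M (N j)" "integrable M (\<lambda>\<omega>. N j \<omega> * N j \<omega>)"
      using sN[OF that] by (auto intro: sqint_integrable[OF finite_measure_axioms] sqint_mult)
    have "(\<integral>\<omega>. (b j + N j \<omega>)\<^sup>2 \<partial>M) = (\<integral>\<omega>. (b j)\<^sup>2 + (2 * b j) * N j \<omega> + N j \<omega> * N j \<omega> \<partial>M)"
      by (intro Bochner_Integration.integral_cong) (auto simp: power2_eq_square algebra_simps)
    also have "\<dots> = (b j)\<^sup>2 + (\<integral>\<omega>. N j \<omega> * N j \<omega> \<partial>M)"
      using i sN[OF that] by (simp add: prob_space)
    finally show ?thesis
      using noise_integral_inner[OF N[OF that] N[OF that]] gram[OF that that] by simp
  qed
  have rhs: "(\<lambda>k. ?\<kappa> * (real (card J) - 1) * (3 / (2 * R) - (\<epsilon>\<^sup>2 + (\<Sum>j\<in>J. \<integral>\<omega>. (X j k \<omega>)\<^sup>2 \<partial>M)) / (2 * R^3)) - 2 / \<epsilon> * err k)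
     \<longlonglongrightarrow> ?\<kappa> * (real (card J) - 1) * (3 / (2 * R) - (\<epsilon>\<^sup>2 + (\<Sum>j\<in>J. \<integral>\<omega>. (b j + N j \<omega>)\<^sup>2 \<partial>M)) / (2 * R^3)) - 2 / \<epsilon> * 0"
    using R by (intro tendsto_intros err l2lim_square X) auto
  have lhs: "(\<lambda>k. \<Sum>j\<in>J. \<integral>\<omega>. NN j k \<omega> * (X j k \<omega> / smooth_norm \<epsilon> J (\<lambda>l. X l k \<omega>)) \<partial>M) \<longlonglongrightarrow>
    (\<Sum>j\<in>J. \<integral>\<omega>. N j \<omega> * ((b j + N j \<omega>) / smooth_norm \<epsilon> J (\<lambda>l. b l + N l \<omega>)) \<partial>M)"
    by (intro tendsto_sum l2lim_mult NN l2lim_smooth_quotient[OF eps J(1) _ finite_measure_axioms, of _ X] X)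
  have le: "?\<kappa> * (real (card J) - 1) * (3 / (2 * R) - (\<epsilon>\<^sup>2 + (\<Sum>j\<in>J. \<integral>\<omega>. (X j k \<omega>)\<^sup>2 \<partial>M)) / (2 * R^3)) - 2 / \<epsilon> * err k
     \<le> (\<Sum>j\<in>J. \<integral>\<omega>. NN j k \<omega> * (X j k \<omega> / smooth_norm \<epsilon> J (\<lambda>l. X l k \<omega>)) \<partial>M)" for k
    unfolding X_def NN_def err_def q_def
    by (rule grid_noise_stein[OF T m[of k] eps R J, where V = "\<lambda>j. V j k" and g = "\<lambda>j. g j k" and b = b, OF V(1)])
  have "?\<kappa> * (real (card J) - 1) * (1 / R) \<le>
    ?\<kappa> * (real (card J) - 1) * (3 / (2 * R) - (\<epsilon>\<^sup>2 + (\<Sum>j\<in>J. \<integral>\<omega>. (b j + N j \<omega>)\<^sup>2 \<partial>M)) / (2 * R^3))"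
  proof (rule mult_left_mono)
    have "1 \<le> card J" using J by (simp add: Suc_leI card_gt_0_iff)
    then show "0 \<le> ?\<kappa> * (real (card J) - 1)" using T by simp
    have "\<epsilon>\<^sup>2 + (\<Sum>j\<in>J. \<integral>\<omega>. (b j + N j \<omega>)\<^sup>2 \<partial>M) \<le> R\<^sup>2"
      using R2 by (simp add: EX sum.distrib)
    then have "(\<epsilon>\<^sup>2 + (\<Sum>j\<in>J. \<integral>\<omega>. (b j + N j \<omega>)\<^sup>2 \<partial>M)) / (2 * R^3) \<le> R\<^sup>2 / (2 * R^3)"
      using R by (intro divide_right_mono) auto
    \<comment> \<open>At second moment \<open>R\<^sup>2\<close> the tangent touches, and its value
      there is exactly \<open>1 / R\<close>.\<close>
    also have "\<dots> = 3 / (2 * R) - 1 / R"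
      using R by (simp add: field_simps power2_eq_square power3_eq_cube)
    finally show "1 / R \<le> 3 / (2 * R) - (\<epsilon>\<^sup>2 + (\<Sum>j\<in>J. \<integral>\<omega>. (b j + N j \<omega>)\<^sup>2 \<partial>M)) / (2 * R^3)" by linarith
  qed
  also have "\<dots> \<le> (\<Sum>j\<in>J. \<integral>\<omega>. N j \<omega> * ((b j + N j \<omega>) / smooth_norm \<epsilon> J (\<lambda>l. b l + N l \<omega>)) \<partial>M)"
    using LIMSEQ_le[OF rhs lhs] le by simp
  finally show ?thesis by simp
qed

end

section \<open>Periodic signals, drift and paths\<close>

lemma one_periodic_nat:
  assumes "one_periodic f" shows "f (t + real i) = f t"
proof (induction i)
  case (Suc i)
  have "f (t + real (Suc i)) = f ((t + real i) + 1)" by (simp add: add_ac)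
  also have "\<dots> = f (t + real i)" using assms by (simp only: one_periodic_def)
  finally show ?case using Suc by simp
qed simp

lemma one_periodic_diff_nat: "one_periodic f \<Longrightarrow> f (t - real i) = f t"
  using one_periodic_nat[of f "t - real i" i] by simp

text \<open>Translates of the half-open unit interval tile \<open>{0<..n}\<close> without overlap,
  which closed intervals would not. \<open>has_bochner_integral\<close> carries integrability and
  value together.\<close>

lemma has_bochner_integral_lebesgue_on_Ioc_iff:
  fixes f :: "real \<Rightarrow> real"
  shows "has_bochner_integral (lebesgue_on {a..b}) f I \<longleftrightarrow>
    has_bochner_integral lebesgue (\<lambda>x. indicator {a<..b} x * f x) I"
proof (cases "a \<le> b")
  case True
  let ?g = "\<lambda>x. f a * indicator {a} x"
  have g: "has_bochner_integral lebesgue ?g 0"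
    using has_bochner_integral_mult_right[OF has_bochner_integral_real_indicator[of "{a}" lebesgue], of "f a"] by simp
  have eq: "indicator {a..b} x * f x = indicator {a<..b} x * f x + ?g x" for x
    using True by (auto simp: indicator_def)
  show ?thesis
    using has_bochner_integral_add[OF _ g, of "\<lambda>x. indicator {a<..b} x * f x" I]
      has_bochner_integral_diff[OF _ g, of "\<lambda>x. indicator {a..b} x * f x" I]
    by (auto simp: has_bochner_integral_restrict_space eq)
qed (simp add: has_bochner_integral_restrict_space)

lemma has_bochner_integral_periodic:
  fixes f :: "real \<Rightarrow> real"
  assumes p: "one_periodic f" and i: "has_bochner_integral (lebesgue_on {0..1}) f I"
  shows "has_bochner_integral (lebesgue_on {0..real n}) f (real n * I)"
proof -
  let ?F = "\<lambda>x. indicator {0<..1} x * f x"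
  have 1: "has_bochner_integral lebesgue (\<lambda>x. ?F (- real i + 1 * x)) I" for i
    using i has_bochner_integral_lebesgue_real_affine_iff[of 1 ?F I "- real i"]
    by (simp add: has_bochner_integral_lebesgue_on_Ioc_iff)
  have "has_bochner_integral lebesgue (\<lambda>x. \<Sum>i<n. ?F (- real i + 1 * x)) (\<Sum>i<n. I)"
    by (rule has_bochner_integral_sum) (rule 1)
  moreover have "(\<Sum>i<n. ?F (- real i + 1 * x)) = indicator {0<..real n} x * f x" for x
  proof -
    have "(\<Sum>i<n. ?F (- real i + 1 * x)) = (\<Sum>i<n. indicator {real i<..real i + 1} x) * f x"
      unfolding sum_distrib_right
    proof (rule sum.cong[OF refl])
      fix i
      show "?F (- real i + 1 * x) = indicator {real i<..real i + 1} x * f x"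
        using one_periodic_diff_nat[OF p, of x i] by (auto simp: indicator_def algebra_simps)
    qed
    also have "(\<Sum>i<n. indicator {real i<..real i + 1} x) = (indicator {0<..real n} x :: real)"
      by (induction n) (auto simp: indicator_def)
    finally show ?thesis .
  qed
  ultimately show ?thesis by (simp add: has_bochner_integral_lebesgue_on_Ioc_iff)
qed

lemma periodic_integral:
  assumes "one_periodic f" "integrable (lebesgue_on {0..1}) f"
  shows "integrable (lebesgue_on {0..real n}) f"
    "(\<integral>t. f t \<partial>lebesgue_on {0..real n}) = real n * (\<integral>t. f t \<partial>lebesgue_on {0..1})"
  using has_bochner_integral_periodic[OF assms(1) has_bochner_integral_integrable[OF assms(2)], of n]
  by (auto simp: has_bochner_integral_iff)

lemma periodic_sqint:
  assumes p: "one_periodic f" and s: "sqint (lebesgue_on {0..1}) f"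
  shows "sqint (lebesgue_on {0..real n}) f"
proof -
  have "integrable (lebesgue_on {0..1}) f"
    by (rule sqint_integrable[OF finite_measure_lebesgue_on_Icc s])
  from borel_measurable_integrable[OF periodic_integral(1)[OF p this]]
  have "f \<in> borel_measurable (lebesgue_on {0..real n})" .
  moreover have "one_periodic (\<lambda>t. (f t)\<^sup>2)" using p by (simp add: one_periodic_def)
  from periodic_integral(1)[OF this sqint_square[OF s]]
  have "integrable (lebesgue_on {0..real n}) (\<lambda>t. (f t)\<^sup>2)" .
  ultimately show ?thesis by (simp add: sqint_def)
qed

section \<open>The drift of the observed path\<close>

definition drift :: "(real \<Rightarrow> real) \<Rightarrow> real \<Rightarrow> real" where
  "drift S t = (\<integral>s. S s \<partial>lebesgue_on {0..t})"

text \<open>Continuity of the indefinite integral is taken over from the gauge integral, which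
  agrees with the Lebesgue integral here. It makes the observed path cadlag.\<close>

lemma drift_continuous:
  assumes "integrable (lebesgue_on {0..T}) S"
  shows "continuous_on {0..T} (drift S)"
proof -
  have "S integrable_on {0..T}" by (rule integrable_on_lebesgue_on[OF assms]) simp
  then have "continuous_on {0..T} (\<lambda>t. integral {0..t} S)" by (rule indefinite_integral_continuous_1)
  moreover have "integral {0..t} S = drift S t" if "t \<in> {0..T}" for t
  proof -
    have "integrable (lebesgue_on {0..t}) S"
      by (rule integrable_subinterval[OF assms]) (use that in auto)
    then show ?thesis by (simp add: drift_def lebesgue_integral_eq_integral)
  qed
  ultimately show ?thesis by (rule continuous_on_eq)
qed

lemma drift_increment:
  assumes S: "sqint (lebesgue_on {0..T}) S" and "0 \<le> s" "s \<le> u" "u \<le> T"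
  shows "drift S u - drift S s = (\<integral>t. indicator {s<..u} t * S t \<partial>lebesgue_on {0..T})"
proof -
  have i: "integrable lebesgue (\<lambda>x. indicator {a<..b} x * S x)" if "0 \<le> a" "b \<le> T" for a b
  proof -
    have "integrable (lebesgue_on {0..T}) S" by (rule sqint_integrable[OF finite_measure_lebesgue_on_Icc S])
    then have "integrable lebesgue (\<lambda>x. indicator {0..T} x * S x)" by (simp add: integrable_restrict_space)
    then have "integrable lebesgue (\<lambda>x. indicator {a<..b} x * (indicator {0..T} x * S x))"
      using integrable_mult_indicator[of "{a<..b}" lebesgue "\<lambda>x. indicator {0..T} x * S x"] by simp
    moreover have "indicator {a<..b} x * (indicator {0..T} x * S x) = indicator {a<..b} x * S x" for x
      using that by (auto simp: indicator_def)
    ultimately show ?thesis by simp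
  qed
  have d: "drift S t = (\<integral>x. indicator {0<..t} x * S x \<partial>lebesgue)" if "t \<le> T" for t
    unfolding drift_def
    by (rule has_bochner_integral_integral_eq, subst has_bochner_integral_lebesgue_on_Ioc_iff,
        rule has_bochner_integral_integrable, rule i) (use that in auto)
  have "(\<integral>t. indicator {s<..u} t * S t \<partial>lebesgue_on {0..T}) = (\<integral>x. indicator {0..T} x * (indicator {s<..u} x * S x) \<partial>lebesgue)"
    by (subst integral_restrict_space) auto
  also have "\<dots> = (\<integral>x. indicator {0<..u} x * S x - indicator {0<..s} x * S x \<partial>lebesgue)"
    using assms by (intro Bochner_Integration.integral_cong) (auto simp: indicator_def)
  also have "\<dots> = drift S u - drift S s"
    using assms by (subst Bochner_Integration.integral_diff) (auto simp: d i)
  finally show ?thesis ..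
qed

lemma step_integral_drift:
  assumes S: "sqint (lebesgue_on {0..T}) S" and p: "valid_steps T p"
  shows "step_integral p (drift S) = (\<integral>t. step_fun p t * S t \<partial>lebesgue_on {0..T})"
proof -
  have "(\<integral>t. (\<Sum>x\<leftarrow>p. case x of (a, s, u) \<Rightarrow> a * indicator {s<..u} t) * S t \<partial>lebesgue_on {0..T}) =
     (\<Sum>x\<leftarrow>p. \<integral>t. (case x of (a, s, u) \<Rightarrow> a * indicator {s<..u} t) * S t \<partial>lebesgue_on {0..T})"
  proof (rule integral_sum_list_mult[OF _ S])
    fix x
    show "sqint (lebesgue_on {0..T}) (\<lambda>t. case x of (a, s, u) \<Rightarrow> a * indicator {s<..u} t)"
      using sqint_step_fun[of 0 T "[x]"] by (simp add: step_fun_def[abs_def])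
  qed
  also have "\<dots> = (\<Sum>x\<leftarrow>p. case x of (a, s, u) \<Rightarrow> a * (drift S u - drift S s))"
  proof (rule arg_cong[where f = sum_list], rule map_cong[OF refl])
    fix x assume "x \<in> set p"
    moreover obtain a s u where x: "x = (a, s, u)" by (cases x)
    ultimately have b: "0 \<le> s" "s \<le> u" "u \<le> T" using p by (auto simp: valid_steps_def)
    show "(\<integral>t. (case x of (a, s, u) \<Rightarrow> a * indicator {s<..u} t) * S t \<partial>lebesgue_on {0..T}) =
       (case x of (a, s, u) \<Rightarrow> a * (drift S u - drift S s))"
      by (simp add: x drift_increment[OF S b] mult.assoc)
  qed
  finally show ?thesis by (simp add: step_integral_def step_fun_def)
qed

section \<open>Cadlag paths and measurability into path space\<close>

lemma cadlag_on_add: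
  assumes "cadlag_on I f" "cadlag_on I g" shows "cadlag_on I (\<lambda>t. f t + g t)"
  unfolding cadlag_on_def
proof (intro conjI ballI)
  fix t assume t: "t \<in> I"
  show "((\<lambda>t. f t + g t) \<longlongrightarrow> f t + g t) (at t within (I \<inter> {t<..}))"
    using assms t by (intro tendsto_add) (auto simp: cadlag_on_def)
  obtain l l' where "(f \<longlongrightarrow> l) (at t within (I \<inter> {..<t}))" "(g \<longlongrightarrow> l') (at t within (I \<inter> {..<t}))"
    using assms t unfolding cadlag_on_def by meson
  then show "\<exists>l. ((\<lambda>t. f t + g t) \<longlongrightarrow> l) (at t within (I \<inter> {..<t}))"
    by (intro exI[of _ "l + l'"] tendsto_add)
qed

lemma cadlag_on_cmult:
  assumes "cadlag_on I f" shows "cadlag_on I (\<lambda>t. c * f t)"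
  unfolding cadlag_on_def
proof (intro conjI ballI)
  fix t assume t: "t \<in> I"
  show "((\<lambda>t. c * f t) \<longlongrightarrow> c * f t) (at t within (I \<inter> {t<..}))"
    using assms t by (intro tendsto_mult tendsto_const) (auto simp: cadlag_on_def)
  obtain l where "(f \<longlongrightarrow> l) (at t within (I \<inter> {..<t}))"
    using assms t unfolding cadlag_on_def by meson
  then show "\<exists>l. ((\<lambda>t. c * f t) \<longlongrightarrow> l) (at t within (I \<inter> {..<t}))"
    by (intro exI[of _ "c * l"] tendsto_mult tendsto_const)
qed

lemma cadlag_on_continuous:
  assumes "continuous_on I f" shows "cadlag_on I f"
  unfolding cadlag_on_def
proof (intro conjI ballI)
  fix t assume t: "t \<in> I"
  have "(f \<longlongrightarrow> f t) (at t within I)" using assms t by (simp add: continuous_on_def)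
  then show "(f \<longlongrightarrow> f t) (at t within (I \<inter> {t<..}))" "\<exists>l. (f \<longlongrightarrow> l) (at t within (I \<inter> {..<t}))"
    by (auto intro: tendsto_within_subset)
qed

lemma cadlag_on_subset:
  assumes "cadlag_on I f" "I' \<subseteq> I" shows "cadlag_on I' f"
  unfolding cadlag_on_def
proof (intro conjI ballI)
  fix t assume "t \<in> I'"
  then have t: "t \<in> I" using assms(2) by auto
  have "(f \<longlongrightarrow> f t) (at t within (I \<inter> {t<..}))" using assms(1) t by (simp add: cadlag_on_def)
  then show "(f \<longlongrightarrow> f t) (at t within (I' \<inter> {t<..}))"
    by (rule tendsto_within_subset) (use assms(2) in auto)
  obtain l where "(f \<longlongrightarrow> l) (at t within (I \<inter> {..<t}))"
    using assms(1) t unfolding cadlag_on_def by meson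
  then have "(f \<longlongrightarrow> l) (at t within (I' \<inter> {..<t}))"
    by (rule tendsto_within_subset) (use assms(2) in auto)
  then show "\<exists>l. (f \<longlongrightarrow> l) (at t within (I' \<inter> {..<t}))" ..
qed

text \<open>Applied to paths extended by \<open>undefined\<close> off the interval: the property
  reads values on \<open>I\<close> only.\<close>

lemma cadlag_on_cong:
  assumes "cadlag_on I f" "\<And>t. t \<in> I \<Longrightarrow> f t = g t" shows "cadlag_on I g"
  unfolding cadlag_on_def
proof (intro conjI ballI)
  fix t assume t: "t \<in> I"
  have cong: "(g \<longlongrightarrow> l) (at t within (I \<inter> A))" if "(f \<longlongrightarrow> l) (at t within (I \<inter> A))" for l A
    by (rule Lim_transform_eventually[OF that])
       (use assms(2) in \<open>auto simp: eventually_at_filter\<close>)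
  have "(f \<longlongrightarrow> f t) (at t within (I \<inter> {t<..}))" using assms(1) t by (simp add: cadlag_on_def)
  from cong[OF this] show "(g \<longlongrightarrow> g t) (at t within (I \<inter> {t<..}))" using assms(2)[OF t] by simp
  obtain l where "(f \<longlongrightarrow> l) (at t within (I \<inter> {..<t}))"
    using assms(1) t unfolding cadlag_on_def by meson
  from cong[OF this] show "\<exists>l. (g \<longlongrightarrow> l) (at t within (I \<inter> {..<t}))" ..
qed

lemma measurable_skorokhod_space:
  assumes "\<And>t. t \<in> {0..T} \<Longrightarrow> (\<lambda>\<omega>. x t \<omega>) \<in> borel_measurable M"
    and "\<And>\<omega>. \<omega> \<in> space M \<Longrightarrow> cadlag_on {0..T} (\<lambda>t. x t \<omega>)"
  shows "(\<lambda>\<omega>. \<lambda>t\<in>{0..T}. x t \<omega>) \<in> measurable M (skorokhod_space T)"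
  unfolding skorokhod_space_def
proof (rule measurable_restrict_space2)
  show "(\<lambda>\<omega>. \<lambda>t\<in>{0..T}. x t \<omega>) \<in> measurable M (Pi\<^sub>M {0..T} (\<lambda>_. borel))"
    using assms(1) by (rule measurable_restrict)
  show "(\<lambda>\<omega>. \<lambda>t\<in>{0..T}. x t \<omega>) \<in> space M \<rightarrow> {f. cadlag_on {0..T} f}"
    by (rule funcsetI, rule CollectI, rule cadlag_on_cong[OF assms(2)]) auto
qed

lemma measurable_skorokhod_component:
  "t \<in> {0..T} \<Longrightarrow> (\<lambda>y. y t) \<in> borel_measurable (skorokhod_space T)"
  unfolding skorokhod_space_def by (intro measurable_restrict_space1 measurable_component_singleton)

lemma cadlag_skorokhod_space: "y \<in> space (skorokhod_space T) \<Longrightarrow> cadlag_on {0..T} y"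
  by (simp add: skorokhod_space_def space_restrict_space)

lemma l2lim_scalar:
  assumes "finite_measure M" "c \<longlonglongrightarrow> (d :: real)"
  shows "l2lim M (\<lambda>k _. c k) (\<lambda>_. d)"
proof -
  have "(\<lambda>k. (c k - d)\<^sup>2 * measure M (space M)) \<longlonglongrightarrow> (d - d)\<^sup>2 * measure M (space M)"
    by (intro tendsto_intros assms)
  then show ?thesis using sqint_const[OF assms(1)] by (simp add: l2lim_def mult.commute)
qed

section \<open>Removal of the smoothing\<close>

lemma smooth_norm_tendsto_L2_set: "((\<lambda>\<epsilon>. smooth_norm \<epsilon> J x) \<longlongrightarrow> L2_set x J) (at_right 0)"
proof -
  have "((\<lambda>\<epsilon>. sqrt (\<epsilon>\<^sup>2 + (\<Sum>l\<in>J. (x l)\<^sup>2))) \<longlongrightarrow> sqrt (0\<^sup>2 + (\<Sum>l\<in>J. (x l)\<^sup>2))) (at_right 0)"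
    by (intro tendsto_intros)
  then show ?thesis by (simp add: smooth_norm_def L2_set_def)
qed

lemma smooth_quotient_tendsto:
  assumes J: "finite J" and j: "j \<in> J" and e: "e \<longlonglongrightarrow> 0" "\<And>k. e k > 0"
  shows "(\<lambda>k. x j / smooth_norm (e k) J x) \<longlonglongrightarrow> x j / L2_set x J"
\<comment> \<open>If \<open>x j = 0\<close>, both quotients are 0, even where the norm vanishes,
  since division by zero gives zero. Otherwise the norm is positive.\<close>
proof (cases "x j = 0")
  case False
  have "0 < \<bar>x j\<bar>" using False by simp
  also have "\<bar>x j\<bar> \<le> L2_set x J"
    using member_le_L2_set[OF J j, of "\<lambda>l. \<bar>x l\<bar>"] by (simp add: L2_set_def)
  finally have "L2_set x J \<noteq> 0" by simp
  moreover have "(\<lambda>k. smooth_norm (e k) J x) \<longlonglongrightarrow> L2_set x J"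
    by (rule filterlim_compose[OF smooth_norm_tendsto_L2_set])
       (use e in \<open>auto intro!: tendsto_imp_filterlim_at_right\<close>)
  ultimately show ?thesis by (intro tendsto_intros)
qed simp

context levy_noise
begin

text \<open>Dominated convergence with bound \<open>\<bar>N j \<omega>\<bar>\<close>, as the
  quotients are at most 1 in modulus. The strict inequality for \<open>R\<close> leaves room for the
  squares of a null sequence of smoothing parameters.\<close>

lemma noise_stein_L2_set:
  fixes f :: "nat \<Rightarrow> real \<Rightarrow> real" and b :: "nat \<Rightarrow> real" and N :: "nat \<Rightarrow> 'a \<Rightarrow> real"
  assumes T: "T > 0" and R: "R > 0" and J: "finite J" "J \<noteq> {}"
    and f: "\<And>j. j \<in> J \<Longrightarrow> f j \<in> borel_measurable (lebesgue_on {0..T})"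
    and B: "\<And>j t. j \<in> J \<Longrightarrow> t \<in> {0..T} \<Longrightarrow> \<bar>f j t\<bar> \<le> B"
    and gram: "\<And>j l. j \<in> J \<Longrightarrow> l \<in> J \<Longrightarrow> (\<integral>t. f j t * f l t \<partial>lebesgue_on {0..T}) = (if j = l then T else 0)"
    and N: "\<And>j. j \<in> J \<Longrightarrow> noise_integral T (f j) (N j)"
    and R2: "(\<Sum>j\<in>J. (b j)\<^sup>2) + real (card J) * ((\<sigma>\<^sub>1\<^sup>2 + \<sigma>\<^sub>2\<^sup>2) * T) < R\<^sup>2"
  shows "\<sigma>\<^sub>1\<^sup>2 * T * (real (card J) - 1) / R \<le>
    (\<Sum>j\<in>J. \<integral>\<omega>. N j \<omega> * ((b j + N j \<omega>) / L2_set (\<lambda>l. b l + N l \<omega>) J) \<partial>M)"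
proof -
  define \<delta> where "\<delta> = sqrt (R\<^sup>2 - ((\<Sum>j\<in>J. (b j)\<^sup>2) + real (card J) * ((\<sigma>\<^sub>1\<^sup>2 + \<sigma>\<^sub>2\<^sup>2) * T)))"
  have \<delta>: "\<delta> > 0" "\<delta>\<^sup>2 = R\<^sup>2 - ((\<Sum>j\<in>J. (b j)\<^sup>2) + real (card J) * ((\<sigma>\<^sub>1\<^sup>2 + \<sigma>\<^sub>2\<^sup>2) * T))"
    using R2 by (simp_all add: \<delta>_def)
  define e where "e k = \<delta> / real (Suc k)" for k
  have e: "e k > 0" "e k \<le> \<delta>" for k using \<delta>(1) by (simp_all add: e_def divide_le_eq)
  have e0: "e \<longlonglongrightarrow> 0"
    unfolding e_def[abs_def] by (rule LIMSEQ_Suc[OF lim_const_over_n])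
  have sN: "sqint M (N j)" if "j \<in> J" for j by (rule noise_integral_mean[OF N[OF that]])
  have mN: "N j \<in> borel_measurable M" if "j \<in> J" for j using sN[OF that] by (simp add: sqint_def)
  have mX: "(\<lambda>\<omega>. b j + N j \<omega>) \<in> borel_measurable M" if "j \<in> J" for j
    by (intro borel_measurable_add borel_measurable_const mN that)
  have "(\<lambda>k. \<Sum>j\<in>J. \<integral>\<omega>. N j \<omega> * ((b j + N j \<omega>) / smooth_norm (e k) J (\<lambda>l. b l + N l \<omega>)) \<partial>M) \<longlonglongrightarrow>
     (\<Sum>j\<in>J. \<integral>\<omega>. N j \<omega> * ((b j + N j \<omega>) / L2_set (\<lambda>l. b l + N l \<omega>) J) \<partial>M)"
  proof (rule tendsto_sum)
    fix j assume j: "j \<in> J"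
    show "(\<lambda>k. \<integral>\<omega>. N j \<omega> * ((b j + N j \<omega>) / smooth_norm (e k) J (\<lambda>l. b l + N l \<omega>)) \<partial>M) \<longlonglongrightarrow>
      (\<integral>\<omega>. N j \<omega> * ((b j + N j \<omega>) / L2_set (\<lambda>l. b l + N l \<omega>) J) \<partial>M)"
    proof (rule integral_dominated_convergence)
      show "integrable M (\<lambda>\<omega>. \<bar>N j \<omega>\<bar>)"
        by (intro integrable_abs sqint_integrable[OF finite_measure_axioms] sN j)
      show "AE \<omega> in M. (\<lambda>k. N j \<omega> * ((b j + N j \<omega>) / smooth_norm (e k) J (\<lambda>l. b l + N l \<omega>))) \<longlonglongrightarrow>
         N j \<omega> * ((b j + N j \<omega>) / L2_set (\<lambda>l. b l + N l \<omega>) J)"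
        by (intro AE_I2 tendsto_mult tendsto_const smooth_quotient_tendsto[OF J(1) j e0 e(1)])
      show "AE \<omega> in M. norm (N j \<omega> * ((b j + N j \<omega>) / smooth_norm (e k) J (\<lambda>l. b l + N l \<omega>))) \<le> \<bar>N j \<omega>\<bar>" for k
      proof (rule AE_I2)
        fix \<omega>
        have "\<bar>N j \<omega>\<bar> * \<bar>(b j + N j \<omega>) / smooth_norm (e k) J (\<lambda>l. b l + N l \<omega>)\<bar> \<le> \<bar>N j \<omega>\<bar> * 1"
          by (intro mult_left_mono smooth_quotient_bounded[OF e(1) J(1) j]) auto
        then show "norm (N j \<omega> * ((b j + N j \<omega>) / smooth_norm (e k) J (\<lambda>l. b l + N l \<omega>))) \<le> \<bar>N j \<omega>\<bar>"
          unfolding real_norm_def abs_mult by simp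
      qed
      show "(\<lambda>\<omega>. N j \<omega> * ((b j + N j \<omega>) / smooth_norm (e k) J (\<lambda>l. b l + N l \<omega>))) \<in> borel_measurable M" for k
        by (intro borel_measurable_times borel_measurable_divide borel_measurable_smooth_norm mN mX j)
      show "(\<lambda>\<omega>. N j \<omega> * ((b j + N j \<omega>) / L2_set (\<lambda>l. b l + N l \<omega>) J)) \<in> borel_measurable M"
        unfolding L2_set_def
        by (intro borel_measurable_times borel_measurable_divide measurable_compose[OF _ borel_measurable_sqrt]
            borel_measurable_sum borel_measurable_power mN mX j)
    qed
  qed
  moreover have "\<sigma>\<^sub>1\<^sup>2 * T * (real (card J) - 1) / R \<le>
      (\<Sum>j\<in>J. \<integral>\<omega>. N j \<omega> * ((b j + N j \<omega>) / smooth_norm (e k) J (\<lambda>l. b l + N l \<omega>)) \<partial>M)" for k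
  proof (rule noise_stein[OF T e(1) R J f B gram N])
    have "(e k)\<^sup>2 \<le> \<delta>\<^sup>2" using e[of k] by (intro power_mono) auto
    then show "(e k)\<^sup>2 + (\<Sum>j\<in>J. (b j)\<^sup>2) + real (card J) * ((\<sigma>\<^sub>1\<^sup>2 + \<sigma>\<^sub>2\<^sup>2) * T) \<le> R\<^sup>2"
      unfolding \<delta>(2) by linarith
  qed
  ultimately show ?thesis by (intro LIMSEQ_le_const) auto
qed

end

section \<open>Transfer to the observation law\<close>

lemma sqint_distr:
  assumes "Y \<in> measurable M N" "X \<in> borel_measurable N"
  shows "sqint (distr M N Y) X \<longleftrightarrow> sqint M (\<lambda>\<omega>. X (Y \<omega>))"
proof -
  have "(\<lambda>\<omega>. X (Y \<omega>)) \<in> borel_measurable M" using assms by (rule measurable_compose)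
  moreover have "integrable (distr M N Y) (\<lambda>x. (X x)\<^sup>2) \<longleftrightarrow> integrable M (\<lambda>\<omega>. (X (Y \<omega>))\<^sup>2)"
    using assms by (intro integrable_distr_eq) auto
  ultimately show ?thesis using assms by (simp add: sqint_def)
qed

lemma l2lim_distr:
  assumes Y: "Y \<in> measurable M N" and X: "\<And>k. X k \<in> borel_measurable N" "X' \<in> borel_measurable N"
  shows "l2lim (distr M N Y) X X' \<longleftrightarrow> l2lim M (\<lambda>k \<omega>. X k (Y \<omega>)) (\<lambda>\<omega>. X' (Y \<omega>))"
proof -
  have "(\<integral>x. (X k x - X' x)\<^sup>2 \<partial>distr M N Y) = (\<integral>\<omega>. (X k (Y \<omega>) - X' (Y \<omega>))\<^sup>2 \<partial>M)" for k
    using assms by (intro integral_distr) auto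
  then show ?thesis by (simp add: l2lim_def sqint_distr[OF Y] X)
qed

lemma step_integral_cong:
  assumes "valid_steps T p" "\<And>t. t \<in> {0..T} \<Longrightarrow> x t = y t"
  shows "step_integral p x = step_integral p y"
proof -
  have "(case e of (a, s, u) \<Rightarrow> a * (x u - x s)) = (case e of (a, s, u) \<Rightarrow> a * (y u - y s))" if "e \<in> set p" for e
    using assms(1) that assms(2) by (cases e) (auto simp: valid_steps_def)
  then show ?thesis unfolding step_integral_def by (intro arg_cong[where f = sum_list] map_cong refl)
qed

lemma borel_measurable_step_integral:
  assumes "valid_steps T p" shows "step_integral p \<in> borel_measurable (skorokhod_space T)"
  using assms
proof (induction p)
  case Nil
  then show ?case by (simp add: step_integral_def[abs_def])
next
  case (Cons x p)
  obtain a s u where x: "x = (a, s, u)" by (cases x)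
  have v: "valid_steps T p" "s \<in> {0..T}" "u \<in> {0..T}" using Cons.prems by (auto simp: valid_steps_def x)
  have "(\<lambda>y. a * (y u - y s) + step_integral p y) \<in> borel_measurable (skorokhod_space T)"
    by (intro borel_measurable_add borel_measurable_times borel_measurable_const borel_measurable_diff
        measurable_skorokhod_component v Cons.IH)
  moreover have "step_integral (x # p) = (\<lambda>y. a * (y u - y s) + step_integral p y)"
    by (rule ext) (simp add: step_integral_def x)
  ultimately show ?case by simp
qed

section \<open>The observed path and stochastic integrals against it\<close>

context levy_noise
begin

definition observation :: "real \<Rightarrow> (real \<Rightarrow> real) \<Rightarrow> 'a \<Rightarrow> real \<Rightarrow> real" where
  "observation T S \<omega> = (\<lambda>t\<in>{0..T}. drift S t + \<xi> t \<omega>)"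

definition noise_law :: "real \<Rightarrow> (real \<Rightarrow> real) measure" where
  "noise_law T = distr M (skorokhod_space T) (\<lambda>\<omega>. \<lambda>t\<in>{0..T}. \<xi> t \<omega>)"

lemma \<xi>_measurable: "t \<in> {0..T} \<Longrightarrow> \<xi> t \<in> borel_measurable M"
  using \<xi>_sqint[of t] by (simp add: sqint_def)

lemma \<xi>_cadlag: "\<omega> \<in> space M \<Longrightarrow> cadlag_on {0..T} (\<lambda>t. \<xi> t \<omega>)"
proof -
  assume \<omega>: "\<omega> \<in> space M"
  have "continuous_on {0..} (\<lambda>t. w t \<omega>)" using bm \<omega> by (simp add: standard_brownian_motion_def)
  moreover have "cadlag_on {0..} (\<lambda>t. z t \<omega>)" using jump_process \<omega> by (simp add: compensated_jump_process_def)
  ultimately have "cadlag_on {0..} (\<lambda>t. \<xi> t \<omega>)"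
    unfolding \<xi>_def by (intro cadlag_on_add[OF cadlag_on_cmult[OF cadlag_on_continuous] cadlag_on_cmult])
  then show ?thesis by (rule cadlag_on_subset) auto
qed

lemma measurable_noise: "(\<lambda>\<omega>. \<lambda>t\<in>{0..T}. \<xi> t \<omega>) \<in> measurable M (skorokhod_space T)"
  by (intro measurable_skorokhod_space \<xi>_measurable[where T = T] \<xi>_cadlag)

context
  fixes T :: real and S :: "real \<Rightarrow> real"
  assumes T: "T > 0" and S: "sqint (lebesgue_on {0..T}) S"
begin

lemma cadlag_drift: "cadlag_on {0..T} (drift S)"
  by (intro cadlag_on_continuous drift_continuous sqint_integrable[OF finite_measure_lebesgue_on_Icc S])

lemma measurable_observation: "observation T S \<in> measurable M (skorokhod_space T)"
  unfolding observation_def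
  by (intro measurable_skorokhod_space borel_measurable_add borel_measurable_const \<xi>_measurable[where T = T]
      cadlag_on_add cadlag_drift \<xi>_cadlag)

text \<open>Adding the drift is a measurable map of path space, so the two image measures compose,
  and expectations under the law of \<open>y\<close> become expectations on the probability
  space.\<close>

lemma observation_law_eq:
  "observation_law T (noise_law T) S = distr M (skorokhod_space T) (observation T S)"
proof -
  have m: "(\<lambda>x. \<lambda>t\<in>{0..T}. drift S t + x t) \<in> measurable (skorokhod_space T) (skorokhod_space T)"
    by (intro measurable_skorokhod_space borel_measurable_add borel_measurable_const
        measurable_skorokhod_component cadlag_on_add cadlag_drift cadlag_skorokhod_space)
  have "observation_law T (noise_law T) S =
      distr (distr M (skorokhod_space T) (\<lambda>\<omega>. \<lambda>t\<in>{0..T}. \<xi> t \<omega>)) (skorokhod_space T) (\<lambda>x. \<lambda>t\<in>{0..T}. drift S t + x t)"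
    unfolding observation_law_def noise_law_def drift_def
    by (rule distr_cong) (auto simp: distr_def)
  also have "\<dots> = distr M (skorokhod_space T) ((\<lambda>x. \<lambda>t\<in>{0..T}. drift S t + x t) \<circ> (\<lambda>\<omega>. \<lambda>t\<in>{0..T}. \<xi> t \<omega>))"
    by (rule distr_distr[OF m measurable_noise])
  also have "(\<lambda>x. \<lambda>t\<in>{0..T}. drift S t + x t) \<circ> (\<lambda>\<omega>. \<lambda>t\<in>{0..T}. \<xi> t \<omega>) = observation T S"
    by (auto simp: fun_eq_iff observation_def)
  finally show ?thesis .
qed

lemma step_integral_observation:
  assumes "valid_steps T p"
  shows "step_integral p (observation T S \<omega>) =
    (\<integral>t. step_fun p t * S t \<partial>lebesgue_on {0..T}) + step_integral p (\<lambda>t. \<xi> t \<omega>)"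
proof -
  have "step_integral p (observation T S \<omega>) = step_integral p (\<lambda>t. drift S t + \<xi> t \<omega>)"
    by (rule step_integral_cong[OF assms]) (simp add: observation_def)
  then show ?thesis by (simp add: step_integral_add step_integral_drift[OF S assms])
qed

lemma sqint_step_integral_observation:
  "valid_steps T p \<Longrightarrow> sqint M (\<lambda>\<omega>. step_integral p (observation T S \<omega>))"
  by (simp add: step_integral_observation sqint_add sqint_const finite_measure_axioms sqint_step_integral_\<xi>)

lemma drift_l2lim:
  assumes "l2lim (lebesgue_on {0..T}) (\<lambda>k. step_fun (p k)) f"
  shows "l2lim M (\<lambda>k _. \<integral>t. step_fun (p k) t * S t \<partial>lebesgue_on {0..T}) (\<lambda>_. \<integral>t. f t * S t \<partial>lebesgue_on {0..T})"
  by (intro l2lim_scalar finite_measure_axioms l2lim_mult[OF assms l2lim_const[OF S]])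

text \<open>Holds for every version, so for the one chosen in \<open>stochastic_integral\<close>.
  Mean square limits under the image measure are those of the composed variables, and the drift
  contributes the deterministic limit of its step integrals.\<close>

lemma has_stochastic_integral_noise:
  assumes X: "has_stochastic_integral (distr M (skorokhod_space T) (observation T S)) T f X"
  shows "X \<in> borel_measurable (skorokhod_space T)"
    "noise_integral T f (\<lambda>\<omega>. X (observation T S \<omega>) - (\<integral>t. f t * S t \<partial>lebesgue_on {0..T}))"
proof -
  obtain p where p: "(\<forall>k. \<forall>(a, s, u)\<in>set (p k). 0 \<le> s \<and> s \<le> u \<and> u \<le> T) \<and>
      L2_tendsto (lebesgue_on {0..T}) (\<lambda>k. step_fun (p k)) f \<and>
      L2_tendsto (distr M (skorokhod_space T) (observation T S)) (\<lambda>k. step_integral (p k)) X"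
    using X unfolding has_stochastic_integral_def by (rule exE)
  then have v: "valid_steps T (p k)" for k by (simp add: valid_steps_def)
  have f: "l2lim (lebesgue_on {0..T}) (\<lambda>k. step_fun (p k)) f"
    using p by (simp add: l2lim_iff_L2_tendsto sqint_step_fun)
  show mX: "X \<in> borel_measurable (skorokhod_space T)" using p by (simp add: L2_tendsto_def)
  have "l2lim (distr M (skorokhod_space T) (observation T S)) (\<lambda>k. step_integral (p k)) X"
    using p by (simp add: l2lim_iff_L2_tendsto sqint_distr[OF measurable_observation borel_measurable_step_integral[OF v]]
        sqint_step_integral_observation[OF v])
  then have "l2lim M (\<lambda>k \<omega>. step_integral (p k) (observation T S \<omega>)) (\<lambda>\<omega>. X (observation T S \<omega>))"
    by (simp add: l2lim_distr[OF measurable_observation borel_measurable_step_integral[OF v] mX])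
  from l2lim_add[OF this l2lim_cmult[OF drift_l2lim[OF f], of "-1"]]
  have "l2lim M (\<lambda>k \<omega>. step_integral (p k) (\<lambda>t. \<xi> t \<omega>)) (\<lambda>\<omega>. X (observation T S \<omega>) - (\<integral>t. f t * S t \<partial>lebesgue_on {0..T}))"
    by (simp add: step_integral_observation[OF v])
  with v f show "noise_integral T f (\<lambda>\<omega>. X (observation T S \<omega>) - (\<integral>t. f t * S t \<partial>lebesgue_on {0..T}))"
    unfolding noise_integral_def by (intro exI[of _ p]) simp
qed

text \<open>Guarantees that the choice in \<open>stochastic_integral\<close> yields a genuine
  integral.\<close>

lemma has_stochastic_integral_exists:
  assumes f: "f \<in> borel_measurable (lebesgue_on {0..T})" and B: "\<And>t. t \<in> {0..T} \<Longrightarrow> \<bar>f t\<bar> \<le> B"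
  shows "\<exists>X. has_stochastic_integral (distr M (skorokhod_space T) (observation T S)) T f X"
proof -
  let ?P = "distr M (skorokhod_space T) (observation T S)"
  obtain m g where mg: "l2lim (lebesgue_on {0..T}) (\<lambda>k. step_fun (grid_list T (m k) (g () k))) f"
    by (rule grid_l2_approx[OF T, of "{()}" "\<lambda>_. f" B]) (use f B in auto)
  define p where "p k = grid_list T (m k) (g () k)" for k
  have v: "valid_steps T (p k)" for k unfolding p_def by (rule valid_grid_list[OF T])
  have l: "l2lim (lebesgue_on {0..T}) (\<lambda>k. step_fun (p k)) f" using mg by (simp add: p_def)
  from step_integral_cauchy_limit[OF v l]
  obtain N where N: "l2lim M (\<lambda>k \<omega>. step_integral (p k) (\<lambda>t. \<xi> t \<omega>)) N" ..
  from l2lim_add[OF drift_l2lim[OF l] N]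
  obtain N' where N': "l2lim M (\<lambda>k \<omega>. step_integral (p k) (observation T S \<omega>)) N'"
    unfolding step_integral_observation[OF v] by blast
  have s: "sqint ?P (step_integral (p k))" for k
    by (simp add: sqint_distr[OF measurable_observation borel_measurable_step_integral[OF v]]
        sqint_step_integral_observation[OF v])
  \<comment> \<open>The limit has to be a function of the path, whereas \<open>N'\<close> lives on
    the probability space. So only the Cauchy property is transferred, and completeness is used a
    second time, on path space.\<close>
  have "\<exists>X. l2lim ?P (\<lambda>k. step_integral (p k)) X"
  proof (rule l2_complete[OF s])
    fix e :: real assume e: "e > 0"
    have "(\<integral>y. (step_integral (p i) y - step_integral (p j) y)\<^sup>2 \<partial>?P) =
       (\<integral>\<omega>. (step_integral (p i) (observation T S \<omega>) - step_integral (p j) (observation T S \<omega>))\<^sup>2 \<partial>M)" for i j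
      using borel_measurable_step_integral[OF v] by (intro integral_distr measurable_observation) auto
    then show "\<exists>K. \<forall>i\<ge>K. \<forall>j\<ge>K. (\<integral>y. (step_integral (p i) y - step_integral (p j) y)\<^sup>2 \<partial>?P) < e"
      using l2lim_cauchy[OF N' e] by simp
  qed
  then obtain X where "l2lim ?P (\<lambda>k. step_integral (p k)) X" ..
  then show ?thesis
    using v l unfolding has_stochastic_integral_def l2lim_iff_L2_tendsto valid_steps_def
    by (intro exI[of _ X] exI[of _ p]) simp
qed

end

end

section \<open>The risk of the shrinkage estimator\<close>

text \<open>Pythagoras: the last bracket is the squared distance from \<open>S\<close> to the span.
  It does not involve the coefficients \<open>a\<close> and therefore cancels in the difference of
  the risks.\<close>

lemma orthonormal_expansion:
  assumes s: "\<And>j. j \<in> I \<Longrightarrow> sqint K (\<phi> j)" and S: "sqint K S" and I: "finite I"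
    and on: "\<And>i j. i \<in> I \<Longrightarrow> j \<in> I \<Longrightarrow> (\<integral>t. \<phi> i t * \<phi> j t \<partial>K) = (if i = j then 1 else 0)"
  shows "(\<integral>t. ((\<Sum>j\<in>I. a j * \<phi> j t) - S t)\<^sup>2 \<partial>K) =
     (\<Sum>j\<in>I. (a j - (\<integral>t. \<phi> j t * S t \<partial>K))\<^sup>2) + ((\<integral>t. (S t)\<^sup>2 \<partial>K) - (\<Sum>j\<in>I. (\<integral>t. \<phi> j t * S t \<partial>K)\<^sup>2))"
proof -
  let ?\<theta> = "\<lambda>j. \<integral>t. \<phi> j t * S t \<partial>K"
  have i1: "integrable K (\<lambda>t. \<Sum>i\<in>I. \<Sum>j\<in>I. (a i * a j) * (\<phi> i t * \<phi> j t))"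
    by (intro Bochner_Integration.integrable_sum integrable_mult_right sqint_mult s)
  have i2: "integrable K (\<lambda>t. \<Sum>j\<in>I. a j * (\<phi> j t * S t))"
    by (intro Bochner_Integration.integrable_sum integrable_mult_right sqint_mult s S)
  have "(\<integral>t. ((\<Sum>j\<in>I. a j * \<phi> j t) - S t)\<^sup>2 \<partial>K) =
     (\<integral>t. (\<Sum>i\<in>I. \<Sum>j\<in>I. (a i * a j) * (\<phi> i t * \<phi> j t)) - 2 * (\<Sum>j\<in>I. a j * (\<phi> j t * S t)) + (S t)\<^sup>2 \<partial>K)"
  proof (intro Bochner_Integration.integral_cong refl)
    fix t
    have "(\<Sum>j\<in>I. a j * \<phi> j t)\<^sup>2 = (\<Sum>i\<in>I. \<Sum>j\<in>I. (a i * a j) * (\<phi> i t * \<phi> j t))"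
      unfolding power2_eq_square sum_product by (intro sum.cong refl) (simp only: mult_ac)
    moreover have "(\<Sum>j\<in>I. a j * \<phi> j t) * S t = (\<Sum>j\<in>I. a j * (\<phi> j t * S t))"
      by (simp only: sum_distrib_right mult.assoc)
    ultimately show "((\<Sum>j\<in>I. a j * \<phi> j t) - S t)\<^sup>2 =
       (\<Sum>i\<in>I. \<Sum>j\<in>I. (a i * a j) * (\<phi> i t * \<phi> j t)) - 2 * (\<Sum>j\<in>I. a j * (\<phi> j t * S t)) + (S t)\<^sup>2"
      unfolding power2_diff by simp
  qed
  also have "\<dots> = (\<integral>t. (\<Sum>i\<in>I. \<Sum>j\<in>I. (a i * a j) * (\<phi> i t * \<phi> j t)) \<partial>K) - 2 * (\<integral>t. (\<Sum>j\<in>I. a j * (\<phi> j t * S t)) \<partial>K)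
     + (\<integral>t. (S t)\<^sup>2 \<partial>K)"
    using i1 i2 sqint_square[OF S] by simp
  also have "(\<integral>t. (\<Sum>i\<in>I. \<Sum>j\<in>I. (a i * a j) * (\<phi> i t * \<phi> j t)) \<partial>K) = (\<Sum>i\<in>I. \<Sum>j\<in>I. (a i * a j) * (\<integral>t. \<phi> i t * \<phi> j t \<partial>K))"
    by (rule integral_double_sum) (intro sqint_mult s)
  also have "\<dots> = (\<Sum>i\<in>I. \<Sum>j\<in>I. if i = j then a i * a j else 0)"
    by (intro sum.cong refl) (simp add: on)
  also have "\<dots> = (\<Sum>j\<in>I. (a j)\<^sup>2)" using I by (simp add: power2_eq_square)
  also have "(\<integral>t. (\<Sum>j\<in>I. a j * (\<phi> j t * S t)) \<partial>K) = (\<Sum>j\<in>I. a j * ?\<theta> j)"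
    by (subst Bochner_Integration.integral_sum) (auto intro!: integrable_mult_right sqint_mult s S)
  finally show ?thesis
    by (simp add: power2_diff sum.distrib sum_subtractf sum_distrib_left mult.assoc)
qed

text \<open>Beyond \<open>d\<close> the estimators agree. Up to \<open>d\<close> the weights are 1,
  and expanding the squares leaves \<open>\<gamma>\<^sup>2\<close> times the squared norm and a
  linear term. The direction of \<open>th\<close> is invariant under scaling, so the linear term can
  be written with the unnormalised integrals \<open>x\<close>.\<close>

lemma shrinkage_loss_difference:
  fixes x \<theta> :: "nat \<Rightarrow> real" and c :: real
  assumes n: "n > 0" and d: "d \<le> n" and lam: "\<And>j. j \<in> {1..d} \<Longrightarrow> lam j = 1"
  defines "th \<equiv> \<lambda>j. x j / real n"
  defines "g \<equiv> \<lambda>j. c / L2_set th {1..d} * indicator {1..d} j"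
  shows "(\<Sum>j=1..n. (lam j * ((1 - g j) * th j) - \<theta> j)\<^sup>2) - (\<Sum>j=1..n. (lam j * th j - \<theta> j)\<^sup>2) \<le>
    c\<^sup>2 - 2 * c / real n * (\<Sum>j=1..d. (x j - real n * \<theta> j) * (x j / L2_set x {1..d}))"
proof -
  define \<gamma> where "\<gamma> = c / L2_set th {1..d}"
  have L: "L2_set th {1..d} = L2_set x {1..d} / real n"
    using L2_set_right_distrib[of "1 / real n" x "{1..d}"] by (simp add: th_def)
  have "(\<Sum>j=1..n. (lam j * ((1 - g j) * th j) - \<theta> j)\<^sup>2) - (\<Sum>j=1..n. (lam j * th j - \<theta> j)\<^sup>2) =
      (\<Sum>j=1..n. (lam j * ((1 - g j) * th j) - \<theta> j)\<^sup>2 - (lam j * th j - \<theta> j)\<^sup>2)"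
    by (simp add: sum_subtractf)
  also have "\<dots> = (\<Sum>j=1..d. (lam j * ((1 - g j) * th j) - \<theta> j)\<^sup>2 - (lam j * th j - \<theta> j)\<^sup>2)"
    by (rule sum.mono_neutral_right) (use d in \<open>auto simp: g_def\<close>)
  also have "\<dots> = (\<Sum>j=1..d. \<gamma>\<^sup>2 * (th j)\<^sup>2 - 2 * (th j - \<theta> j) * (\<gamma> * th j))"
  proof (intro sum.cong refl)
    fix j assume j: "j \<in> {1..d}"
    then have "g j = \<gamma>" by (simp add: g_def \<gamma>_def)
    then show "(lam j * ((1 - g j) * th j) - \<theta> j)\<^sup>2 - (lam j * th j - \<theta> j)\<^sup>2 =
       \<gamma>\<^sup>2 * (th j)\<^sup>2 - 2 * (th j - \<theta> j) * (\<gamma> * th j)"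
      using lam[OF j] by (simp add: power2_eq_square algebra_simps)
  qed
  also have "\<dots> = \<gamma>\<^sup>2 * (L2_set th {1..d})\<^sup>2 - (\<Sum>j=1..d. 2 * (th j - \<theta> j) * (\<gamma> * th j))"
    by (simp add: sum_subtractf sum_distrib_left L2_set_def sum_nonneg)
  \<comment> \<open>Equality unless the vector vanishes; in that case \<gamma> is 0, being a
    quotient by zero.\<close>
  also have "\<gamma>\<^sup>2 * (L2_set th {1..d})\<^sup>2 \<le> c\<^sup>2" by (simp add: \<gamma>_def power_divide)
  also have "(\<Sum>j=1..d. 2 * (th j - \<theta> j) * (\<gamma> * th j)) =
      2 * c / real n * (\<Sum>j=1..d. (x j - real n * \<theta> j) * (x j / L2_set x {1..d}))"
    unfolding sum_distrib_left
  proof (intro sum.cong refl)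
    fix j
    have "\<gamma> * th j = c * (x j / L2_set x {1..d})" unfolding \<gamma>_def L using n by (simp add: th_def)
    moreover have "th j - \<theta> j = (x j - real n * \<theta> j) / real n" using n by (simp add: th_def field_simps)
    ultimately show "2 * (th j - \<theta> j) * (\<gamma> * th j) = 2 * c / real n * ((x j - real n * \<theta> j) * (x j / L2_set x {1..d}))"
      by simp
  qed
  finally show ?thesis by simp
qed

text \<open>The shrinkage correction is bounded, also where the norm vanishes, so the shrunk
  coefficients stay square integrable.\<close>

lemma shrinkage_coefficient_bound:
  fixes c :: real and th :: "nat \<Rightarrow> real"
  assumes "j \<in> {1..d}"
  shows "\<bar>c / L2_set th {1..d} * th j\<bar> \<le> \<bar>c\<bar>"
proof -
  have "\<bar>th j\<bar> \<le> L2_set th {1..d}"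
    using member_le_L2_set[OF finite_atLeastAtMost assms, of "\<lambda>l. \<bar>th l\<bar>"] by (simp add: L2_set_def)
  then have "\<bar>th j\<bar> / L2_set th {1..d} \<le> 1"
    by (cases "L2_set th {1..d} = 0") (auto simp: divide_le_eq L2_set_nonneg less_le)
  then have "\<bar>c\<bar> * (\<bar>th j\<bar> / L2_set th {1..d}) \<le> \<bar>c\<bar> * 1" by (intro mult_left_mono) auto
  then show ?thesis by (simp add: abs_mult L2_set_nonneg)
qed

context levy_noise
begin

text \<open>The pointwise loss inequality is integrated, and the Stein bound with
  \<open>T = n\<close> estimates its linear term. Periodicity makes the basis functions orthogonal
  on \<open>{0..n}\<close> as well, with squared norm \<open>n\<close>, and multiplies the Fourier
  coefficients of \<open>S\<close> by \<open>n\<close>.\<close>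

lemma risk_difference_le:
  assumes n: "n \<ge> 1" and lo: "0 < lo" "lo \<le> \<sigma>\<^sub>1\<^sup>2" and hi: "\<sigma>\<^sub>1\<^sup>2 + \<sigma>\<^sub>2\<^sup>2 \<le> hi" and r: "r > 0"
    and basis: "periodic_orthonormal_basis \<phi>"
    and B: "\<And>j t. j \<in> {1..n} \<Longrightarrow> t \<in> {0..1} \<Longrightarrow> \<bar>\<phi> j t\<bar> \<le> B"
    and d: "1 \<le> d" "d \<le> n" and lam: "\<And>j. j \<in> {1..d} \<Longrightarrow> lam j = 1"
    and S: "S \<in> signals" "L2_norm S \<le> r"
  shows "risk_difference n \<phi> lam d (shrinkage_const n d lo hi r) (noise_law (real n)) S \<le>
     ereal (- (shrinkage_const n d lo hi r)\<^sup>2)"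
proof -
  define c where "c = shrinkage_const n d lo hi r"
  let ?T = "real n" and ?K1 = "lebesgue_on {0..1::real}"
  let ?K = "lebesgue_on {0..?T}" and ?Sk = "skorokhod_space ?T"
  have T: "?T > 0" using n by simp
  have S1: "one_periodic S" "sqint ?K1 S" using S by (auto simp: signals_def square_integrable_on_iff)
  have \<phi>: "one_periodic (\<phi> j)" "sqint ?K1 (\<phi> j)" if "j \<in> {1..n}" for j
    using basis that by (auto simp: periodic_orthonormal_basis_def square_integrable_on_iff)
  have on: "(\<integral>t. \<phi> i t * \<phi> j t \<partial>?K1) = (if i = j then 1 else 0)" if "i \<in> {1..n}" "j \<in> {1..n}" for i j
    using basis that by (auto simp: periodic_orthonormal_basis_def L2_inner_def)
  have ST: "sqint ?K S" by (rule periodic_sqint[OF S1])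
  have \<phi>T: "sqint ?K (\<phi> j)" if "j \<in> {1..n}" for j by (rule periodic_sqint[OF \<phi>[OF that]])
  have m\<phi>: "\<phi> j \<in> borel_measurable ?K" if "j \<in> {1..n}" for j using \<phi>T[OF that] by (simp add: sqint_def)
  have BT: "\<bar>\<phi> j t\<bar> \<le> B" if "j \<in> {1..n}" "t \<in> {0..?T}" for j t
  proof -
    \<comment> \<open>Periodicity moves \<open>t\<close> into \<open>{0..1}\<close>, the interval on
      which the bound is assumed.\<close>
    define i where "i = nat \<lfloor>t\<rfloor>"
    have "real i = of_int \<lfloor>t\<rfloor>" using that by (simp add: i_def)
    then have "t - real i \<in> {0..1}" by (simp add: of_int_floor_le) linarith
    then show ?thesis using B[OF that(1), of "t - real i"] one_periodic_diff_nat[OF \<phi>(1)[OF that(1)], of t i] by simp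
  qed
  define \<theta> where "\<theta> j = (\<integral>t. \<phi> j t * S t \<partial>?K1)" for j
  have periodic_mult: "one_periodic (\<lambda>t. f t * g t)" if "one_periodic f" "one_periodic g" for f g
    using that by (simp add: one_periodic_def)
  have \<theta>T: "(\<integral>t. \<phi> j t * S t \<partial>?K) = ?T * \<theta> j" if "j \<in> {1..n}" for j
    unfolding \<theta>_def using \<phi>[OF that] S1 by (intro periodic_integral periodic_mult sqint_mult)
  have gram: "(\<integral>t. \<phi> i t * \<phi> j t \<partial>?K) = (if i = j then ?T else 0)" if "i \<in> {1..n}" "j \<in> {1..n}" for i j
  proof -
    have "(\<integral>t. \<phi> i t * \<phi> j t \<partial>?K) = ?T * (\<integral>t. \<phi> i t * \<phi> j t \<partial>?K1)"
      using \<phi>[OF that(1)] \<phi>[OF that(2)] by (intro periodic_integral periodic_mult sqint_mult)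
    then show ?thesis by (simp add: on[OF that])
  qed
  define P where "P = distr M ?Sk (observation ?T S)"
  have mY: "observation ?T S \<in> measurable M ?Sk" by (rule measurable_observation[OF T ST])
  interpret P: prob_space P unfolding P_def by (rule prob_space_distr[OF mY])
  have P: "observation_law ?T (noise_law ?T) S = P" unfolding P_def by (rule observation_law_eq[OF T ST])
  define x where "x j = stochastic_integral P ?T (\<phi> j)" for j
  have hx: "has_stochastic_integral P ?T (\<phi> j) (x j)" if "j \<in> {1..n}" for j
    unfolding x_def stochastic_integral_def P_def
    by (rule someI_ex[OF has_stochastic_integral_exists[OF T ST m\<phi>[OF that] BT[OF that]]])
  define N where "N j \<omega> = x j (observation ?T S \<omega>) - ?T * \<theta> j" for j \<omega>
  have mx: "x j \<in> borel_measurable ?Sk" and N: "noise_integral ?T (\<phi> j) (N j)" if "j \<in> {1..n}" for j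
    using has_stochastic_integral_noise[OF T ST hx[OF that, unfolded P_def]] \<theta>T[OF that] by (auto simp: N_def[abs_def])
  have sx: "sqint P (x j)" if "j \<in> {1..n}" for j
  proof -
    have "sqint M (\<lambda>\<omega>. N j \<omega> + ?T * \<theta> j)"
      by (intro sqint_add noise_integral_mean[OF N[OF that]] sqint_const finite_measure_axioms)
    then show ?thesis unfolding P_def sqint_distr[OF mY mx[OF that]] by (simp add: N_def)
  qed
  define C0 where "C0 = (\<integral>t. (S t)\<^sup>2 \<partial>?K1) - (\<Sum>j=1..n. (\<theta> j)\<^sup>2)"
  have loss: "(L2_norm (\<lambda>t. (\<Sum>j=1..n. a j * \<phi> j t) - S t))\<^sup>2 = (\<Sum>j=1..n. (a j - \<theta> j)\<^sup>2) + C0" for a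
  proof -
    have "(L2_norm (\<lambda>t. (\<Sum>j=1..n. a j * \<phi> j t) - S t))\<^sup>2 = (\<integral>t. ((\<Sum>j=1..n. a j * \<phi> j t) - S t)\<^sup>2 \<partial>?K1)"
      by (simp add: L2_norm_def)
    also have "\<dots> = (\<Sum>j=1..n. (a j - \<theta> j)\<^sup>2) + C0"
      unfolding \<theta>_def C0_def by (rule orthonormal_expansion[OF \<phi>(2) S1(2) _ on]) auto
    finally show ?thesis .
  qed
  \<comment> \<open>With the true coefficients \<theta> the loss is exactly \<open>C0\<close>, the
    part of the signal outside the first \<open>n\<close> coordinates.\<close>
  have C0: "0 \<le> C0"
    using loss[of \<theta>] zero_le_power2[of "L2_norm (\<lambda>t. (\<Sum>j=1..n. \<theta> j * \<phi> j t) - S t)"] by simp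
  \<comment> \<open>Both risks are finite, so their difference in \<open>ereal\<close> is an
    ordinary difference of integrals.\<close>
  have risk: "quadratic_risk P est S = ereal (\<integral>y. (\<Sum>j=1..n. (a j y - \<theta> j)\<^sup>2) + C0 \<partial>P)"
    if est: "\<And>y t. est y t = (\<Sum>j=1..n. a j y * \<phi> j t)" and a: "\<And>j. j \<in> {1..n} \<Longrightarrow> sqint P (a j)" for est a
  proof -
    have "(\<integral>\<^sup>+y. ennreal ((L2_norm (\<lambda>t. est y t - S t))\<^sup>2) \<partial>P) = (\<integral>\<^sup>+y. ennreal ((\<Sum>j=1..n. (a j y - \<theta> j)\<^sup>2) + C0) \<partial>P)"
      by (simp only: est loss)
    also have "\<dots> = ennreal (\<integral>y. (\<Sum>j=1..n. (a j y - \<theta> j)\<^sup>2) + C0 \<partial>P)"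
    proof (rule nn_integral_eq_integral)
      show "integrable P (\<lambda>y. (\<Sum>j=1..n. (a j y - \<theta> j)\<^sup>2) + C0)"
        by (intro Bochner_Integration.integrable_add Bochner_Integration.integrable_sum P.integrable_const
            sqint_square sqint_diff[OF a sqint_const] P.finite_measure_axioms)
    qed (use C0 in \<open>auto intro!: add_nonneg_nonneg sum_nonneg\<close>)
    finally show ?thesis
      unfolding quadratic_risk_def using C0
      by (simp add: enn2ereal_ennreal integral_nonneg_AE add_nonneg_nonneg sum_nonneg)
  qed
  define th where "th j y = x j y / ?T" for j y
  have th: "theta_hat P n \<phi> j y = th j y" for j y by (simp add: theta_hat_def th_def x_def)
  define g where "g j y = c / L2_set (\<lambda>i. th i y) {1..d} * indicator {1..d} j" for j y
  define a0 where "a0 j y = lam j * th j y" for j y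
  define a1 where "a1 j y = lam j * ((1 - g j y) * th j y)" for j y
  have sth: "sqint P (th j)" if "j \<in> {1..n}" for j
    using sqint_cmult[OF sx[OF that], of "1 / ?T"] by (simp add: th_def[abs_def])
  have mth: "th j \<in> borel_measurable P" if "j \<in> {1..n}" for j using sth[OF that] by (simp add: sqint_def)
  have s0: "sqint P (a0 j)" if "j \<in> {1..n}" for j
    unfolding a0_def[abs_def] by (rule sqint_cmult[OF sth[OF that]])
  have s1: "sqint P (a1 j)" if j: "j \<in> {1..n}" for j
  proof -
    have "sqint P (\<lambda>y. g j y * th j y)"
    proof (rule sqint_bounded[OF P.finite_measure_axioms, where B = "\<bar>c\<bar>"])
      show "(\<lambda>y. g j y * th j y) \<in> borel_measurable P"
        unfolding g_def L2_set_def
        by (intro borel_measurable_times borel_measurable_divide borel_measurable_const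
            measurable_compose[OF _ borel_measurable_sqrt] borel_measurable_sum borel_measurable_power mth)
           (use d j in auto)
      show "\<bar>g j y * th j y\<bar> \<le> \<bar>c\<bar>" for y
        using shrinkage_coefficient_bound[of j d c "\<lambda>i. th i y"] by (cases "j \<in> {1..d}") (auto simp: g_def)
    qed
    from sqint_cmult[OF sqint_diff[OF sth[OF j] this], of "lam j"]
    show ?thesis by (simp add: a1_def[abs_def] left_diff_distrib)
  qed
  have R0: "quadratic_risk P (weighted_lse P n \<phi> lam) S = ereal (\<integral>y. (\<Sum>j=1..n. (a0 j y - \<theta> j)\<^sup>2) + C0 \<partial>P)"
    by (rule risk[OF _ s0]) (simp add: weighted_lse_def a0_def th)
  have R1: "quadratic_risk P (shrinkage_estimator P n \<phi> lam d c) S = ereal (\<integral>y. (\<Sum>j=1..n. (a1 j y - \<theta> j)\<^sup>2) + C0 \<partial>P)"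
    by (rule risk[OF _ s1]) (simp add: shrinkage_estimator_def shrinkage_weight_def a1_def g_def th)
  \<comment> \<open>The \<open>j\<close>-th term of the Stein integrand, as a function of the
    path.\<close>
  define q where "q j y = (x j y - ?T * \<theta> j) * (x j y / L2_set (\<lambda>i. x i y) {1..d})" for j y
  have mq: "q j \<in> borel_measurable ?Sk" if "j \<in> {1..d}" for j
    unfolding q_def[abs_def] L2_set_def
    by (intro borel_measurable_times borel_measurable_divide borel_measurable_diff borel_measurable_const
        measurable_compose[OF _ borel_measurable_sqrt] borel_measurable_sum borel_measurable_power mx)
       (use d that in auto)
  have iq: "integrable P (q j)" if j: "j \<in> {1..d}" for j
    unfolding q_def[abs_def]
  proof (rule sqint_mult[OF sqint_diff[OF sx sqint_const[OF P.finite_measure_axioms]] sqint_bounded[OF P.finite_measure_axioms, where B = 1]])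
    show "(\<lambda>y. x j y / L2_set (\<lambda>i. x i y) {1..d}) \<in> borel_measurable P"
      unfolding L2_set_def P_def measurable_distr_eq1
      by (intro borel_measurable_divide measurable_compose[OF _ borel_measurable_sqrt] borel_measurable_sum borel_measurable_power mx)
         (use d j in auto)
    show "\<bar>x j y / L2_set (\<lambda>i. x i y) {1..d}\<bar> \<le> 1" for y
      using shrinkage_coefficient_bound[OF j, of 1 "\<lambda>i. x i y"] by simp
    show "j \<in> {1..n}" using d j by auto
  qed
  \<comment> \<open>A bound for the root mean square of the first \<open>d\<close> coordinates of
    \<open>theta_hat\<close>; \<open>R\<close> is the same bound for the unnormalised
    integrals.\<close>
  define \<rho> where "\<rho> = r + sqrt (real d * hi / ?T)"
  define R where "R = ?T * \<rho>"
  have hi0: "0 < hi" using lo hi zero_le_power2[of \<sigma>\<^sub>2] by linarith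
  have \<rho>: "0 < \<rho>" unfolding \<rho>_def using r hi0 T by (intro add_pos_nonneg) auto
  have R: "0 < R" unfolding R_def using T \<rho> by simp
  \<comment> \<open>The constant is the Stein bound with \<open>\<sigma>\<^sub>1\<^sup>2\<close>
    lowered to \<open>lo\<close>, divided by \<open>n\<close>.\<close>
  have cR: "c = lo * ?T * (real d - 1) / R / ?T"
  proof -
    have "c = (real d - 1) * lo / (\<rho> * ?T)" by (simp add: c_def shrinkage_const_def \<rho>_def)
    then show ?thesis using T by (simp add: R_def mult.commute)
  qed
  have c0: "0 \<le> c" unfolding cR using lo T R d by (intro divide_nonneg_nonneg mult_nonneg_nonneg) auto
  have stein: "\<sigma>\<^sub>1\<^sup>2 * ?T * (real (card {1..d}) - 1) / R \<le>
    (\<Sum>j=1..d. \<integral>\<omega>. N j \<omega> * ((?T * \<theta> j + N j \<omega>) / L2_set (\<lambda>l. ?T * \<theta> l + N l \<omega>) {1..d}) \<partial>M)"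
  proof (rule noise_stein_L2_set[OF T R, where f = \<phi> and B = B])
    show "(\<Sum>j=1..d. (?T * \<theta> j)\<^sup>2) + real (card {1..d}) * ((\<sigma>\<^sub>1\<^sup>2 + \<sigma>\<^sub>2\<^sup>2) * ?T) < R\<^sup>2"
    proof -
      have "(\<Sum>j=1..d. (\<theta> j)\<^sup>2) \<le> (\<Sum>j=1..n. (\<theta> j)\<^sup>2)" using d by (intro sum_mono2) auto
      also have "\<dots> \<le> (\<integral>t. (S t)\<^sup>2 \<partial>?K1)" using C0 by (simp add: C0_def)
      also have "\<dots> = (L2_norm S)\<^sup>2" by (simp add: L2_norm_def)
      also have "\<dots> \<le> r\<^sup>2" using S(2) by (intro power_mono) (auto simp: L2_norm_def)
      finally have 1: "(\<Sum>j=1..d. (?T * \<theta> j)\<^sup>2) \<le> ?T\<^sup>2 * r\<^sup>2"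
        by (simp add: power_mult_distrib sum_distrib_left[symmetric] mult_left_mono)
      have "real d * ((\<sigma>\<^sub>1\<^sup>2 + \<sigma>\<^sub>2\<^sup>2) * ?T) \<le> real d * (hi * ?T)"
        using hi by (intro mult_left_mono mult_right_mono) auto
      also have "\<dots> = ?T\<^sup>2 * (real d * hi / ?T)" using T by (simp add: power2_eq_square)
      finally have 2: "real d * ((\<sigma>\<^sub>1\<^sup>2 + \<sigma>\<^sub>2\<^sup>2) * ?T) \<le> ?T\<^sup>2 * (real d * hi / ?T)" .
      define s where "s = sqrt (real d * hi / ?T)"
      have "0 < real d * hi / ?T" using d hi0 T by simp
      have Rs: "R = ?T * (r + s)" by (simp only: R_def \<rho>_def s_def)
      from \<open>0 < real d * hi / ?T\<close> have s: "0 < s" "s\<^sup>2 = real d * hi / ?T" by (auto simp: s_def)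
      \<comment> \<open>The cross term is positive because \<open>r\<close> and \<open>hi\<close>
        are; it is the gap used up by the smoothing.\<close>
      have "?T\<^sup>2 * r\<^sup>2 + ?T\<^sup>2 * s\<^sup>2 < ?T\<^sup>2 * r\<^sup>2 + ?T\<^sup>2 * s\<^sup>2 + 2 * (?T\<^sup>2 * (r * s))"
        using T r s by simp
      also have "\<dots> = R\<^sup>2" unfolding Rs by (simp add: power2_eq_square algebra_simps)
      finally show ?thesis using 1 2 s(2) by simp
    qed
    show "(\<integral>t. \<phi> j t * \<phi> l t \<partial>?K) = (if j = l then ?T else 0)" if "j \<in> {1..d}" "l \<in> {1..d}" for j l
      by (rule gram) (use that d in auto)
  qed (use d in \<open>auto intro!: m\<phi> BT N\<close>)
  have q_int: "(\<integral>y. q j y \<partial>P) = (\<integral>\<omega>. N j \<omega> * ((?T * \<theta> j + N j \<omega>) / L2_set (\<lambda>l. ?T * \<theta> l + N l \<omega>) {1..d}) \<partial>M)"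
    if "j \<in> {1..d}" for j
    unfolding P_def by (subst integral_distr[OF mY mq[OF that]]) (simp add: q_def N_def)
  have cq: "c * ?T \<le> (\<Sum>j=1..d. \<integral>y. q j y \<partial>P)"
  proof -
    have "c * ?T = lo * ?T * (real d - 1) / R" using T by (simp add: cR)
    also have "\<dots> \<le> \<sigma>\<^sub>1\<^sup>2 * ?T * (real (card {1..d}) - 1) / R"
      using lo T R d by (intro divide_right_mono) (auto intro!: mult_right_mono)
    also note stein
    finally show ?thesis by (simp add: q_int)
  qed
  have risk_int: "integrable P (\<lambda>y. (\<Sum>j=1..n. (a j y - \<theta> j)\<^sup>2) + C0)" if "\<And>j. j \<in> {1..n} \<Longrightarrow> sqint P (a j)" for a
    by (intro Bochner_Integration.integrable_add Bochner_Integration.integrable_sum P.integrable_const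
        sqint_square sqint_diff[OF that sqint_const] P.finite_measure_axioms)
  note i0 = risk_int[of a0, OF s0] and i1 = risk_int[of a1, OF s1]
  have "(\<integral>y. (\<Sum>j=1..n. (a1 j y - \<theta> j)\<^sup>2) + C0 \<partial>P) - (\<integral>y. (\<Sum>j=1..n. (a0 j y - \<theta> j)\<^sup>2) + C0 \<partial>P) =
     (\<integral>y. ((\<Sum>j=1..n. (a1 j y - \<theta> j)\<^sup>2) + C0) - ((\<Sum>j=1..n. (a0 j y - \<theta> j)\<^sup>2) + C0) \<partial>P)"
    by (rule Bochner_Integration.integral_diff[OF i1 i0, symmetric])
  also have "\<dots> \<le> (\<integral>y. c\<^sup>2 - 2 * c / ?T * (\<Sum>j=1..d. q j y) \<partial>P)"
  proof (rule integral_mono)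
    show "integrable P (\<lambda>y. ((\<Sum>j=1..n. (a1 j y - \<theta> j)\<^sup>2) + C0) - ((\<Sum>j=1..n. (a0 j y - \<theta> j)\<^sup>2) + C0))"
      by (rule Bochner_Integration.integrable_diff[OF i1 i0])
    show "integrable P (\<lambda>y. c\<^sup>2 - 2 * c / ?T * (\<Sum>j=1..d. q j y))"
      by (intro Bochner_Integration.integrable_diff P.integrable_const integrable_mult_right Bochner_Integration.integrable_sum iq)
    fix y
    show "((\<Sum>j=1..n. (a1 j y - \<theta> j)\<^sup>2) + C0) - ((\<Sum>j=1..n. (a0 j y - \<theta> j)\<^sup>2) + C0) \<le> c\<^sup>2 - 2 * c / ?T * (\<Sum>j=1..d. q j y)"
      using shrinkage_loss_difference[of n d lam c "\<lambda>j. x j y" \<theta>] n d lam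
      by (simp add: a0_def a1_def g_def th_def q_def)
  qed
  also have "\<dots> = c\<^sup>2 - 2 * c / ?T * (\<Sum>j=1..d. \<integral>y. q j y \<partial>P)"
  proof -
    have "integrable P (\<lambda>y. \<Sum>j=1..d. q j y)" by (intro Bochner_Integration.integrable_sum iq)
    then have "(\<integral>y. c\<^sup>2 - 2 * c / ?T * (\<Sum>j=1..d. q j y) \<partial>P) = (\<integral>y. c\<^sup>2 \<partial>P) - (\<integral>y. 2 * c / ?T * (\<Sum>j=1..d. q j y) \<partial>P)"
      by (intro Bochner_Integration.integral_diff P.integrable_const integrable_mult_right)
    also have "\<dots> = c\<^sup>2 - 2 * c / ?T * (\<integral>y. (\<Sum>j=1..d. q j y) \<partial>P)"
      by (simp only: integral_mult_right_zero) (simp add: P.prob_space)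
    also have "(\<integral>y. (\<Sum>j=1..d. q j y) \<partial>P) = (\<Sum>j=1..d. \<integral>y. q j y \<partial>P)"
      by (rule Bochner_Integration.integral_sum) (rule iq)
    finally show ?thesis .
  qed
  \<comment> \<open>Uses \<open>c \<ge> 0\<close>. For \<open>d = 1\<close> the constant is 0, and
    the two risks are merely compared.\<close>
  also have "\<dots> \<le> c\<^sup>2 - 2 * c / ?T * (c * ?T)"
    using c0 T by (intro diff_left_mono mult_left_mono cq) auto
  also have "\<dots> = - c\<^sup>2" using T by (simp add: power2_eq_square)
  finally show ?thesis
    unfolding risk_difference_def Let_def c_def[symmetric] P R0 R1 by simp
qed

end

theorem theorem3p2:
  fixes levy :: "real measure"
    and \<phi> :: "nat \<Rightarrow> real \<Rightarrow> real"
    and \<phi>_bound \<sigma>_low \<sigma>_up r :: "nat \<Rightarrow> real"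
    and \<Lambda> :: "nat \<Rightarrow> (nat \<Rightarrow> real) set"
    and d :: "nat \<Rightarrow> (nat \<Rightarrow> real) \<Rightarrow> nat"
  assumes levy: "levy_measure_space levy"
    and sigma_bounds: "\<And>n. n \<ge> 1 \<Longrightarrow> 0 < \<sigma>_low n \<and> \<sigma>_low n \<le> \<sigma>_up n"
    and sigma_low: "\<And>\<epsilon>::real. \<epsilon> > 0 \<Longrightarrow> liminf (\<lambda>n. ereal (real n powr \<epsilon> * \<sigma>_low n)) > 0"
    and sigma_up: "\<And>\<epsilon>::real. \<epsilon> > 0 \<Longrightarrow> (\<lambda>n. real n powr (- \<epsilon>) * \<sigma>_up n) \<longlonglongrightarrow> 0"
    and basis: "periodic_orthonormal_basis \<phi>"
    and basis_bound: "\<And>n j t. n \<ge> 1 \<Longrightarrow> j \<in> {1..n} \<Longrightarrow> t \<in> {0..1} \<Longrightarrow> \<bar>\<phi> j t\<bar> \<le> \<phi>_bound n"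
    and weights: "\<And>n. n \<ge> 1 \<Longrightarrow> finite (\<Lambda> n) \<and> \<Lambda> n \<subseteq> ({1..n} \<rightarrow>\<^sub>E {0..1})"
    and weights_one: "\<And>n lam. n \<ge> 1 \<Longrightarrow> lam \<in> \<Lambda> n \<Longrightarrow>
          1 \<le> d n lam \<and> d n lam \<le> n \<and> (\<forall>j\<in>{1..d n lam}. lam j = 1)"
    and r_pos: "\<And>n. n \<ge> 1 \<Longrightarrow> 0 < r n"
    and r_infinity: "filterlim r at_top sequentially"
    and r_slow: "\<And>\<epsilon>::real. \<epsilon> > 0 \<Longrightarrow> (\<lambda>n. r n / real n powr \<epsilon>) \<longlonglongrightarrow> 0"
  shows "\<forall>n\<ge>1. \<forall>lam\<in>\<Lambda> n.
    (let c = shrinkage_const n (d n lam) (\<sigma>_low n) (\<sigma>_up n) (r n) in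
      (SUP Q\<in>noise_laws TYPE('a) levy (real n) (\<sigma>_low n) (\<sigma>_up n).
        SUP S\<in>{S \<in> signals. L2_norm S \<le> r n}.
          risk_difference n \<phi> lam (d n lam) c Q S) \<le> ereal (- c\<^sup>2))"
  unfolding Let_def
proof (intro allI ballI impI SUP_least)
  fix n :: nat and lam Q S
  assume n: "1 \<le> n" and lam: "lam \<in> \<Lambda> n"
    and Q: "Q \<in> noise_laws TYPE('a) levy (real n) (\<sigma>_low n) (\<sigma>_up n)"
    and S: "S \<in> {S \<in> signals. L2_norm S \<le> r n}"
  \<comment> \<open>A law in the family comes with a probability space carrying its processes, and
    the estimate is carried out there.\<close>
  from Q obtain M :: "'a measure" and w \<mu> z \<sigma>\<^sub>1 \<sigma>\<^sub>2 where
    "prob_space M" "standard_brownian_motion M w" "poisson_random_measure M \<mu> (jump_compensator levy)"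
    "brownian_jump_independent M w \<mu> (jump_compensator levy)"
    "compensated_jump_process M \<mu> (jump_compensator levy) z"
    and \<sigma>: "\<sigma>_low n \<le> \<sigma>\<^sub>1\<^sup>2" "\<sigma>\<^sub>1\<^sup>2 + \<sigma>\<^sub>2\<^sup>2 \<le> \<sigma>_up n"
    and Q_eq: "Q = distr M (skorokhod_space (real n)) (\<lambda>\<omega>. \<lambda>t\<in>{0..real n}. \<sigma>\<^sub>1 * w t \<omega> + \<sigma>\<^sub>2 * z t \<omega>)"
    unfolding noise_laws_def by (elim CollectE exE conjE) (rule that)
  then interpret levy_noise M levy w \<mu> z \<sigma>\<^sub>1 \<sigma>\<^sub>2
    by (intro levy_noise.intro levy_noise_axioms.intro levy)
  have "Q = noise_law (real n)" unfolding Q_eq noise_law_def \<xi>_def ..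
  then show "risk_difference n \<phi> lam (d n lam) (shrinkage_const n (d n lam) (\<sigma>_low n) (\<sigma>_up n) (r n)) Q S
     \<le> ereal (- (shrinkage_const n (d n lam) (\<sigma>_low n) (\<sigma>_up n) (r n))\<^sup>2)"
    using weights_one[OF n lam] sigma_bounds[OF n] \<sigma> r_pos[OF n] S n
    by (simp only:) (rule risk_difference_le[OF n _ _ _ _ basis basis_bound[OF n]]; simp)
qed

end
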